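(* Let $b>\frac23$ and $f\in F_b$. In the family of solutions $u$ described in the context, the radiation profile $v_1$ depends only on $f$, while there is a one-parameter family of $\lambda_0\in\Lambda_b$ corresponding to the given $f$ (i.e. satisfying $\frac{\lambda_0''(t)}{\lambda_0(t)}=\frac{f'(t)}{t}$ for $t \geq T_{\lambda_0}$). In particular, this family of solutions includes functions of the form $$Q_{\frac{1}{\lambda(t)}}(r)+v_1(t,r)+o(1)$$ for a one-parameter family of possible asymptotic values of $\lambda(t)$, and the same $v_1$.
   Context: The equation is the equivariant Yang-Mills equation $$-\partial_{tt}u+\partial_{rr}u+\frac1r\partial_ru+\frac{2u(1-u^2)}{r^2}=0,$$ with solitons $Q_\mu(r)=Q_1(\mu r)$, $Q_1(r)=\frac{1-r^2}{1+r^2}$, and conserved energy $E_{YM}(u,\partial_tu)=\frac12\int_0^\infty\left((\partial_tu)^2+(\partial_ru)^2+\frac{(1-u^2)^2}{r^2}\right)r\,dr$. Also set $E(v,\partial_tv)=\frac12\int_0^\infty\left((\partial_tv)^2+(\partial_rv)^2+\frac{4v^2}{r^2}\right)r\,dr$. For $b>\frac23$, $F_b$ is the set of functions $f$ for which there exist $M>50$ and constants $C_{f,k}>0$ with $f\in C^\infty([M,\infty))$ and $|f^{(k)}(t)|\le\frac{C_{f,k}}{t^k\log^b(t)}$ for all $t\ge M$, $k\ge0$. $\Lambda_b$ is the set of functions $\lambda_0$ for which there is $T_{\lambda_0}>50$ with $\lambda_0\in C^\infty([T_{\lambda_0},\infty))$ such that (i) there is $f\in F_b$ with $\frac{\lambda_0''(t)}{\lambda_0(t)}=\frac{f'(t)}{t}$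 for $t\ge T_{\lambda_0}$, and (ii) $\lambda_0(t)>0$ and $\frac{|\lambda_0'(t)|}{\lambda_0(t)}\le\frac{C}{t\log^b(t)}$ for $t\ge T_{\lambda_0}$. Radiation profile of $f$: $v_1$ solves $-\partial_{tt}v_1+\partial_{rr}v_1+\frac1r\partial_rv_1-\frac{4v_1}{r^2}=0$, $v_1(0)=0$, $\partial_tv_1(0)=v_{1,1}$, where $$\widehat{v_{1,1}}(\xi)=\frac{8}{3\pi\xi^2}\int_0^\infty\frac{(\psi\cdot f)'(t)}{t}\sin(t\xi)\,dt,$$ $\widehat{g}(\xi)=\int_0^\infty g(r)J_2(r\xi)r\,dr$ is the Hankel transform of order 2, and $\psi\in C^\infty([0,\infty))$ is a fixed (unimportant) cutoff with $0\le\psi\le1$, $\psi(x)=0$ for $x\le T_{\lambda_0}$, $\psi(x)=1$ for $x\ge2T_{\lambda_0}$; the number $T_{\lambda_0}>50$ may be taken the same for the whole one-parameter family of $\lambda_0$ corresponding to $f$, and larger than $M$, and $\psi f$ is extended by $0$ to $[0,T_{\lambda_0}]$. Family of solutions: for every $b>\frac23$, $f\in F_b$ and $\lambda_0\in\Lambda_b$ with $\frac{\lambda_0''(t)}{\lambda_0(t)}=\frac{f'(t)}{t}$ for $t\ge T_{\lambda_0}$, there are $T_0=T_0(\lambda_0)$ and a finite energy solution $u(t,r)=Q_{\frac{1}{\lambda(t)}}(r)+v_1(t,r)+v_e(t,r)$ of the Yang-Mills equation for $t\ge T_0$, where $v_1$ is the radiation profile of $f$ with $E(v_1,\partial_tv_1)<\infty$,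 $E(v_e,\partial_tv_e)<\frac{C}{\log^{4b-2}(t)}$, and $\lambda(t)=\lambda_0(t)(1+e(t))$ with $\lambda\in C^4([T_0,\infty))$ and, for some $\epsilon_0>0$, $|e^{(k)}(t)|\le\frac{C}{t^k\log^{\epsilon_0}(t)}$ for $0\le k\le4$. Every $\lambda_0\in\Lambda_b$ has a positive limit as $t\to\infty$. The term $o(1)$ is the remainder $v_e$, and is understood as $t\to\infty$. *)

theory Defs
  imports "HOL-Analysis.Analysis"
begin

section \<open>Smooth functions on closed half-lines\<close>

text \<open>Derivatives are taken within the set, hence one-sided at the end point of a half-line.\<close>

definition deriv_on :: "real set \<Rightarrow> (real \<Rightarrow> real) \<Rightarrow> real \<Rightarrow> real" where
  "deriv_on S g t = vector_derivative g (at t within S)"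

definition Ck_on :: "nat \<Rightarrow> real set \<Rightarrow> (real \<Rightarrow> real) \<Rightarrow> bool" where
  "Ck_on k S g \<longleftrightarrow>
     (\<forall>j<k. ((deriv_on S ^^ j) g) differentiable_on S) \<and> continuous_on S ((deriv_on S ^^ k) g)"

definition Cinf_on :: "real set \<Rightarrow> (real \<Rightarrow> real) \<Rightarrow> bool" where
  "Cinf_on S g \<longleftrightarrow> (\<forall>k. Ck_on k S g)"


section \<open>The classes \<open>F_b\<close> and \<open>\<Lambda>_b\<close>\<close>

definition symbol_from :: "real \<Rightarrow> real \<Rightarrow> (real \<Rightarrow> real) \<Rightarrow> bool" where
  "symbol_from b M f \<longleftrightarrow> M > 50 \<and> Cinf_on {M..} f \<and>
     (\<forall>k. \<exists>C>0. \<forall>t\<ge>M. \<bar>(deriv_on {M..} ^^ k) f t\<bar> \<le> C / (t ^ k * ln t powr b))"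

definition F_class :: "real \<Rightarrow> (real \<Rightarrow> real) set" where
  "F_class b = {f. \<exists>M. symbol_from b M f}"

definition corresponds :: "real \<Rightarrow> (real \<Rightarrow> real) \<Rightarrow> (real \<Rightarrow> real) \<Rightarrow> bool" where
  "corresponds T f lam0 \<longleftrightarrow>
     (\<forall>t\<ge>T. (deriv_on {T..} ^^ 2) lam0 t / lam0 t = deriv_on {T..} f t / t)"

text \<open>\<open>Lambda_from b T\<close> is the set of members of \<open>\<Lambda>_b\<close> for which \<open>T\<close> is an admissible
  \<open>T\<^sub>\<lambda>\<^sub>0\<close>. The condition \<open>M \<le> T\<close> makes \<open>f'\<close> meaningful on \<open>[T, \<infinity>)\<close>.\<close>

definition Lambda_from :: "real \<Rightarrow> real \<Rightarrow> (real \<Rightarrow> real) set" where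
  "Lambda_from b T = {lam0. T > 50 \<and> Cinf_on {T..} lam0 \<and>
     (\<exists>M f. symbol_from b M f \<and> M \<le> T \<and> corresponds T f lam0) \<and>
     (\<exists>C. \<forall>t\<ge>T. lam0 t > 0 \<and> \<bar>deriv_on {T..} lam0 t\<bar> / lam0 t \<le> C / (t * ln t powr b))}"


section \<open>Solitons and energies\<close>

definition Q1 :: "real \<Rightarrow> real" where
  "Q1 r = (1 - r\<^sup>2) / (1 + r\<^sup>2)"

definition Q :: "real \<Rightarrow> real \<Rightarrow> real" where
  "Q mu r = Q1 (mu * r)"

text \<open>In both energies the arguments are the values at a fixed time of the function, of its
  time derivative and of its radial derivative.\<close>

definition E_YM :: "(real \<Rightarrow> real) \<Rightarrow> (real \<Rightarrow> real) \<Rightarrow> (real \<Rightarrow> real) \<Rightarrow> ennreal" where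
  "E_YM u ut ur =
     (\<integral>\<^sup>+r\<in>{0<..}. ennreal (1/2 * ((ut r)\<^sup>2 + (ur r)\<^sup>2 + (1 - (u r)\<^sup>2)\<^sup>2 / r\<^sup>2) * r) \<partial>lborel)"

definition E_lin :: "(real \<Rightarrow> real) \<Rightarrow> (real \<Rightarrow> real) \<Rightarrow> (real \<Rightarrow> real) \<Rightarrow> ennreal" where
  "E_lin v vt vr =
     (\<integral>\<^sup>+r\<in>{0<..}. ennreal (1/2 * ((vt r)\<^sup>2 + (vr r)\<^sup>2 + 4 * (v r)\<^sup>2 / r\<^sup>2) * r) \<partial>lborel)"


section \<open>The radiation profile\<close>

definition bessel_J :: "nat \<Rightarrow> real \<Rightarrow> real" where
  "bessel_J n x = (\<Sum>m. (-1) ^ m / (fact m * fact (m + n)) * (x / 2) ^ (2 * m + n))"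

text \<open>For data that are merely square integrable with respect to \<open>r dr\<close>, the Hankel integral
  converges in general only as an improper integral at infinity; \<open>has_integral\<close> over an unbounded
  interval is this notion.\<close>

definition has_hankel2 :: "(real \<Rightarrow> real) \<Rightarrow> (real \<Rightarrow> real) \<Rightarrow> bool" where
  "has_hankel2 g ghat \<longleftrightarrow>
     (\<forall>\<xi>>0. ((\<lambda>r. g r * bessel_J 2 (r * \<xi>) * r) has_integral ghat \<xi>) {0<..})"

definition is_cutoff :: "real \<Rightarrow> (real \<Rightarrow> real) \<Rightarrow> bool" where
  "is_cutoff T \<psi> \<longleftrightarrow> Cinf_on {0..} \<psi> \<and> (\<forall>x\<ge>0. 0 \<le> \<psi> x \<and> \<psi> x \<le> 1) \<and>
     (\<forall>x\<in>{0..T}. \<psi> x = 0) \<and> (\<forall>x\<ge>2*T. \<psi> x = 1)"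

text \<open>As \<open>\<psi>\<close> vanishes on \<open>[0, T]\<close>, the product \<open>\<psi> f\<close> does so too, whatever the values of \<open>f\<close>
  there.\<close>

definition profile_data_hat :: "(real \<Rightarrow> real) \<Rightarrow> (real \<Rightarrow> real) \<Rightarrow> real \<Rightarrow> real" where
  "profile_data_hat \<psi> f \<xi> = 8 / (3 * pi * \<xi>\<^sup>2) *
     integral {0<..} (\<lambda>t. deriv (\<lambda>s. \<psi> s * f s) t / t * sin (t * \<xi>))"

definition has_partials_on ::
  "(real \<times> real) set \<Rightarrow> (real \<Rightarrow> real \<Rightarrow> real) \<Rightarrow> (real \<Rightarrow> real \<Rightarrow> real) \<Rightarrow> (real \<Rightarrow> real \<Rightarrow> real) \<Rightarrow> bool"
  where
  "has_partials_on D v vt vr \<longleftrightarrow>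
     continuous_on D (\<lambda>z. vt (fst z) (snd z)) \<and> continuous_on D (\<lambda>z. vr (fst z) (snd z)) \<and>
     (\<forall>(t, r)\<in>D. ((\<lambda>z. v (fst z) (snd z)) has_derivative
         (\<lambda>h. vt t r * fst h + vr t r * snd h)) (at (t, r) within D))"

definition linear_wave_solution ::
  "(real \<Rightarrow> real \<Rightarrow> real) \<Rightarrow> (real \<Rightarrow> real \<Rightarrow> real) \<Rightarrow> (real \<Rightarrow> real \<Rightarrow> real) \<Rightarrow> bool" where
  "linear_wave_solution v vt vr \<longleftrightarrow>
     (let D = {0..} \<times> {0<..} in
      has_partials_on D v vt vr \<and>
      (\<exists>vtt vtr vrt vrr. has_partials_on D vt vtt vtr \<and> has_partials_on D vr vrt vrr \<and>
         (\<forall>(t, r)\<in>D. - vtt t r + vrr t r + 1 / r * vr t r - 4 * v t r / r\<^sup>2 = 0)))"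

text \<open>The energy is conserved, so finiteness of the energy is finiteness of its supremum over time.
  It replaces a boundary condition at \<open>r = 0\<close>.\<close>

definition radiation_profile ::
  "(real \<Rightarrow> real) \<Rightarrow> (real \<Rightarrow> real) \<Rightarrow> (real \<Rightarrow> real \<Rightarrow> real) \<Rightarrow> bool" where
  "radiation_profile \<psi> f v \<longleftrightarrow>
     (\<exists>vt vr. linear_wave_solution v vt vr \<and>
        (\<forall>r>0. v 0 r = 0) \<and> has_hankel2 (vt 0) (profile_data_hat \<psi> f) \<and>
        (SUP t\<in>{0..}. E_lin (v t) (vt t) (vr t)) < \<infinity>)"


section \<open>Finite energy solutions\<close>

text \<open>A solution of finite energy need not be twice differentiable. Its first derivatives are weak
  ones and the Yang-Mills equation is tested against compactly supported functions; \<open>C\<^sup>1\<close>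
  test functions give the same notion as smooth ones.\<close>

definition test_function ::
  "real \<Rightarrow> (real \<Rightarrow> real \<Rightarrow> real) \<Rightarrow> (real \<Rightarrow> real \<Rightarrow> real) \<Rightarrow> (real \<Rightarrow> real \<Rightarrow> real) \<Rightarrow> bool" where
  "test_function T \<phi> \<phi>t \<phi>r \<longleftrightarrow> has_partials_on UNIV \<phi> \<phi>t \<phi>r \<and>
     (\<exists>K. compact K \<and> K \<subseteq> {T<..} \<times> {0<..} \<and> (\<forall>t r. (t, r) \<notin> K \<longrightarrow> \<phi> t r = 0))"

definition locally_integrable :: "real \<Rightarrow> (real \<Rightarrow> real \<Rightarrow> real) \<Rightarrow> bool" where
  "locally_integrable T v \<longleftrightarrow>
     (\<forall>K. compact K \<and> K \<subseteq> {T<..} \<times> {0<..} \<longrightarrow> set_integrable lborel K (\<lambda>z. v (fst z) (snd z)))"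

text \<open>\<open>energy_path T v vt vr\<close>: \<open>vt\<close> and \<open>vr\<close> are the weak partial derivatives of \<open>v\<close>, and \<open>(v, vt)\<close>
  is a continuous function of time \<open>t \<ge> T\<close> for the norm \<open>E_lin\<close>. Continuity determines \<open>vt t\<close> and
  \<open>vr t\<close> almost everywhere for every single \<open>t\<close>.\<close>

definition energy_path ::
  "real \<Rightarrow> (real \<Rightarrow> real \<Rightarrow> real) \<Rightarrow> (real \<Rightarrow> real \<Rightarrow> real) \<Rightarrow> (real \<Rightarrow> real \<Rightarrow> real) \<Rightarrow> bool" where
  "energy_path T v vt vr \<longleftrightarrow>
     (\<forall>t\<ge>T. \<forall>g\<in>{v, vt, vr}. g t \<in> borel_measurable (restrict_space borel {0<..})) \<and>
     (\<forall>g\<in>{v, vt, vr}. locally_integrable T g) \<and>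
     (\<forall>\<phi> \<phi>t \<phi>r. test_function T \<phi> \<phi>t \<phi>r \<longrightarrow>
        (LINT z|lborel. v (fst z) (snd z) * \<phi>t (fst z) (snd z)) =
          - (LINT z|lborel. vt (fst z) (snd z) * \<phi> (fst z) (snd z)) \<and>
        (LINT z|lborel. v (fst z) (snd z) * \<phi>r (fst z) (snd z)) =
          - (LINT z|lborel. vr (fst z) (snd z) * \<phi> (fst z) (snd z))) \<and>
     (\<forall>t0\<ge>T. ((\<lambda>t. E_lin (\<lambda>r. v t r - v t0 r) (\<lambda>r. vt t r - vt t0 r) (\<lambda>r. vr t r - vr t0 r))
        \<longlongrightarrow> 0) (at t0 within {T..}))"

definition YM_finite_energy_solution :: "real \<Rightarrow> (real \<Rightarrow> real \<Rightarrow> real) \<Rightarrow> bool" where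
  "YM_finite_energy_solution T u \<longleftrightarrow>
     (\<exists>ut ur. energy_path T u ut ur \<and>
        (\<forall>t\<ge>T. E_YM (u t) (ut t) (ur t) < \<infinity>) \<and>
        (\<forall>\<phi> \<phi>t \<phi>r. test_function T \<phi> \<phi>t \<phi>r \<longrightarrow>
           has_bochner_integral lborel
             (\<lambda>(t, r). (ut t r * \<phi>t t r - ur t r * \<phi>r t r
                + 2 * u t r * (1 - (u t r)\<^sup>2) / r\<^sup>2 * \<phi> t r) * r) 0))"


section \<open>The family of solutions\<close>

definition family_solution ::
  "real \<Rightarrow> (real \<Rightarrow> real) \<Rightarrow> (real \<Rightarrow> real) \<Rightarrow> real \<Rightarrow> (real \<Rightarrow> real) \<Rightarrow> real \<Rightarrow> (real \<Rightarrow> real \<Rightarrow> real) \<Rightarrow>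
     (real \<Rightarrow> real) \<Rightarrow> (real \<Rightarrow> real \<Rightarrow> real) \<Rightarrow> (real \<Rightarrow> real \<Rightarrow> real) \<Rightarrow> bool" where
  "family_solution b f \<psi> T lam0 T0 u lam v1 ve \<longleftrightarrow>
     T0 \<ge> T \<and>
     YM_finite_energy_solution T0 u \<and>
     (\<forall>t\<ge>T0. lam t > 0 \<and> (\<forall>r>0. u t r = Q (1 / lam t) r + v1 t r + ve t r)) \<and>
     radiation_profile \<psi> f v1 \<and>
     (\<exists>vet ver C. energy_path T0 ve vet ver \<and>
        (\<forall>t\<ge>T0. E_lin (ve t) (vet t) (ver t) < ennreal (C / ln t powr (4 * b - 2)))) \<and>
     Ck_on 4 {T0..} lam \<and>
     (\<exists>e. Ck_on 4 {T0..} e \<and> (\<forall>t\<ge>T0. lam t = lam0 t * (1 + e t)) \<and>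
        (\<exists>\<epsilon>0>0. \<exists>C. \<forall>k\<le>4. \<forall>t\<ge>T0.
           \<bar>(deriv_on {T0..} ^^ k) e t\<bar> \<le> C / (t ^ k * ln t powr \<epsilon>0)))"

definition energy_vanishes :: "real \<Rightarrow> (real \<Rightarrow> real \<Rightarrow> real) \<Rightarrow> bool" where
  "energy_vanishes T0 v \<longleftrightarrow>
     (\<exists>vt vr. energy_path T0 v vt vr \<and> ((\<lambda>t. E_lin (v t) (vt t) (vr t)) \<longlongrightarrow> 0) at_top)"

end

(* Idea. Write lam0' / lam0 = u / t. The equation for lam0 becomes a Riccati equation, that is, the
   fixed point equation u = f + t * int_t^oo (u^2 - f) / s^2 ds, which is a contraction on
   {|u| <= 4 A / log^b} for large t. The part of int u / s that is linear in f converges because it is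
   the derivative of - t * int_t^oo f / s^2, and the quadratic part converges because 2 b > 1. Two
   solutions are proportional: their Wronskian is constant, and it tends to 0 because the bound on
   lam0' / lam0 forces lam0 = O(sqrt t).

   The radiation profile is unique for two reasons. First, velocities with finite energy are
   determined by their (conditionally convergent) Hankel transform: the truncated transforms of a
   function with zero transform tend to 0 pointwise and are bounded in L^2 by Weber's second
   exponential integral and Schur's test, hence they tend to 0 weakly; tested against
   xi^3 exp(-s xi^2), Weber's first exponential integral turns this into the vanishing of all
   Gaussian moments int g(r) r^3 exp(-r^2 / (4 s)) dr. Second, a finite energy solution w with zero
   Cauchy data vanishes: W = int_0^t w has better behaviour at r = 0, and its energy in an annulus is
   the difference of the fluxes A(r) = r int_0^t W_r W_t through the two boundary circles, so A is
   nondecreasing, while |A| / r is integrable on (0, oo); therefore A = 0. *)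
theory Submission
  imports Defs "HOL-Probability.Distributions" "HOL-Real_Asymp.Real_Asymp"
begin

section \<open>Smooth functions on half-lines\<close>

text \<open>Uniqueness of the profile carries most of the weight because \<open>family\<close> hands
  out, for each member separately, some \<open>v1\<close> related to \<open>f\<close> by
  \<open>radiation_profile\<close>; only uniqueness lets one function serve all parameters. The
  Hankel transform is available just as an improper integral, so injectivity is not read off from
  Parseval or inversion. About J_2 only its power series and the crude bound exp x are used. Hence
  all weights in xi are Gaussians, which beat this growth, and the L^2 bound is proved with a
  damping exp(-q xi^2), under which the square of the transform expands into a positive explicit
  kernel. The passage to the time integral W is what closes the flux argument at r = 0. For w itself
  the flux r w_r w_t is integrable in dr, which excludes a nonzero limit at infinity but not a
  negative limit at r = 0. For W the flux is r W_r w, which the energy controls even after division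
  by r, and 1 / r is not integrable at either end.\<close>

lemma at_within_atLeast_neq_bot: 
  fixes t :: real
  assumes "t \<ge> T"
  shows "at t within {T..} \<noteq> bot"
proof
  assume "at t within {T..} = bot"
  moreover have "at t within {t<..} \<le> at t within {T..}"
    using assms by (intro at_le) auto
  ultimately show False
    using trivial_limit_at_right_real[of t] by (simp add: bot_unique)
qed

lemma deriv_on_eqI:
  assumes "(g has_real_derivative D) (at t within {T..})" "t \<ge> T"
  shows "deriv_on {T..} g t = D"
  unfolding deriv_on_def
  using assms at_within_atLeast_neq_bot[OF assms(2)]
  by (intro vector_derivative_within) (auto simp: has_real_derivative_iff_has_vector_derivative)

lemma has_real_derivative_deriv_on:
  assumes "g differentiable_on {T..}" "t \<ge> T"
  shows "(g has_real_derivative deriv_on {T..} g t) (at t within {T..})"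
proof -
  obtain D where "(g has_real_derivative D) (at t within {T..})"
    using assms by (auto simp: differentiable_on_def real_differentiable_def)
  then show ?thesis
    using deriv_on_eqI[OF _ assms(2)] by metis
qed

lemma differentiable_onI_real:
  assumes "\<And>t. t \<ge> T \<Longrightarrow> (g has_real_derivative D t) (at t within {T..})"
  shows "g differentiable_on {T..}"
  using assms by (auto simp: differentiable_on_def real_differentiable_def)

lemma deriv_on_cong:
  assumes "\<And>s. s \<ge> T \<Longrightarrow> g s = h s" "t \<ge> T"
  shows "deriv_on {T..} g t = deriv_on {T..} h t"
proof -
  have "(g has_vector_derivative D) (at t within {T..}) \<longleftrightarrow>
      (h has_vector_derivative D) (at t within {T..})" for D
    using assms by (metis atLeast_iff has_vector_derivative_transform)
  then show ?thesis
    by (simp add: deriv_on_def vector_derivative_def)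
qed

lemma deriv_on_funpow_cong:
  assumes "\<And>s. s \<ge> T \<Longrightarrow> g s = h s" "t \<ge> T"
  shows "(deriv_on {T..} ^^ k) g t = (deriv_on {T..} ^^ k) h t"
  using assms(2)
proof (induction k arbitrary: t)
  case (Suc k)
  then show ?case
    by (auto intro!: deriv_on_cong)
qed (use assms in auto)

lemma Ck_on_0: "Ck_on 0 S g \<longleftrightarrow> continuous_on S g"
  by (simp add: Ck_on_def)

lemma Ck_on_Suc: "Ck_on (Suc k) S g \<longleftrightarrow> g differentiable_on S \<and> Ck_on k S (deriv_on S g)"
proof -
  have "(deriv_on S ^^ j) (deriv_on S g) = (deriv_on S ^^ Suc j) g" for j
    by (simp add: funpow_swap1)
  then show ?thesis
    unfolding Ck_on_def by (subst All_less_Suc2) auto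
qed

lemma Ck_on_cong:
  assumes "\<And>s. s \<ge> T \<Longrightarrow> g s = h s"
  shows "Ck_on k {T..} g \<longleftrightarrow> Ck_on k {T..} h"
proof -
  have "(deriv_on {T..} ^^ j) g differentiable_on {T..} \<longleftrightarrow>
      (deriv_on {T..} ^^ j) h differentiable_on {T..}" for j
  proof -
    have *: "(deriv_on {T..} ^^ j) g t = (deriv_on {T..} ^^ j) h t" if "t \<ge> T" for t
      using deriv_on_funpow_cong[OF assms that] .
    have "((deriv_on {T..} ^^ j) g has_derivative D) (at t within {T..}) \<longleftrightarrow>
        ((deriv_on {T..} ^^ j) h has_derivative D) (at t within {T..})" if "t \<ge> T" for t D
      using * that has_derivative_transform[of t "{T..}"] by (metis atLeast_iff)
    then show ?thesis
      by (auto simp: differentiable_on_def differentiable_def)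
  qed
  moreover have "continuous_on {T..} ((deriv_on {T..} ^^ k) g) \<longleftrightarrow>
      continuous_on {T..} ((deriv_on {T..} ^^ k) h)"
    using deriv_on_funpow_cong[OF assms, where k=k] by (intro continuous_on_cong) auto
  ultimately show ?thesis
    by (simp add: Ck_on_def)
qed

lemma Ck_on_SucI:
  assumes "\<And>t. t \<ge> T \<Longrightarrow> (g has_real_derivative D t) (at t within {T..})" "Ck_on k {T..} D"
  shows "Ck_on (Suc k) {T..} g"
proof -
  have "Ck_on k {T..} (deriv_on {T..} g)"
    using assms deriv_on_eqI Ck_on_cong[of T "deriv_on {T..} g" D] by blast
  then show ?thesis
    using assms differentiable_onI_real by (auto simp: Ck_on_Suc)
qed

lemma Ck_on_SucE:
  assumes "Ck_on (Suc k) {T..} g"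
  obtains "\<And>t. t \<ge> T \<Longrightarrow> (g has_real_derivative deriv_on {T..} g t) (at t within {T..})"
    "Ck_on k {T..} (deriv_on {T..} g)"
  using assms has_real_derivative_deriv_on by (auto simp: Ck_on_Suc)

lemma Ck_on_mono:
  assumes "Ck_on k {T..} g" "j \<le> k"
  shows "Ck_on j {T..} g"
  using assms
proof (induction k arbitrary: g j)
  case (Suc k)
  show ?case
  proof (cases j)
    case 0
    then show ?thesis
      using Suc.prems by (auto simp: Ck_on_0 Ck_on_Suc differentiable_imp_continuous_on)
  next
    case (Suc i)
    then show ?thesis
      using Suc.prems Suc.IH by (auto simp: Ck_on_Suc)
  qed
qed auto

lemma Ck_on_const: "Ck_on k {T..} (\<lambda>t. c)"
proof (induction k arbitrary: c)
  case (Suc k)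
  show ?case
    by (rule Ck_on_SucI[where D="\<lambda>t. 0"]) (auto intro: Suc)
qed (simp add: Ck_on_0)

lemma Ck_on_add:
  assumes "Ck_on k {T..} g" "Ck_on k {T..} h"
  shows "Ck_on k {T..} (\<lambda>t. g t + h t)"
  using assms
proof (induction k arbitrary: g h)
  case (Suc k)
  show ?case
    using Suc.prems
    by (elim Ck_on_SucE, intro Ck_on_SucI[where D="\<lambda>t. deriv_on {T..} g t + deriv_on {T..} h t"])
      (auto intro!: derivative_eq_intros Suc.IH)
qed (auto simp: Ck_on_0 intro: continuous_intros)

lemma Ck_on_mult:
  assumes "Ck_on k {T..} g" "Ck_on k {T..} h"
  shows "Ck_on k {T..} (\<lambda>t. g t * h t)"
  using assms
proof (induction k arbitrary: g h)
  case (Suc k)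
  have "Ck_on k {T..} g" "Ck_on k {T..} h"
    using Suc.prems Ck_on_mono by fastforce+
  with Suc.prems show ?case
    by (elim Ck_on_SucE, intro Ck_on_SucI[where D="\<lambda>t. deriv_on {T..} g t * h t + g t * deriv_on {T..} h t"])
      (auto intro!: derivative_eq_intros Suc.IH Ck_on_add)
qed (auto simp: Ck_on_0 intro: continuous_intros)

lemma Ck_on_inverse:
  assumes "T > 0"
  shows "Ck_on k {T..} (\<lambda>t. 1 / t)"
proof (induction k)
  case (Suc k)
  have "Ck_on k {T..} (\<lambda>t. (-1) * (1 / t * (1 / t)))"
    by (intro Ck_on_mult Suc Ck_on_const)
  then show ?case
    by (rule Ck_on_SucI[rotated]) (use assms in \<open>auto intro!: derivative_eq_intros\<close>)
qed (use assms in \<open>auto simp: Ck_on_0 intro!: continuous_intros\<close>)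

lemma Ck_on_subset:
  assumes "Ck_on k {M..} g" "M \<le> T"
  shows "Ck_on k {T..} g"
  using assms(1)
proof (induction k arbitrary: g)
  case 0
  then show ?case
    using assms(2) by (auto simp: Ck_on_0 intro: continuous_on_subset)
next
  case (Suc k)
  show ?case
    using Suc.prems Suc.IH assms(2)
    by (elim Ck_on_SucE, intro Ck_on_SucI[where D="deriv_on {M..} g"])
      (auto intro: DERIV_subset[where s="{M..}"])
qed

lemma deriv_on_interior:
  assumes "t > T"
  shows "deriv_on {T..} g t = vector_derivative g (at t)"
proof -
  have "at t within {T..} = at t"
    by (rule at_within_interior) (use assms in simp)
  then show ?thesis
    by (simp add: deriv_on_def)
qed

text \<open>Bootstrap: the derivative of \<open>y\<close> is \<open>z\<close> and that of
  \<open>z\<close> is a smooth multiple of \<open>y\<close>, so the two are carried through the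
  induction on the order together.\<close>

lemma Cinf_on_linear_ode:
  assumes "Cinf_on {T..} q"
    and "\<And>t. t \<ge> T \<Longrightarrow> (y has_real_derivative z t) (at t within {T..})"
    and "\<And>t. t \<ge> T \<Longrightarrow> (z has_real_derivative q t * y t) (at t within {T..})"
  shows "Cinf_on {T..} y"
proof -
  have "Ck_on k {T..} y \<and> Ck_on k {T..} z" for k
  proof (induction k)
    case 0
    show ?case
      using DERIV_continuous_on[of "{T..}" y z] DERIV_continuous_on[of "{T..}" z "\<lambda>t. q t * y t"] assms(2,3)
      by (simp add: Ck_on_0)
  next
    case (Suc k)
    then have "Ck_on k {T..} (\<lambda>t. q t * y t)"
      using assms(1) by (auto simp: Cinf_on_def intro: Ck_on_mult)
    then show ?case
      using Suc Ck_on_SucI[of T y z k] Ck_on_SucI[of T z "\<lambda>t. q t * y t" k] assms(2,3) by simp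
  qed
  then show ?thesis
    by (simp add: Cinf_on_def)
qed

section \<open>The equation for \<open>\<lambda>\<^sub>0\<close>\<close>

text \<open>The weight 1 / s^2 has integral 1 / t over [t, \<infinity>), so
  \<open>t * tail_integral F t\<close> is the mean of \<open>F\<close> for a probability density on
  that half-line.\<close>

definition tail_integral :: "(real \<Rightarrow> real) \<Rightarrow> real \<Rightarrow> real" where
  "tail_integral F t = integral {t..} (\<lambda>s. F s / s\<^sup>2)"

lemma tail_integrable:
  fixes F :: "real \<Rightarrow> real"
  assumes "continuous_on {T..} F" "\<And>s. s \<ge> T \<Longrightarrow> \<bar>F s\<bar> \<le> B" "0 < T" "T \<le> t"
  shows "(\<lambda>s. F s / s\<^sup>2) integrable_on {t..}"
proof -
  have 1: "((\<lambda>x. 1 / x\<^sup>2) has_integral 1 / t) {t..}"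
    using has_integral_inverse_power_to_inf[of 2 t] assms by simp
  have "(\<lambda>s. F s / s\<^sup>2) absolutely_integrable_on {t..}"
  proof (rule measurable_bounded_by_integrable_imp_absolutely_integrable)
    show "(\<lambda>s. F s / s\<^sup>2) \<in> borel_measurable (lebesgue_on {t..})"
      using assms by (intro continuous_imp_measurable_on_sets_lebesgue continuous_intros)
        (auto intro: continuous_on_subset)
    show "(\<lambda>x. B * (1 / x\<^sup>2)) integrable_on {t..}"
      using 1 by (intro integrable_on_mult_right) (auto simp: integrable_on_def)
    show "norm (F x / x\<^sup>2) \<le> B * (1 / x\<^sup>2)" if "x \<in> {t..}" for x
      using assms that by (auto simp: abs_divide intro!: divide_right_mono)
  qed auto
  then show ?thesis
    using absolutely_integrable_on_def by blast
qed

text \<open>A mean stays within the bounds of the function. Two bounds occur: \<open>B\<close> on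
  the whole half-line secures integrability, while \<open>b\<close>, valid from \<open>t\<close> on,
  is the one that carries decay in \<open>t\<close>.\<close>

lemma tail_integral_bound:
  assumes "continuous_on {T..} F" "\<And>s. s \<ge> T \<Longrightarrow> \<bar>F s\<bar> \<le> B" "0 < T" "T \<le> t"
    and "\<And>s. s \<ge> t \<Longrightarrow> \<bar>F s\<bar> \<le> b"
  shows "\<bar>t * tail_integral F t\<bar> \<le> b"
proof -
  have 1: "((\<lambda>x. b * (1 / x\<^sup>2)) has_integral b * (1 / t)) {t..}"
    using has_integral_inverse_power_to_inf[of 2 t] assms by (intro has_integral_mult_right) simp
  have "norm (tail_integral F t) \<le> integral {t..} (\<lambda>x. b * (1 / x\<^sup>2))"
    unfolding tail_integral_def
  proof (rule integral_norm_bound_integral)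
    show "(\<lambda>s. F s / s\<^sup>2) integrable_on {t..}"
      using assms(1-4) by (rule tail_integrable)
    show "norm (F x / x\<^sup>2) \<le> b * (1 / x\<^sup>2)" if "x \<in> {t..}" for x
      using assms that by (auto simp: abs_divide intro!: divide_right_mono)
  qed (use 1 in \<open>auto simp: integrable_on_def\<close>)
  also have "\<dots> = b / t"
    using 1 by (simp add: integral_unique)
  finally show ?thesis
    using assms by (simp add: abs_mult field_simps)
qed

lemma has_real_derivative_integral_atLeast:
  fixes g :: "real \<Rightarrow> real"
  assumes "continuous_on {T..} g" "T \<le> t"
  shows "((\<lambda>x. integral {T..x} g) has_real_derivative g t) (at t within {T..})"
proof -
  have "((\<lambda>x. integral {T..x} g) has_real_derivative g t) (at t within {T..t+1})"
    by (rule integral_has_real_derivative) (use assms in \<open>auto intro: continuous_on_subset\<close>)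
  moreover have "at t within {T..t+1} = at t within {T..}"
    by (rule at_within_nhd[where S="{..<t+1}"]) auto
  ultimately show ?thesis
    by simp
qed

lemma has_real_derivative_tail_integral:
  assumes "continuous_on {T..} F" "\<And>s. s \<ge> T \<Longrightarrow> \<bar>F s\<bar> \<le> B" "0 < T" "T \<le> t"
  shows "(tail_integral F has_real_derivative - (F t / t\<^sup>2)) (at t within {T..})"
proof -
  have eq: "tail_integral F T - integral {T..x} (\<lambda>s. F s / s\<^sup>2) = tail_integral F x" if "x \<ge> T" for x
  proof -
    have "{T..x} \<union> {x..} = {T..}" "{T..x} \<inter> {x..} = {x}"
      using that by auto
    moreover have "(\<lambda>s. F s / s\<^sup>2) integrable_on {T..x}"
      by (rule integrable_on_subinterval[OF tail_integrable[OF assms(1-3) order_refl]]) auto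
    moreover have "(\<lambda>s. F s / s\<^sup>2) integrable_on {x..}"
      using assms(1-3) that by (rule tail_integrable)
    ultimately show ?thesis
      using integral_Un[of "\<lambda>s. F s / s\<^sup>2" "{T..x}" "{x..}"] by (simp add: tail_integral_def)
  qed
  have "((\<lambda>x. tail_integral F T - integral {T..x} (\<lambda>s. F s / s\<^sup>2)) has_real_derivative
      - (F t / t\<^sup>2)) (at t within {T..})"
    using assms
    by (auto intro!: derivative_eq_intros has_real_derivative_integral_atLeast continuous_intros)
  then show ?thesis
    by (rule has_field_derivative_transform_within[where d=1]) (use assms eq in auto)
qed

lemma tail_integral_diff:
  assumes "continuous_on {T..} F" "\<And>s. s \<ge> T \<Longrightarrow> \<bar>F s\<bar> \<le> B"
    and "continuous_on {T..} G" "\<And>s. s \<ge> T \<Longrightarrow> \<bar>G s\<bar> \<le> C" "0 < T" "T \<le> t"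
  shows "tail_integral F t - tail_integral G t = tail_integral (\<lambda>s. F s - G s) t"
  unfolding tail_integral_def diff_divide_distrib
  using assms by (intro integral_diff[symmetric] tail_integrable)

text \<open>With \<open>w = u / t\<close> the fixed point equation says that
  \<open>w' + w\<^sup>2 = f' / t\<close>.\<close>

lemma riccati_fixed_point:
  assumes "0 < T" and f: "continuous_on {T..} f" "\<And>t. t \<ge> T \<Longrightarrow> \<bar>f t\<bar> \<le> B t"
    and B: "\<And>s t. T \<le> s \<Longrightarrow> s \<le> t \<Longrightarrow> B t \<le> B s" "16 * B T \<le> 1"
  obtains u where "continuous_on {T..} u" "\<And>t. t \<ge> T \<Longrightarrow> \<bar>u t\<bar> \<le> 4 * B t"
    "\<And>t. t \<ge> T \<Longrightarrow> u t = f t + t * tail_integral (\<lambda>s. (u s)\<^sup>2 - f s) t"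
proof -
  have B0: "0 \<le> B t" "B t \<le> B T" if "t \<ge> T" for t
    using f(2)[OF that] B(1)[of T t] that by auto
  \<comment> \<open>Bounded continuous functions live on the whole line, so \<open>max t T\<close>
    freezes both the bound and \<open>\<Phi>\<close> to the left of \<open>T\<close>; only values on
    [T, \<infinity>) matter.\<close>
  define S where "S = PiC UNIV (\<lambda>t. {- 4 * B (max t T) .. 4 * B (max t T)})"
  define \<Phi> where "\<Phi> v t = f (max t T) + max t T * tail_integral (\<lambda>s. (v s)\<^sup>2 - f s) (max t T)"
    for v :: "real \<Rightarrow> real" and t
  have S: "u \<in> S \<longleftrightarrow> (\<forall>t. \<bar>apply_bcontfun u t\<bar> \<le> 4 * B (max t T))" for u
    by (auto simp: S_def mem_PiC_iff Pi_iff abs_le_iff) (smt (verit))+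
  \<comment> \<open>The smallness \<open>16 * B T \<le> 1\<close> serves twice: it gives (4 B)^2
    \<le> B here, and later |u + v| \<le> 8 B T \<le> 1/2, the contraction constant. With B from
    \<open>f\<close> and 2 B from the integral, \<open>\<Phi>\<close> stays within 3 B, inside the
    allowed 4 B.\<close>
  have sq: "\<bar>(u t)\<^sup>2 - f t\<bar> \<le> 2 * B t" if "t \<ge> T" "\<bar>u t\<bar> \<le> 4 * B t" for u t
  proof -
    have "(u t)\<^sup>2 \<le> (4 * B t)\<^sup>2"
      using that by (metis abs_ge_zero power2_abs power_mono)
    also have "\<dots> = (16 * B t) * B t"
      by (simp add: power2_eq_square)
    also have "\<dots> \<le> 1 * B t"
      using B0[OF that(1)] B(2) by (intro mult_right_mono) auto
    finally have "(u t)\<^sup>2 \<le> B t" by simp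
    then show ?thesis
      using f(2)[OF that(1)] zero_le_power2[of "u t"] by linarith
  qed
  have cont: "continuous_on {T..} (\<lambda>s. (apply_bcontfun u s)\<^sup>2 - f s)" for u
    by (intro continuous_intros f) auto
  have bd: "\<bar>(apply_bcontfun u s)\<^sup>2 - f s\<bar> \<le> 2 * B t" if "u \<in> S" "s \<ge> t" "t \<ge> T" for u s t
  proof -
    have "\<bar>apply_bcontfun u s\<bar> \<le> 4 * B s"
      using that S[of u] by (metis max.absorb1 order_trans)
    then have "\<bar>(apply_bcontfun u s)\<^sup>2 - f s\<bar> \<le> 2 * B s"
      using that sq[of s "apply_bcontfun u"] by auto
    then show ?thesis
      using B(1)[of t s] that by auto
  qed
  have \<Phi>: "\<bar>\<Phi> (apply_bcontfun u) t\<bar> \<le> 4 * B (max t T)" if "u \<in> S" for u t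
  proof -
    have "\<bar>max t T * tail_integral (\<lambda>s. (apply_bcontfun u s)\<^sup>2 - f s) (max t T)\<bar> \<le> 2 * B (max t T)"
      by (rule tail_integral_bound[OF cont bd[OF that]]) (use assms bd[OF that] in auto)
    then show ?thesis
      unfolding \<Phi>_def using f(2)[of "max t T"] B0(1)[of "max t T"] by (smt (verit) max.cobounded2)
  qed
  have \<Phi>_cont: "continuous_on UNIV (\<Phi> (apply_bcontfun u))" if "u \<in> S" for u
  proof -
    have "(tail_integral (\<lambda>s. (apply_bcontfun u s)\<^sup>2 - f s) has_real_derivative
        - (((apply_bcontfun u t)\<^sup>2 - f t) / t\<^sup>2)) (at t within {T..})" if "t \<ge> T" for t
      using has_real_derivative_tail_integral[OF cont bd[OF \<open>u \<in> S\<close>]] assms that by blast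
    then have "continuous_on {T..} (tail_integral (\<lambda>s. (apply_bcontfun u s)\<^sup>2 - f s))"
      by (intro DERIV_continuous_on) auto
    then have "continuous_on {T..} (\<lambda>t. f t + t * tail_integral (\<lambda>s. (apply_bcontfun u s)\<^sup>2 - f s) t)"
      by (intro continuous_intros f)
    moreover have "continuous_on UNIV (\<lambda>t. max t T)" "range (\<lambda>t. max t T) \<subseteq> {T..}"
      by (auto intro!: continuous_intros)
    ultimately show ?thesis
      unfolding \<Phi>_def by (rule continuous_on_compose2)
  qed
  have bc: "\<Phi> (apply_bcontfun u) \<in> bcontfun" if "u \<in> S" for u
  proof (rule bcontfun_normI[OF \<Phi>_cont[OF that]])
    show "norm (\<Phi> (apply_bcontfun u) t) \<le> 4 * B T" for t
      using \<Phi>[OF that, of t] B0(2)[of "max t T"] by auto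
  qed
  have "closed S"
    unfolding S_def by (intro closed_PiC) auto
  have "\<exists>!u\<in>S. Bcontfun (\<Phi> (apply_bcontfun u)) = u"
  proof (rule Banach_fix[where c="1/2", OF complete_eq_closed[THEN iffD2, OF \<open>closed S\<close>]])
    have "0 \<in> S"
      using B0(1) by (auto simp: S zero_bcontfun.rep_eq)
    then show "S \<noteq> {}" by auto
    show "(\<lambda>u. Bcontfun (\<Phi> (apply_bcontfun u))) ` S \<subseteq> S"
      using \<Phi> bc by (auto simp: S Bcontfun_inverse)
    show "dist (Bcontfun (\<Phi> (apply_bcontfun u))) (Bcontfun (\<Phi> (apply_bcontfun v))) \<le> 1/2 * dist u v"
      if "u \<in> S" "v \<in> S" for u v
    proof (rule dist_bound)
      fix t
      let ?t = "max t T"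
      have *: "\<bar>((apply_bcontfun u s)\<^sup>2 - f s) - ((apply_bcontfun v s)\<^sup>2 - f s)\<bar> \<le> 1/2 * dist u v"
        if "s \<ge> T" for s
      proof -
        have "\<bar>apply_bcontfun u s\<bar> \<le> 4 * B T" "\<bar>apply_bcontfun v s\<bar> \<le> 4 * B T"
          using \<open>u \<in> S\<close> \<open>v \<in> S\<close> S B0(2)[OF that] that
          by (metis max.absorb1 mult_left_mono order_trans zero_le_numeral)+
        then have 1: "\<bar>apply_bcontfun u s + apply_bcontfun v s\<bar> \<le> 1/2"
          using B(2) by linarith
        have "((apply_bcontfun u s)\<^sup>2 - f s) - ((apply_bcontfun v s)\<^sup>2 - f s) =
            (apply_bcontfun u s + apply_bcontfun v s) * (apply_bcontfun u s - apply_bcontfun v s)"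
          by (simp add: algebra_simps power2_eq_square)
        then show ?thesis
          using mult_mono[OF 1 dist_bounded[of u s v, unfolded dist_real_def]]
          by (simp add: abs_mult)
      qed
      have "\<Phi> (apply_bcontfun u) t - \<Phi> (apply_bcontfun v) t = ?t *
          (tail_integral (\<lambda>s. (apply_bcontfun u s)\<^sup>2 - f s) ?t -
           tail_integral (\<lambda>s. (apply_bcontfun v s)\<^sup>2 - f s) ?t)"
        by (simp add: \<Phi>_def algebra_simps)
      also have "\<dots> = ?t * tail_integral
          (\<lambda>s. ((apply_bcontfun u s)\<^sup>2 - f s) - ((apply_bcontfun v s)\<^sup>2 - f s)) ?t"
        using assms by (subst tail_integral_diff[OF cont bd[OF that(1)] cont bd[OF that(2)]]) auto
      finally have eq: "\<Phi> (apply_bcontfun u) t - \<Phi> (apply_bcontfun v) t = \<dots>" .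
      have "\<bar>\<Phi> (apply_bcontfun u) t - \<Phi> (apply_bcontfun v) t\<bar> \<le> 1/2 * dist u v"
        unfolding eq
        by (rule tail_integral_bound[where T=T and B="1/2 * dist u v"])
          (use assms * in \<open>auto intro!: continuous_intros\<close>)
      then show "dist (apply_bcontfun (Bcontfun (\<Phi> (apply_bcontfun u))) t)
          (apply_bcontfun (Bcontfun (\<Phi> (apply_bcontfun v))) t) \<le> 1/2 * dist u v"
        using bc that by (simp add: Bcontfun_inverse dist_real_def)
    qed
  qed auto
  then obtain u where u: "u \<in> S" "Bcontfun (\<Phi> (apply_bcontfun u)) = u"
    by blast
  then have eq: "\<Phi> (apply_bcontfun u) = apply_bcontfun u"
    using bc by (metis Bcontfun_inverse)
  show ?thesis
  proof
    show "continuous_on {T..} (apply_bcontfun u)" by simp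
    show "\<bar>apply_bcontfun u t\<bar> \<le> 4 * B t" if "t \<ge> T" for t
      using u(1) that S[of u] by (metis max.absorb1)
    show "apply_bcontfun u t = f t + t * tail_integral (\<lambda>s. (apply_bcontfun u s)\<^sup>2 - f s) t"
      if "t \<ge> T" for t
      using fun_cong[OF eq, of t] that by (simp add: \<Phi>_def)
  qed
qed

section \<open>A positive solution that tends to 1\<close>

lemma mono_bounded_tendsto_at_top:
  fixes P :: "real \<Rightarrow> real"
  assumes mono: "\<And>s t. T \<le> s \<Longrightarrow> s \<le> t \<Longrightarrow> P s \<le> P t" and bdd: "\<And>t. T \<le> t \<Longrightarrow> P t \<le> C"
  obtains L where "(P \<longlongrightarrow> L) at_top"
proof
  let ?L = "SUP t\<in>{T..}. P t"
  have bdd': "bdd_above (P ` {T..})"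
    using bdd by (auto intro!: bdd_aboveI)
  show "(P \<longlongrightarrow> ?L) at_top"
  proof (rule order_tendstoI)
    fix a assume "a < ?L"
    then obtain t where "t \<ge> T" "a < P t"
      using bdd' by (auto simp: less_cSUP_iff)
    then show "eventually (\<lambda>x. a < P x) at_top"
      using mono by (intro eventually_at_top_linorderI[of t]) (meson less_le_trans)
  next
    fix a assume "a > ?L"
    then show "eventually (\<lambda>x. P x < a) at_top"
      using cSUP_upper[OF _ bdd'] by (intro eventually_at_top_linorderI[of T]) (meson atLeast_iff le_less_trans)
  qed
qed

lemma DERIV_nonpos_imp_antimono_within:
  fixes R :: "real \<Rightarrow> real"
  assumes "\<And>t. t \<ge> T \<Longrightarrow> (R has_real_derivative R' t) (at t within {T..})"
    and "\<And>t. t \<ge> T \<Longrightarrow> R' t \<le> 0" "T \<le> s" "s \<le> t"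
  shows "R t \<le> R s"
proof (rule DERIV_nonpos_imp_decreasing_open[OF \<open>s \<le> t\<close>])
  show "\<exists>y. (R has_real_derivative y) (at x) \<and> y \<le> 0" if "s < x" "x < t" for x
  proof -
    have "at x within {T..} = at x"
      by (rule at_within_interior) (use that assms in simp)
    then show ?thesis
      using assms(1,2)[of x] that assms(3) by auto
  qed
  have "continuous_on {T..} R"
    using assms(1) by (intro DERIV_continuous_on) auto
  then show "continuous_on {s..t} R"
    by (rule continuous_on_subset) (use assms in auto)
qed

lemma Lambda_fromI:
  assumes f: "symbol_from b M f" "M < T"
    and y: "\<And>t. t \<ge> T \<Longrightarrow> (y has_real_derivative z t) (at t within {T..})"
    and z: "\<And>t. t \<ge> T \<Longrightarrow> (z has_real_derivative deriv_on {T..} f t / t * y t) (at t within {T..})"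
    and pos: "\<And>t. t \<ge> T \<Longrightarrow> y t > 0"
    and bd: "\<And>t. t \<ge> T \<Longrightarrow> \<bar>z t\<bar> / y t \<le> C / (t * ln t powr b)"
  shows "y \<in> Lambda_from b T" "corresponds T f y"
proof -
  have T: "T > 50"
    using f by (auto simp: symbol_from_def)
  have "Ck_on k {T..} (\<lambda>t. deriv_on {T..} f t * (1 / t))" for k
  proof (intro Ck_on_mult Ck_on_inverse)
    have "Ck_on (Suc k) {M..} f"
      using f by (auto simp: symbol_from_def Cinf_on_def)
    then have "Ck_on (Suc k) {T..} f"
      by (rule Ck_on_subset) (use f in simp)
    then show "Ck_on k {T..} (deriv_on {T..} f)"
      using Ck_on_Suc by blast
  qed (use T in auto)
  then have "Cinf_on {T..} y"
    using y z by (intro Cinf_on_linear_ode[of T "\<lambda>t. deriv_on {T..} f t * (1 / t)" y z])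
      (auto simp: Cinf_on_def)
  moreover have y': "deriv_on {T..} y t = z t" if "t \<ge> T" for t
    using y that deriv_on_eqI by blast
  moreover have "(deriv_on {T..} ^^ 2) y t = deriv_on {T..} f t / t * y t" if "t \<ge> T" for t
    using that deriv_on_cong[of T "deriv_on {T..} y" z t] y' deriv_on_eqI[OF z]
    by (simp add: numeral_2_eq_2)
  ultimately show corr: "corresponds T f y"
    using pos by (auto simp: corresponds_def less_imp_neq[symmetric])
  show "y \<in> Lambda_from b T"
    unfolding Lambda_from_def
    using T \<open>Cinf_on {T..} y\<close> y' pos bd f(1) less_imp_le[OF f(2)] corr by auto
qed

text \<open>For the Riccati solution w = u / t, the exponential of an antiderivative of w solves the
  linear equation, and its logarithmic derivative w has the required size. The limit 1 is a
  normalization: multiples of this solution reach every positive limit. The threshold b > 1/2 is the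
  integrability of 1 / (t log^(2b) t) at infinity.\<close>

lemma asymptotically_constant_solution:
  assumes "b > 1/2" and f: "symbol_from b M f"
  obtains T y z C where "M < T"
    "\<And>t. t \<ge> T \<Longrightarrow> (y has_real_derivative z t) (at t within {T..})"
    "\<And>t. t \<ge> T \<Longrightarrow> (z has_real_derivative deriv_on {T..} f t / t * y t) (at t within {T..})"
    "\<And>t. t \<ge> T \<Longrightarrow> y t > 0" "\<And>t. t \<ge> T \<Longrightarrow> \<bar>z t\<bar> / y t \<le> C / (t * ln t powr b)"
    "(y \<longlongrightarrow> 1) at_top"
proof -
  have M: "M > 50"
    using f by (simp add: symbol_from_def)
  have "\<exists>C>0. \<forall>t\<ge>M. \<bar>(deriv_on {M..} ^^ 0) f t\<bar> \<le> C / (t ^ 0 * ln t powr b)"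
    using f unfolding symbol_from_def by blast
  then obtain A where A: "A > 0" "\<And>t. t \<ge> M \<Longrightarrow> \<bar>f t\<bar> \<le> A / ln t powr b"
    by auto
  define B where "B t = A / ln t powr b" for t
  have Blim: "(B \<longlongrightarrow> 0) at_top"
    unfolding B_def using assms(1) by real_asymp
  then have "eventually (\<lambda>t. B t < 1/16 \<and> t > M) at_top"
    by (intro eventually_conj order_tendstoD(2) eventually_gt_at_top) auto
  then obtain T where T: "B T < 1/16" "T > M"
    using eventually_happens'[OF trivial_limit_at_top_linorder] by blast
  have fM: "Ck_on (Suc 0) {M..} f"
    using f by (simp add: symbol_from_def Cinf_on_def)
  have f': "(f has_real_derivative deriv_on {T..} f t) (at t within {T..})" if "t \<ge> T" for t
  proof -
    have "Ck_on (Suc 0) {T..} f"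
      by (rule Ck_on_subset[OF fM]) (use T in simp)
    then have "f differentiable_on {T..}"
      using Ck_on_Suc by blast
    then show ?thesis
      using that by (rule has_real_derivative_deriv_on)
  qed
  then have fcont: "continuous_on {T..} f"
    by (intro DERIV_continuous_on) auto
  have fB: "\<bar>f t\<bar> \<le> B t" if "t \<ge> T" for t
    using that T A by (simp add: B_def)
  have Banti: "B t \<le> B s" if "T \<le> s" "s \<le> t" for s t
    unfolding B_def using that T M A assms(1)
    by (intro divide_left_mono powr_mono2 mult_pos_pos) auto
  have T0: "0 < T" "1 < T" using T M by auto
  obtain u where u: "continuous_on {T..} u" "\<And>t. t \<ge> T \<Longrightarrow> \<bar>u t\<bar> \<le> 4 * B t"
    "\<And>t. t \<ge> T \<Longrightarrow> u t = f t + t * tail_integral (\<lambda>s. (u s)\<^sup>2 - f s) t"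
    using riccati_fixed_point[OF T0(1) fcont fB Banti] T(1) by auto
  have u2: "(u s)\<^sup>2 \<le> 16 * (B t)\<^sup>2" if "t \<ge> T" "s \<ge> t" for s t
  proof -
    have "\<bar>u s\<bar> \<le> 4 * B t"
      using u(2)[of s] Banti[of t s] that by auto
    then have "\<bar>u s\<bar>\<^sup>2 \<le> (4 * B t)\<^sup>2"
      by (intro power_mono) auto
    then show ?thesis by (simp add: power_mult_distrib)
  qed
  have u2cont: "continuous_on {T..} (\<lambda>s. (u s)\<^sup>2)"
    by (intro continuous_intros u)
  have u2bd: "\<bar>(u s)\<^sup>2\<bar> \<le> 16 * (B T)\<^sup>2" if "s \<ge> T" for s
    using u2[of T s] that by simp
  have fbd: "\<bar>f s\<bar> \<le> B T" if "s \<ge> T" for s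
    using fB[OF that] Banti[of T s] that by simp
  have dJf: "(tail_integral f has_real_derivative - (f t / t\<^sup>2)) (at t within {T..})" if "t \<ge> T" for t
    using has_real_derivative_tail_integral[OF fcont fbd T0(1) that] .
  have dJu: "(tail_integral (\<lambda>s. (u s)\<^sup>2) has_real_derivative - ((u t)\<^sup>2 / t\<^sup>2)) (at t within {T..})"
    if "t \<ge> T" for t
    using has_real_derivative_tail_integral[OF u2cont u2bd T0(1) that] .
  define P where "P t = integral {T..t} (tail_integral (\<lambda>s. (u s)\<^sup>2))" for t
  have dP: "(P has_real_derivative tail_integral (\<lambda>s. (u s)\<^sup>2) t) (at t within {T..})" if "t \<ge> T" for t
    unfolding P_def using dJu that
    by (intro has_real_derivative_integral_atLeast DERIV_continuous_on) auto
  \<comment> \<open>The fixed point \<open>u\<close> is only known to be continuous. Written through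
    \<open>f\<close> and tail integrals, \<open>w\<close> can be differentiated, and the fixed point
    equation identifies it with \<open>u t / t\<close>.\<close>
  define w where "w t = f t / t + (tail_integral (\<lambda>s. (u s)\<^sup>2) t - tail_integral f t)" for t
  have w: "w t = u t / t" if "t \<ge> T" for t
    using u(3)[OF that] T0 that
    by (simp add: w_def tail_integral_diff[OF u2cont u2bd fcont fbd] field_simps)
  have dw: "(w has_real_derivative deriv_on {T..} f t / t - (w t)\<^sup>2) (at t within {T..})" if "t \<ge> T" for t
  proof -
    have "(w has_real_derivative (deriv_on {T..} f t * t - f t * 1) / (t * t) +
        (- ((u t)\<^sup>2 / t\<^sup>2) - - (f t / t\<^sup>2))) (at t within {T..})"
      unfolding w_def
      by (intro DERIV_add DERIV_diff DERIV_divide DERIV_ident f' dJf dJu that) (use that T0 in auto)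
    then show ?thesis
      by (rule DERIV_cong) (use that T0 in \<open>simp add: w[OF that] power_divide field_simps power2_eq_square\<close>)
  qed
  define y where "y t = exp (P t - t * tail_integral f t)" for t
  have dy: "(y has_real_derivative w t * y t) (at t within {T..})" if "t \<ge> T" for t
    unfolding y_def w_def using that T0
    by (auto intro!: derivative_eq_intros dJf dP simp: field_simps power2_eq_square)
  have dz: "((\<lambda>t. w t * y t) has_real_derivative deriv_on {T..} f t / t * y t) (at t within {T..})"
    if "t \<ge> T" for t
    using that by (auto intro!: derivative_eq_intros dw dy simp: algebra_simps power2_eq_square)
  have "((\<lambda>t. t * tail_integral f t) \<longlongrightarrow> 0) at_top"
  proof (rule Lim_null_comparison[OF _ Blim])
    show "eventually (\<lambda>t. norm (t * tail_integral f t) \<le> B t) at_top"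
    proof (rule eventually_at_top_linorderI[of T])
      fix t assume "t \<ge> T"
      moreover have "\<bar>f s\<bar> \<le> B t" if "s \<ge> t" for s
        using fB[of s] Banti[of t s] \<open>t \<ge> T\<close> that by auto
      ultimately show "norm (t * tail_integral f t) \<le> B t"
        using tail_integral_bound[OF fcont fbd T0(1)] by auto
    qed
  qed
  moreover obtain L where "(P \<longlongrightarrow> L) at_top"
  proof -
    have Ju: "0 \<le> tail_integral (\<lambda>s. (u s)\<^sup>2) t" "tail_integral (\<lambda>s. (u s)\<^sup>2) t \<le> 16 * (B t)\<^sup>2 / t"
      if "t \<ge> T" for t
    proof -
      show "0 \<le> tail_integral (\<lambda>s. (u s)\<^sup>2) t"
        unfolding tail_integral_def
        by (intro Henstock_Kurzweil_Integration.integral_nonneg tail_integrable[OF u2cont u2bd T0(1) that]) auto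
      have "\<bar>t * tail_integral (\<lambda>s. (u s)\<^sup>2) t\<bar> \<le> 16 * (B t)\<^sup>2"
        by (rule tail_integral_bound[OF u2cont u2bd T0(1) that]) (use u2 that in auto)
      then show "tail_integral (\<lambda>s. (u s)\<^sup>2) t \<le> 16 * (B t)\<^sup>2 / t"
        using T0 that by (simp add: field_simps)
    qed
    \<comment> \<open>\<open>P\<close> is nondecreasing and \<open>R\<close> nonincreasing\<close>
    define R where "R t = P t + 16 * A\<^sup>2 / (2 * b - 1) * ln t powr (1 - 2 * b)" for t
    have "(R has_real_derivative tail_integral (\<lambda>s. (u s)\<^sup>2) t - 16 * (B t)\<^sup>2 / t) (at t within {T..})"
      if "t \<ge> T" for t
    proof -
      have "ln t > 0" using that T0 by simp
      then have "(B t)\<^sup>2 = A\<^sup>2 * ln t powr (- 2 * b)"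
        by (simp add: B_def power_divide powr_power powr_minus field_simps)
      moreover have "((\<lambda>t. ln t powr (1 - 2 * b)) has_real_derivative
          (1 - 2 * b) * ln t powr (- 2 * b) / t) (at t within {T..})"
      proof (rule has_field_derivative_at_within)
        have "(ln has_real_derivative 1 / t) (at t)"
          using DERIV_ln_divide that T0 by auto
        from DERIV_fun_powr[OF this \<open>ln t > 0\<close>, of "1 - 2 * b"]
        show "((\<lambda>t. ln t powr (1 - 2 * b)) has_real_derivative
          (1 - 2 * b) * ln t powr (- 2 * b) / t) (at t)"
          by simp
      qed
      ultimately show ?thesis
        unfolding R_def using assms(1)
        by (intro DERIV_cong[OF DERIV_add[OF dP[OF that] DERIV_cmult]])
          (auto simp: divide_simps algebra_simps)
    qed
    then have R: "R t \<le> R s" if "T \<le> s" "s \<le> t" for s t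
      by (rule DERIV_nonpos_imp_antimono_within) (use Ju that in auto)
    show ?thesis
    proof (rule mono_bounded_tendsto_at_top[of T P "R T"])
      show "P s \<le> P t" if "T \<le> s" "s \<le> t" for s t
        using DERIV_nonpos_imp_antimono_within[of T "\<lambda>t. - P t" "\<lambda>t. - tail_integral (\<lambda>s. (u s)\<^sup>2) t" s t]
          Ju(1) dP that by (auto intro!: derivative_intros)
      show "P t \<le> R T" if "T \<le> t" for t
        using R[of T t] that assms(1) by (auto simp: R_def intro: order_trans[rotated])
    qed (use that in auto)
  qed
  ultimately have "((\<lambda>t. P t - t * tail_integral f t) \<longlongrightarrow> L - 0) at_top"
    by (intro tendsto_diff)
  then have "(y \<longlongrightarrow> exp L) at_top"
    unfolding y_def by (intro tendsto_exp) simp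
  then have lim: "((\<lambda>t. y t / exp L) \<longlongrightarrow> 1) at_top"
    using tendsto_divide[of y "exp L" at_top "\<lambda>_. exp L" "exp L"] by simp
  show ?thesis
  proof (rule that[OF T(2) _ _ _ _ lim])
    show "((\<lambda>t. y t / exp L) has_real_derivative w t * y t / exp L) (at t within {T..})" if "t \<ge> T" for t
      using dy[OF that] by (rule DERIV_cdivide)
    show "((\<lambda>t. w t * y t / exp L) has_real_derivative deriv_on {T..} f t / t * (y t / exp L))
        (at t within {T..})" if "t \<ge> T" for t
      using DERIV_cdivide[OF dz[OF that], of "exp L"] by simp
    show "y t / exp L > 0" for t by (simp add: y_def)
    show "\<bar>w t * y t / exp L\<bar> / (y t / exp L) \<le> 4 * A / (t * ln t powr b)" if "t \<ge> T" for t
    proof -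
      have "\<bar>w t * y t / exp L\<bar> / (y t / exp L) = \<bar>w t\<bar>"
        by (simp add: abs_mult y_def abs_divide)
      also have "\<dots> \<le> 4 * B t / t"
        using u(2)[OF that] that T0 by (simp add: w[OF that] abs_divide divide_right_mono)
      finally show ?thesis
        by (simp add: B_def mult.commute)
    qed
  qed
qed

section \<open>Comparison of two solutions by their Wronskian\<close>

lemma const_on_open_half_line:
  fixes g :: "real \<Rightarrow> real"
  assumes "\<And>t. t > N \<Longrightarrow> (g has_real_derivative 0) (at t)"
  obtains c where "\<And>t. t > N \<Longrightarrow> g t = c"
proof -
  have "\<exists>c. \<forall>t\<in>{N<..}. g t = c"
    by (rule has_field_derivative_zero_constant) (auto intro: assms has_field_derivative_at_within)
  then show ?thesis
    using that by auto
qed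

text \<open>The roles are asymmetric: \<open>y1\<close> is the normalized solution and bounded near
  infinity, while \<open>y\<close> is controlled by its logarithmic derivative alone. The Wronskian
  is O(y / t), which tends to 0 once \<open>y\<close> is O(sqrt t); then y / y1 has derivative
  0.\<close>

lemma proportional_solutions:
  fixes y y1 z z1 q :: "real \<Rightarrow> real"
  assumes N: "N > 1" and b: "b > 0"
    and y: "\<And>t. t > N \<Longrightarrow> (y has_real_derivative z t) (at t)"
      "\<And>t. t > N \<Longrightarrow> (z has_real_derivative q t * y t) (at t)"
    and y1: "\<And>t. t > N \<Longrightarrow> (y1 has_real_derivative z1 t) (at t)"
      "\<And>t. t > N \<Longrightarrow> (z1 has_real_derivative q t * y1 t) (at t)"
    and pos: "\<And>t. t > N \<Longrightarrow> y t > 0" "\<And>t. t > N \<Longrightarrow> y1 t > 0"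
    and bd: "\<And>t. t > N \<Longrightarrow> \<bar>z t\<bar> / y t \<le> C / (t * ln t powr b)"
      "\<And>t. t > N \<Longrightarrow> \<bar>z1 t\<bar> / y1 t \<le> C1 / (t * ln t powr b)"
    and lim: "(y1 \<longlongrightarrow> 1) at_top"
  obtains c where "c > 0" "\<And>t. t > N \<Longrightarrow> y t = c * y1 t"
proof -
  define W where "W t = z t * y1 t - y t * z1 t" for t
  have "(W has_real_derivative 0) (at t)" if "t > N" for t
    unfolding W_def
    by (rule DERIV_cong[OF DERIV_diff[OF DERIV_mult[OF y(2) y1(1)] DERIV_mult[OF y(1) y1(2)]]])
      (use that in \<open>auto simp: algebra_simps\<close>)
  then obtain w where w: "W t = w" if "t > N" for t
    using const_on_open_half_line by blast
  have "((\<lambda>t. C / ln t powr b) \<longlongrightarrow> 0) at_top" "((\<lambda>t. C1 / ln t powr b) \<longlongrightarrow> 0) at_top"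
    using b by real_asymp+
  \<comment> \<open>The value 1/2 becomes the exponent in y = O(t^(1/2)); any value below 1 would
    keep y / t null at infinity.\<close>
  then have "eventually (\<lambda>t. C / ln t powr b < 1/2 \<and> C1 / ln t powr b < 1/2 \<and> y1 t < 2 \<and> t > N) at_top"
    using lim by (intro eventually_conj order_tendstoD(2) eventually_gt_at_top) auto
  then obtain N1 where N1: "\<And>t. t \<ge> N1 \<Longrightarrow> C / ln t powr b < 1/2 \<and> C1 / ln t powr b < 1/2 \<and> y1 t < 2 \<and> t > N"
    by (auto simp: eventually_at_top_linorder)
  then have N1N: "N1 > N" by blast
  have zy: "\<bar>z t\<bar> \<le> y t / (2 * t)" "\<bar>z1 t\<bar> \<le> y1 t / (2 * t)" if "t \<ge> N1" for t
  proof -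
    have t: "t > N" "t > 0" using N1[OF that] N by auto
    have "C / (t * ln t powr b) = C / ln t powr b / t" "C1 / (t * ln t powr b) = C1 / ln t powr b / t"
      by (simp_all add: field_simps)
    moreover have "C / ln t powr b / t \<le> 1/2 / t" "C1 / ln t powr b / t \<le> 1/2 / t"
      using N1[OF that] t by (intro divide_right_mono; simp)+
    ultimately have "\<bar>z t\<bar> / y t \<le> 1/2 / t" "\<bar>z1 t\<bar> / y1 t \<le> 1/2 / t"
      using bd[OF t(1)] by linarith+
    then show "\<bar>z t\<bar> \<le> y t / (2 * t)" "\<bar>z1 t\<bar> \<le> y1 t / (2 * t)"
      using pos[OF t(1)] t(2) by (simp_all add: field_simps)
  qed
  define K where "K = y N1 / sqrt N1"
  have K: "y t \<le> K * sqrt t" if "t \<ge> N1" for t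
  proof -
    \<comment> \<open>The inequality z \<le> y / (2 t) says precisely that y / sqrt t does not
      increase.\<close>
    have "(\<lambda>t. y t / sqrt t) t \<le> (\<lambda>t. y t / sqrt t) N1"
    proof (rule DERIV_nonpos_imp_nonincreasing[OF that])
      fix x assume x: "N1 \<le> x" "x \<le> t"
      then have x': "x > N" "x > 0" using N1N N by auto
      have "((\<lambda>t. y t / sqrt t) has_real_derivative
          (z x * sqrt x - y x * (inverse (sqrt x) / 2)) / (sqrt x * sqrt x)) (at x)"
        using x' by (intro DERIV_divide y DERIV_real_sqrt) auto
      moreover have "z x * sqrt x \<le> y x * (inverse (sqrt x) / 2)"
      proof -
        have "z x * sqrt x \<le> y x / (2 * x) * sqrt x"
          using zy(1)[OF x(1)] x' by (intro mult_right_mono) auto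
        also have "\<dots> = y x * (inverse (sqrt x) / 2)"
          using x' by (simp add: field_simps)
        finally show ?thesis .
      qed
      ultimately show "\<exists>d. ((\<lambda>t. y t / sqrt t) has_real_derivative d) (at x) \<and> d \<le> 0"
        using x' by (intro exI conjI) (auto intro!: divide_nonpos_nonneg)
    qed
    then show ?thesis
      using that N1N N by (simp add: K_def field_simps)
  qed
  have "\<bar>w\<bar> \<le> 2 * K / sqrt t" if "t \<ge> N1" for t
  proof -
    have t: "t > N" "t > 0" "y1 t < 2" using N1[OF that] N by auto
    have "\<bar>w\<bar> \<le> \<bar>z t\<bar> * y1 t + y t * \<bar>z1 t\<bar>"
      using w[OF t(1)] pos[OF t(1)] by (auto simp: W_def abs_mult intro!: order_trans[OF abs_triangle_ineq4])
    also have "\<dots> \<le> y t / (2 * t) * y1 t + y t * (y1 t / (2 * t))"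
      using zy[OF that] pos[OF t(1)] by (intro add_mono mult_mono) auto
    also have "\<dots> = y t * y1 t / t"
      using t by (simp add: field_simps)
    also have "\<dots> \<le> (K * sqrt t) * 2 / t"
      using K[OF that] pos[OF t(1)] t by (intro divide_right_mono mult_mono) auto
    also have "\<dots> = 2 * K / sqrt t"
      using t by (simp add: field_simps)
    finally show ?thesis .
  qed
  then have "eventually (\<lambda>t. \<bar>w\<bar> \<le> 2 * K / sqrt t) at_top"
    by (rule eventually_at_top_linorderI)
  moreover have "((\<lambda>t. 2 * K / sqrt t) \<longlongrightarrow> 0) at_top"
    by real_asymp
  ultimately have "\<bar>w\<bar> \<le> 0"
    by (intro tendsto_le[OF _ _ tendsto_const]) auto
  then have W0: "z t * y1 t = y t * z1 t" if "t > N" for t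
    using w[OF that] by (simp add: W_def)
  have "((\<lambda>t. y t / y1 t) has_real_derivative 0) (at t)" if "t > N" for t
    using DERIV_divide[OF y(1)[OF that] y1(1)[OF that]] pos(2)[OF that] W0[OF that] by simp
  then obtain c where c: "y t / y1 t = c" if "t > N" for t
    using const_on_open_half_line[of N "\<lambda>t. y t / y1 t"] by blast
  show ?thesis
  proof
    show "c > 0"
      using c[of "N + 1"] pos[of "N + 1"] by (auto intro: divide_pos_pos simp flip: c)
    show "y t = c * y1 t" if "t > N" for t
      using c[OF that] pos(2)[OF that] by (simp add: field_simps)
  qed
qed

text \<open>Away from the end point the derivatives are two-sided, and the coefficient is written
  with \<open>vector_derivative f (at t)\<close>, which does not mention \<open>T\<close>. Solutions
  on different half-lines thus satisfy literally the same equation, as the Wronskian comparison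
  demands.\<close>

lemma Lambda_from_ode:
  assumes "lam \<in> Lambda_from b T" "corresponds T f lam"
  obtains C where
    "\<And>t. t > T \<Longrightarrow> (lam has_real_derivative deriv_on {T..} lam t) (at t)"
    "\<And>t. t > T \<Longrightarrow> (deriv_on {T..} lam has_real_derivative
        vector_derivative f (at t) / t * lam t) (at t)"
    "\<And>t. t \<ge> T \<Longrightarrow> lam t > 0"
    "\<And>t. t \<ge> T \<Longrightarrow> \<bar>deriv_on {T..} lam t\<bar> / lam t \<le> C / (t * ln t powr b)"
    "continuous_on {T..} lam"
proof -
  have at: "at t within {T..} = at t" if "t > T" for t
    by (rule at_within_interior) (use that in simp)
  obtain C where C: "\<forall>t\<ge>T. lam t > 0 \<and> \<bar>deriv_on {T..} lam t\<bar> / lam t \<le> C / (t * ln t powr b)"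
    using assms(1) by (auto simp: Lambda_from_def)
  have ck: "Ck_on (Suc (Suc 0)) {T..} lam"
    using assms(1) by (auto simp: Lambda_from_def Cinf_on_def)
  have d1: "(lam has_real_derivative deriv_on {T..} lam t) (at t within {T..})" if "t \<ge> T" for t
    using ck that by (blast elim: Ck_on_SucE)
  have d2: "(deriv_on {T..} lam has_real_derivative deriv_on {T..} (deriv_on {T..} lam) t)
      (at t within {T..})" if "t \<ge> T" for t
    using ck that by (blast elim: Ck_on_SucE)
  show ?thesis
  proof (rule that[of C])
    show "(lam has_real_derivative deriv_on {T..} lam t) (at t)" if "t > T" for t
      using d1[of t] at[OF that] that by simp
    show "(deriv_on {T..} lam has_real_derivative vector_derivative f (at t) / t * lam t) (at t)"
      if "t > T" for t
    proof -
      have "deriv_on {T..} (deriv_on {T..} lam) t / lam t = deriv_on {T..} f t / t"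
        using assms(2) that by (simp add: corresponds_def numeral_2_eq_2)
      then have "deriv_on {T..} (deriv_on {T..} lam) t = vector_derivative f (at t) / t * lam t"
        using C that deriv_on_interior[OF that, of f]
        by (metis less_imp_le less_irrefl nonzero_divide_eq_eq)
      then show ?thesis
        using d2[of t] at[OF that] that by simp
    qed
    show "continuous_on {T..} lam"
      using d1 by (intro DERIV_continuous_on) auto
  qed (use C in auto)
qed

text \<open>The comparison runs on the open common half-line; continuity adds its end point
  \<open>max T T'\<close>. The factor is unique because \<open>lam1\<close> is positive.\<close>

lemma Lambda_from_proportional:
  assumes "b > 0" "lam1 \<in> Lambda_from b T" "corresponds T f lam1" "(lam1 \<longlongrightarrow> 1) at_top"
    and "lam \<in> Lambda_from b T'" "corresponds T' f lam"
  shows "\<exists>!c. c > 0 \<and> (\<forall>t\<ge>max T T'. lam t = c * lam1 t)"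
proof -
  let ?N = "max T T'"
  have N: "?N > 1"
    using assms(2) by (auto simp: Lambda_from_def)
  obtain C1 where 1:
    "\<And>t. t > T \<Longrightarrow> (lam1 has_real_derivative deriv_on {T..} lam1 t) (at t)"
    "\<And>t. t > T \<Longrightarrow> (deriv_on {T..} lam1 has_real_derivative
        vector_derivative f (at t) / t * lam1 t) (at t)"
    "\<And>t. t \<ge> T \<Longrightarrow> lam1 t > 0"
    "\<And>t. t \<ge> T \<Longrightarrow> \<bar>deriv_on {T..} lam1 t\<bar> / lam1 t \<le> C1 / (t * ln t powr b)"
    "continuous_on {T..} lam1"
    by (rule Lambda_from_ode[OF assms(2,3)]) (rule that)
  obtain C where 2:
    "\<And>t. t > T' \<Longrightarrow> (lam has_real_derivative deriv_on {T'..} lam t) (at t)"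
    "\<And>t. t > T' \<Longrightarrow> (deriv_on {T'..} lam has_real_derivative
        vector_derivative f (at t) / t * lam t) (at t)"
    "\<And>t. t \<ge> T' \<Longrightarrow> lam t > 0"
    "\<And>t. t \<ge> T' \<Longrightarrow> \<bar>deriv_on {T'..} lam t\<bar> / lam t \<le> C / (t * ln t powr b)"
    "continuous_on {T'..} lam"
    by (rule Lambda_from_ode[OF assms(5,6)]) (rule that)
  obtain c where c: "c > 0" "\<And>t. t > ?N \<Longrightarrow> lam t = c * lam1 t"
    by (rule proportional_solutions[OF N assms(1), of lam "deriv_on {T'..} lam"
          "\<lambda>t. vector_derivative f (at t) / t" lam1 "deriv_on {T..} lam1" C C1])
      (use 1 2 assms(4) in auto)
  have "lam t = c * lam1 t" if "t \<ge> ?N" for t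
  proof -
    have "lam t - c * lam1 t = 0"
    proof (rule continuous_constant_on_closure[where f="\<lambda>t. lam t - c * lam1 t"])
      have "continuous_on {?N..} (\<lambda>t. lam t - c * lam1 t)"
        by (intro continuous_intros continuous_on_subset[OF 1(5)] continuous_on_subset[OF 2(5)]) auto
      then show "continuous_on (closure {?N<..}) (\<lambda>t. lam t - c * lam1 t)"
        by simp
    qed (use c that in auto)
    then show ?thesis by simp
  qed
  moreover have "c' = c" if "\<forall>t\<ge>?N. lam t = c' * lam1 t" for c'
  proof -
    have "T \<le> ?N + 1"
      by linarith
    then have pos: "lam1 (?N + 1) > 0"
      by (rule 1(3))
    have "lam (?N + 1) = c * lam1 (?N + 1)"
      using c(2)[of "?N + 1"] by simp
    moreover have "lam (?N + 1) = c' * lam1 (?N + 1)"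
      using that[rule_format, of "?N + 1"] by linarith
    ultimately show ?thesis
      using pos by simp
  qed
  ultimately show ?thesis
    using c(1) by blast
qed

section \<open>Uniqueness for the linear wave equation\<close>

lemma has_partials_on_fst:
  assumes "has_partials_on ({0..} \<times> {0<..}) v vt vr" "0 \<le> t" "0 < r"
  shows "((\<lambda>s. v s r) has_real_derivative vt t r) (at t within {0..})"
proof -
  let ?D = "{0..} \<times> {0<..} :: (real \<times> real) set"
  have "((\<lambda>s. (\<lambda>z. v (fst z) (snd z)) (s, r)) has_derivative
      (\<lambda>h. (\<lambda>h. vt (fst (t, r)) (snd (t, r)) * fst h + vr (fst (t, r)) (snd (t, r)) * snd h) (h, 0)))
      (at t within {0..})"
    by (rule has_derivative_in_compose2[where t="?D" and f="\<lambda>s. (s, r)"])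
      (use assms in \<open>auto simp: has_partials_on_def intro!: derivative_eq_intros\<close>)
  then show ?thesis
    by (simp add: has_field_derivative_def)
qed

lemma has_partials_on_snd:
  assumes "has_partials_on ({0..} \<times> {0<..}) v vt vr" "0 \<le> t" "0 < r"
  shows "(v t has_real_derivative vr t r) (at r)"
proof -
  let ?D = "{0..} \<times> {0<..} :: (real \<times> real) set"
  have "((\<lambda>s. (\<lambda>z. v (fst z) (snd z)) (t, s)) has_derivative
      (\<lambda>h. (\<lambda>h. vt (fst (t, r)) (snd (t, r)) * fst h + vr (fst (t, r)) (snd (t, r)) * snd h) (0, h)))
      (at r within {0<..})"
    by (rule has_derivative_in_compose2[where t="?D" and f="\<lambda>s. (t, s)"])
      (use assms in \<open>auto simp: has_partials_on_def intro!: derivative_eq_intros\<close>)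
  then have "((\<lambda>s. v t s) has_real_derivative vr t r) (at r within {0<..})"
    by (simp add: has_field_derivative_def)
  then show ?thesis
    using assms(3) by (simp add: at_within_open[of r "{0<..}"])
qed

lemma has_partials_on_continuous:
  assumes "has_partials_on D v vt vr"
  shows "continuous_on D (\<lambda>z. v (fst z) (snd z))"
proof (rule has_derivative_continuous_on)
  show "((\<lambda>z. v (fst z) (snd z)) has_derivative
      (\<lambda>h. vt (fst z) (snd z) * fst h + vr (fst z) (snd z) * snd h)) (at z within D)" if "z \<in> D" for z
    using assms that by (cases z) (auto simp: has_partials_on_def)
qed

lemma integral_atLeast0_scale:
  fixes g :: "real \<Rightarrow> real"
  assumes "0 \<le> s" "continuous_on {0..s} g"
  shows "integral {0..s} g = s * integral {0..1} (\<lambda>x. g (s * x))"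
proof (cases "s = 0")
  case False
  then have "s > 0" using assms by simp
  have "(g has_integral integral {0..s} g) (cbox 0 s)"
    using assms(2) by (simp add: integrable_continuous_interval integrable_integral)
  from has_integral_affinity'[OF this \<open>s > 0\<close>, of 0]
  have "((\<lambda>x. g (s * x)) has_integral integral {0..s} g / s) {0..1}"
    using \<open>s > 0\<close> by (simp add: field_simps)
  then show ?thesis
    using \<open>s > 0\<close> by (simp add: integral_unique)
qed simp

text \<open>Rescaling the time variable moves the variable limit into the integrand; an integral
  over the fixed interval [0, 1] depends continuously on its parameters.\<close>

lemma continuous_on_integral_variable_limit:
  fixes g :: "real \<Rightarrow> real \<Rightarrow> real"
  assumes "continuous_on ({0..} \<times> S) (\<lambda>z. g (fst z) (snd z))"
  shows "continuous_on ({0..} \<times> S) (\<lambda>z. integral {0..fst z} (\<lambda>x. g x (snd z)))"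
proof -
  have "continuous_on (({0..} \<times> S) \<times> cbox 0 1) (\<lambda>(z, x). g (fst z * x) (snd z))"
    unfolding split_def
    by (rule continuous_on_compose2[OF assms, where f="\<lambda>z. (fst (fst z) * snd z, snd (fst z))", simplified])
      (auto intro!: continuous_intros)
  then have "continuous_on ({0..} \<times> S) (\<lambda>z. integral (cbox 0 1) (\<lambda>x. g (fst z * x) (snd z)))"
    by (rule integral_continuous_on_param)
  then have "continuous_on ({0..} \<times> S) (\<lambda>z. fst z * integral {0..1} (\<lambda>x. g (fst z * x) (snd z)))"
    by (auto intro!: continuous_intros)
  moreover have "fst z * integral {0..1} (\<lambda>x. g (fst z * x) (snd z)) = integral {0..fst z} (\<lambda>x. g x (snd z))"
    if "z \<in> {0..} \<times> S" for z
  proof (rule integral_atLeast0_scale[symmetric])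
    show "continuous_on {0..fst z} (\<lambda>x. g x (snd z))"
      by (rule continuous_on_compose2[OF assms, where f="\<lambda>x. (x, snd z)", simplified])
        (use that in \<open>auto intro!: continuous_intros\<close>)
  qed (use that in auto)
  ultimately show ?thesis
    by (metis (mono_tags, lifting) continuous_on_cong)
qed

text \<open>The inequality 2 |g s| |h x| \<le> r (g s)^2 + (h x)^2 / r is integrated over the square
  [0, t] x [0, t]; the variable missing from a term contributes the factor t. The weights r and 1 /
  r are those of the energy for g = w_r and h = w.\<close>

lemma integral_product_le:
  fixes g h :: "real \<Rightarrow> real"
  assumes "continuous_on {0..t} g" "continuous_on {0..t} h" "0 \<le> t" "0 < r"
  shows "integral {0..t} (\<lambda>s. \<bar>g s\<bar>) * integral {0..t} (\<lambda>s. \<bar>h s\<bar>)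
    \<le> t / 2 * integral {0..t} (\<lambda>s. r * (g s)\<^sup>2 + (h s)\<^sup>2 / r)"
proof -
  have am: "x * y \<le> 1/2 * (r * x\<^sup>2 + y\<^sup>2 / r)" for x y :: real
  proof -
    have "0 \<le> (r * x - y)\<^sup>2 / r"
      using assms by simp
    also have "\<dots> = r * x\<^sup>2 + y\<^sup>2 / r - 2 * x * y"
      using assms by (simp add: power2_eq_square field_simps)
    finally show ?thesis by simp
  qed
  have int: "f integrable_on {0..t}" if "continuous_on {0..t} f" for f :: "real \<Rightarrow> real"
    using that by (rule integrable_continuous_interval)
  note [intro!] = int continuous_intros assms(1,2)
  define H where "H = integral {0..t} (\<lambda>s. (h s)\<^sup>2 / r)"
  have "\<bar>g s\<bar> * integral {0..t} (\<lambda>s. \<bar>h s\<bar>) \<le> 1/2 * (t * (r * (g s)\<^sup>2) + H)" for s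
  proof -
    have "\<bar>g s\<bar> * integral {0..t} (\<lambda>s. \<bar>h s\<bar>) = integral {0..t} (\<lambda>x. \<bar>g s\<bar> * \<bar>h x\<bar>)"
      by simp
    also have "\<dots> \<le> integral {0..t} (\<lambda>x. 1/2 * (r * (g s)\<^sup>2 + (h x)\<^sup>2 / r))"
      using am[of "\<bar>g s\<bar>" "\<bar>h x\<bar>" for x] assms by (intro integral_le) auto
    also have "\<dots> = 1/2 * (integral {0..t} (\<lambda>x. r * (g s)\<^sup>2) + H)"
      unfolding H_def using assms by (subst integral_add[symmetric]) auto
    also have "integral {0..t} (\<lambda>x. r * (g s)\<^sup>2) = t * (r * (g s)\<^sup>2)"
      using assms by simp
    finally show ?thesis .
  qed
  then have "integral {0..t} (\<lambda>s. \<bar>g s\<bar> * integral {0..t} (\<lambda>s. \<bar>h s\<bar>)) \<le>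
      integral {0..t} (\<lambda>s. 1/2 * (t * (r * (g s)\<^sup>2) + H))"
    by (intro integral_le) auto
  also have "\<dots> = 1/2 * (integral {0..t} (\<lambda>s. t * (r * (g s)\<^sup>2)) + integral {0..t} (\<lambda>s. H))"
    by (subst integral_add[symmetric]) auto
  also have "\<dots> = t / 2 * (integral {0..t} (\<lambda>s. r * (g s)\<^sup>2) + H)"
    using assms by (simp add: algebra_simps)
  also have "\<dots> = t / 2 * integral {0..t} (\<lambda>s. r * (g s)\<^sup>2 + (h s)\<^sup>2 / r)"
    unfolding H_def using assms by (subst integral_add) auto
  finally show ?thesis
    by simp
qed

text \<open>A nonzero value would persist up to \<open>\<infinity>\<close> or down to \<open>0\<close>, where \<open>1 / r\<close> is not integrable.\<close>

lemma nondecreasing_log_integrable_eq_0: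
  fixes A :: "real \<Rightarrow> real"
  assumes mono: "\<And>\<delta> \<rho>. 0 < \<delta> \<Longrightarrow> \<delta> \<le> \<rho> \<Longrightarrow> A \<delta> \<le> A \<rho>"
    and cont: "continuous_on {0<..} A"
    and bd: "\<And>\<alpha> \<beta>. 0 < \<alpha> \<Longrightarrow> \<alpha> < \<beta> \<Longrightarrow> integral {\<alpha>..\<beta>} (\<lambda>r. \<bar>A r\<bar> / r) \<le> K"
    and "0 < r0"
  shows "A r0 = 0"
proof (rule ccontr)
  assume nz: "A r0 \<noteq> 0"
  define \<eta> where "\<eta> = \<bar>A r0\<bar>"
  \<comment> \<open>\<open>L\<close> is the length, measured in ln r, over which |A| \<ge>
    \<open>\<eta>\<close> forces the integral of |A| / r to be at least |K| + 1.\<close>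
  define L where "L = (\<bar>K\<bar> + 1) / \<eta>"
  have \<eta>: "\<eta> > 0" "L > 0" using nz by (auto simp: \<eta>_def L_def divide_pos_pos add_nonneg_pos)
  have False if ab: "0 < \<alpha>" "\<alpha> < \<beta>" "ln \<beta> - ln \<alpha> = L" and ge: "\<And>r. r \<in> {\<alpha>..\<beta>} \<Longrightarrow> \<eta> \<le> \<bar>A r\<bar>" for \<alpha> \<beta>
  proof -
    have 1: "((\<lambda>r. \<eta> * (1 / r)) has_integral \<eta> * (ln \<beta> - ln \<alpha>)) {\<alpha>..\<beta>}"
    proof (rule has_integral_mult_right, rule fundamental_theorem_of_calculus)
      show "(ln has_vector_derivative 1 / x) (at x within {\<alpha>..\<beta>})" if "x \<in> {\<alpha>..\<beta>}" for x
        using that ab by (auto intro!: derivative_eq_intros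
            simp: has_real_derivative_iff_has_vector_derivative[symmetric] divide_inverse)
    qed (use ab in simp)
    have "\<eta> * L = integral {\<alpha>..\<beta>} (\<lambda>r. \<eta> * (1 / r))"
      using 1 ab by (simp add: integral_unique)
    also have "\<dots> \<le> integral {\<alpha>..\<beta>} (\<lambda>r. \<bar>A r\<bar> / r)"
    proof (rule integral_le)
      show "(\<lambda>r. \<eta> * (1 / r)) integrable_on {\<alpha>..\<beta>}"
        using 1 by blast
      show "(\<lambda>r. \<bar>A r\<bar> / r) integrable_on {\<alpha>..\<beta>}"
        using ab by (intro integrable_continuous_interval continuous_intros continuous_on_subset[OF cont]) auto
      show "\<eta> * (1 / r) \<le> \<bar>A r\<bar> / r" if "r \<in> {\<alpha>..\<beta>}" for r
        using ge[OF that] that ab by (auto intro!: divide_right_mono)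
    qed
    also have "\<dots> \<le> K"
      using bd ab by blast
    finally show False
      using \<eta> by (simp add: L_def)
  qed note contra = this
  show False
  proof (cases "A r0 > 0")
    case True
    show False
    proof (rule contra)
      show "0 < r0" "r0 < r0 * exp L" "ln (r0 * exp L) - ln r0 = L"
        using \<open>0 < r0\<close> \<eta> by (simp_all add: ln_mult)
      show "\<eta> \<le> \<bar>A r\<bar>" if "r \<in> {r0..r0 * exp L}" for r
        using mono[of r0 r] that \<open>0 < r0\<close> True by (auto simp: \<eta>_def)
    qed
  next
    case False
    show False
    proof (rule contra)
      show "0 < r0 * exp (- L)" "r0 * exp (- L) < r0" "ln r0 - ln (r0 * exp (- L)) = L"
        using \<open>0 < r0\<close> \<eta> by (simp_all add: ln_mult)
      then show "\<eta> \<le> \<bar>A r\<bar>" if "r \<in> {r0 * exp (- L)..r0}" for r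
        using mono[of r r0] that False nz by (auto simp: \<eta>_def)
    qed
  qed
qed

text \<open>\<open>K\<close> bounds just the part r w_r^2 + w^2 / r of the energy. This part
  dominates the flux of the time integral W, because the time derivative of W is w and its radial
  derivative is a time integral of w_r.\<close>

lemma wave_energy_uniqueness:
  fixes w :: "real \<Rightarrow> real \<Rightarrow> real"
  assumes pw: "has_partials_on ({0..} \<times> {0<..}) w wt wr"
    and pt: "has_partials_on ({0..} \<times> {0<..}) wt wtt wtr"
    and pr: "has_partials_on ({0..} \<times> {0<..}) wr wrt wrr"
    and eq: "\<And>t r. 0 \<le> t \<Longrightarrow> 0 < r \<Longrightarrow> wtt t r = wrr t r + wr t r / r - 4 * w t r / r\<^sup>2"
    and init: "\<And>r. 0 < r \<Longrightarrow> w 0 r = 0" "\<And>r. 0 < r \<Longrightarrow> wt 0 r = 0"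
    and bd: "\<And>t \<alpha> \<beta>. 0 \<le> t \<Longrightarrow> 0 < \<alpha> \<Longrightarrow> \<alpha> < \<beta> \<Longrightarrow>
      integral {\<alpha>..\<beta>} (\<lambda>r. r * (wr t r)\<^sup>2 + (w t r)\<^sup>2 / r) \<le> K"
    and "0 \<le> t" "0 < r"
  shows "w t r = 0"
proof (cases "t = 0")
  case True
  then show ?thesis using init assms by simp
next
  case False
  then have t: "t > 0" using assms by simp
  let ?D = "{0..} \<times> {0<..} :: (real \<times> real) set"
  define W where "W s r = integral {0..s} (\<lambda>x. w x r)" for s r
  define Wr where "Wr s r = integral {0..s} (\<lambda>x. wr x r)" for s r
  define Wrr where "Wrr s r = integral {0..s} (\<lambda>x. wrr x r)" for s r
  have cw: "continuous_on ?D (\<lambda>z. w (fst z) (snd z))"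
    and cwt: "continuous_on ?D (\<lambda>z. wt (fst z) (snd z))"
    and cwr: "continuous_on ?D (\<lambda>z. wr (fst z) (snd z))"
    and cwrr: "continuous_on ?D (\<lambda>z. wrr (fst z) (snd z))"
    using has_partials_on_continuous[OF pw] has_partials_on_continuous[OF pt]
      has_partials_on_continuous[OF pr] pr
    by (simp_all add: has_partials_on_def)
  have cW: "continuous_on ?D (\<lambda>z. W (fst z) (snd z))" "continuous_on ?D (\<lambda>z. Wr (fst z) (snd z))"
    unfolding W_def Wr_def by (intro continuous_on_integral_variable_limit cw cwr)+
  have c1: "continuous_on X (\<lambda>s. g s r)"
    if "continuous_on ?D (\<lambda>z. g (fst z) (snd z))" "X \<subseteq> {0..}" "r > 0" for g :: "real \<Rightarrow> real \<Rightarrow> real" and X r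
    by (rule continuous_on_compose2[OF that(1), where f="\<lambda>s. (s, r)", simplified])
      (use that in \<open>auto intro!: continuous_intros\<close>)
  have c2: "continuous_on X (g s)"
    if "continuous_on ?D (\<lambda>z. g (fst z) (snd z))" "X \<subseteq> {0<..}" "s \<ge> 0" for g :: "real \<Rightarrow> real \<Rightarrow> real" and X s
    by (rule continuous_on_compose2[OF that(1), where f="\<lambda>r. (s, r)", simplified])
      (use that in \<open>auto intro!: continuous_intros\<close>)
  have dW: "((\<lambda>s. W s r) has_real_derivative w s r) (at s within {0..})"
    "((\<lambda>s. Wr s r) has_real_derivative wr s r) (at s within {0..})" if "s \<ge> 0" "r > 0" for s r
    unfolding W_def Wr_def using that c1[OF cw order_refl] c1[OF cwr order_refl]
    by (auto intro: has_real_derivative_integral_atLeast)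
  have dWr: "(Wr s has_real_derivative Wrr s r) (at r)" if "s \<ge> 0" "r > 0" for s r
  proof -
    have "((\<lambda>x. integral (cbox 0 s) (\<lambda>\<sigma>. wr \<sigma> x)) has_field_derivative integral (cbox 0 s) (\<lambda>\<sigma>. wrr \<sigma> r))
        (at r within {0<..})"
    proof (rule leibniz_rule_field_derivative)
      show "((\<lambda>x. wr \<sigma> x) has_field_derivative wrr \<sigma> x) (at x within {0<..})"
        if "x \<in> {0<..}" "\<sigma> \<in> cbox 0 s" for x \<sigma>
        using has_partials_on_snd[OF pr, of \<sigma> x] that by (auto intro: has_field_derivative_at_within)
      show "(\<lambda>\<sigma>. wr \<sigma> x) integrable_on cbox 0 s" if "x \<in> {0<..}" for x
        using that by (auto intro!: integrable_continuous_interval c1[OF cwr])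
      show "continuous_on ({0<..} \<times> cbox 0 s) (\<lambda>(x, \<sigma>). wrr \<sigma> x)"
        unfolding split_def
        by (rule continuous_on_compose2[OF cwrr, where f="\<lambda>z. (snd z, fst z)", simplified])
          (auto intro!: continuous_intros)
    qed (use that in auto)
    then show ?thesis
      using that unfolding Wr_def Wrr_def by (simp add: at_within_open[of r "{0<..}"])
  qed
  \<comment> \<open>This is the wave equation for W, whose second time derivative is
    \<open>wt\<close>: the equation for w is integrated in time, and the boundary term at time 0
    vanishes with the initial velocity.\<close>
  have wt: "wt s r = Wrr s r + Wr s r / r - 4 * W s r / r\<^sup>2" if "s \<ge> 0" "r > 0" for s r
  proof -
    have "((\<lambda>x. wtt x r) has_integral wt s r - wt 0 r) {0..s}"
    proof (rule fundamental_theorem_of_calculus[OF that(1)])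
      show "((\<lambda>a. wt a r) has_vector_derivative wtt x r) (at x within {0..s})" if "x \<in> {0..s}" for x
        using has_partials_on_fst[OF pt, of x r] that \<open>r > 0\<close>
        by (auto simp flip: has_real_derivative_iff_has_vector_derivative intro: DERIV_subset)
    qed
    then have "wt s r = integral {0..s} (\<lambda>x. wtt x r)"
      using init that by (simp add: integral_unique)
    also have "\<dots> = integral {0..s} (\<lambda>x. wrr x r + 1 / r * wr x r - 4 / r\<^sup>2 * w x r)"
      using that eq by (intro integral_cong) (auto simp: field_simps)
    also have "\<dots> = Wrr s r + 1 / r * Wr s r - 4 / r\<^sup>2 * W s r"
    proof -
      have int: "(\<lambda>x. wrr x r) integrable_on {0..s}" "(\<lambda>x. 1 / r * wr x r) integrable_on {0..s}"
        "(\<lambda>x. 4 / r\<^sup>2 * w x r) integrable_on {0..s}"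
        using that by (auto intro!: integrable_continuous_interval continuous_on_mult_left c1[OF cw] c1[OF cwr] c1[OF cwrr])
      show ?thesis
        unfolding Wrr_def Wr_def W_def integral_diff[OF integrable_add[OF int(1,2)] int(3)] integral_add[OF int(1,2)]
        by simp
    qed
    finally show ?thesis by (simp add: field_simps)
  qed
  \<comment> \<open>\<open>e\<close> is the energy density of W, including the factor r of the
    measure. The energy identity takes divergence form: \<open>de\<close> is the time derivative of
    \<open>e\<close> and, by the equation for W, also the radial derivative of the flux r W_r
    w.\<close>
  define e where "e s r = 1/2 * (r * ((w s r)\<^sup>2 + (Wr s r)\<^sup>2 + 4 * (W s r)\<^sup>2 / r\<^sup>2))" for s r
  define de where "de s r = r * w s r * wt s r + r * Wr s r * wr s r + 4 * W s r * w s r / r" for s r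
  have cde: "continuous_on ?D (\<lambda>z. de (fst z) (snd z))"
    unfolding de_def by (intro continuous_intros cw cwt cwr cW) auto
  have ce: "continuous_on ?D (\<lambda>z. e (fst z) (snd z))"
    unfolding e_def by (intro continuous_intros cw cW) auto
  have de_t: "((\<lambda>s. e s r) has_real_derivative de s r) (at s within {0..})" if "s \<ge> 0" "r > 0" for s r
    unfolding e_def de_def using that
    by (auto intro!: derivative_eq_intros has_partials_on_fst[OF pw] dW simp: field_simps power2_eq_square)
  have de_r: "((\<lambda>r. r * Wr s r * w s r) has_real_derivative de s r) (at r)" if "s \<ge> 0" "r > 0" for s r
  proof -
    have "((\<lambda>r. r * Wr s r * w s r) has_real_derivative
        (1 * Wr s r + Wrr s r * r) * w s r + wr s r * (r * Wr s r)) (at r)"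
      by (intro DERIV_mult DERIV_ident dWr has_partials_on_snd[OF pw] that)
    then show ?thesis
      by (rule DERIV_cong) (use that in \<open>simp add: de_def wt field_simps power2_eq_square\<close>)
  qed
  define A where "A r = integral {0..t} (\<lambda>s. r * Wr s r * w s r)" for r
  have cA: "continuous_on {0<..} A"
  proof -
    have "continuous_on ({0<..} \<times> cbox 0 t) (\<lambda>(r, s). r * Wr s r * w s r)"
      unfolding split_def
      by (intro continuous_intros continuous_on_compose2[OF cW(2), where f="\<lambda>z. (snd z, fst z)", simplified]
          continuous_on_compose2[OF cw, where f="\<lambda>z. (snd z, fst z)", simplified]) auto
    from integral_continuous_on_param[OF this] show ?thesis
      by (simp add: A_def[abs_def])
  qed
  \<comment> \<open>Integrating the divergence identity over [0, t] x [\<delta>, \<rho>] in both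
    orders; the energy at time 0 drops out.\<close>
  have A_diff: "A \<rho> - A \<delta> = integral {\<delta>..\<rho>} (e t)" if "0 < \<delta>" "\<delta> \<le> \<rho>" for \<delta> \<rho>
  proof -
    have int: "(\<lambda>s. r * Wr s r * w s r) integrable_on {0..t}" if "r > 0" for r
      using that by (intro integrable_continuous_interval continuous_intros c1[OF cW(2)] c1[OF cw]) auto
    have "A \<rho> - A \<delta> = integral {0..t} (\<lambda>s. \<rho> * Wr s \<rho> * w s \<rho> - \<delta> * Wr s \<delta> * w s \<delta>)"
      unfolding A_def using that by (intro integral_diff[symmetric] int) auto
    also have "\<dots> = integral {0..t} (\<lambda>s. integral {\<delta>..\<rho>} (de s))"
    proof (rule integral_cong)
      fix s assume s: "s \<in> {0..t}"
      have "(de s has_integral \<rho> * Wr s \<rho> * w s \<rho> - \<delta> * Wr s \<delta> * w s \<delta>) {\<delta>..\<rho>}"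
        by (rule fundamental_theorem_of_calculus[OF that(2)])
          (use s that in \<open>auto simp flip: has_real_derivative_iff_has_vector_derivative
            intro!: has_field_derivative_at_within[OF de_r]\<close>)
      then show "\<rho> * Wr s \<rho> * w s \<rho> - \<delta> * Wr s \<delta> * w s \<delta> = integral {\<delta>..\<rho>} (de s)"
        by (simp add: integral_unique)
    qed
    also have "\<dots> = integral (cbox 0 t) (\<lambda>s. integral (cbox \<delta> \<rho>) (de s))"
      by simp
    also have "\<dots> = integral (cbox \<delta> \<rho>) (\<lambda>r. integral (cbox 0 t) (\<lambda>s. de s r))"
      by (rule integral_swap_continuous)
        (use that in \<open>auto simp: split_def intro!: continuous_on_subset[OF cde]\<close>)
    also have "\<dots> = integral {\<delta>..\<rho>} (e t)"
      unfolding cbox_interval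
    proof (rule integral_cong)
      fix r assume r: "r \<in> {\<delta>..\<rho>}"
      have "((\<lambda>s. de s r) has_integral e t r - e 0 r) {0..t}"
      proof (rule fundamental_theorem_of_calculus[OF \<open>0 \<le> t\<close>])
        show "((\<lambda>s. e s r) has_vector_derivative de s r) (at s within {0..t})" if "s \<in> {0..t}" for s
          using that r \<open>0 < \<delta>\<close> DERIV_subset[OF de_t[of s r], of "{0..t}"]
          by (auto simp flip: has_real_derivative_iff_has_vector_derivative)
      qed
      moreover have "e 0 r = 0"
        using init r that by (simp add: e_def W_def Wr_def)
      ultimately show "integral {0..t} (\<lambda>s. de s r) = e t r"
        by (simp add: integral_unique)
    qed
    finally show ?thesis .
  qed
  have e0: "0 \<le> e t r" if "r > 0" for r
    using that by (simp add: e_def)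
  have A_mono: "A \<delta> \<le> A \<rho>" if "0 < \<delta>" "\<delta> \<le> \<rho>" for \<delta> \<rho>
  proof -
    have "0 \<le> integral {\<delta>..\<rho>} (e t)"
      using that e0 t by (intro Henstock_Kurzweil_Integration.integral_nonneg integrable_continuous_interval c2[OF ce]) auto
    then show ?thesis
      using A_diff[OF that] by simp
  qed
  define \<phi> where "\<phi> r = integral {0..t} (\<lambda>s. r * (wr s r)\<^sup>2 + (w s r)\<^sup>2 / r)" for r
  have A_le: "\<bar>A r\<bar> / r \<le> t / 2 * \<phi> r" if "r > 0" for r
  proof -
    \<comment> \<open>\<open>a\<close> bounds |W_r| at all times up to t. It decouples W_r from w,
      so that |A| / r is at most a product of two separate time integrals.\<close>
    define a where "a = integral {0..t} (\<lambda>s. \<bar>wr s r\<bar>)"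
    note cr = c1[OF cwr _ that] c1[OF cw _ that] c1[OF cW(2) _ that]
    have Wr_le: "\<bar>Wr s r\<bar> \<le> a" if s: "s \<in> {0..t}" for s
    proof -
      have "norm (Wr s r) \<le> integral {0..s} (\<lambda>s. \<bar>wr s r\<bar>)"
        unfolding Wr_def using s
        by (intro integral_norm_bound_integral integrable_continuous_interval continuous_intros cr) auto
      also have "\<dots> \<le> a"
        unfolding a_def using s
        by (intro integral_subset_le integrable_continuous_interval continuous_intros cr) auto
      finally show ?thesis by simp
    qed
    have "norm (A r) \<le> integral {0..t} (\<lambda>s. r * a * \<bar>w s r\<bar>)"
      unfolding A_def
    proof (intro integral_norm_bound_integral integrable_continuous_interval continuous_intros cr)
      show "norm (r * Wr s r * w s r) \<le> r * a * \<bar>w s r\<bar>" if "s \<in> {0..t}" for s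
        using Wr_le[OF that] \<open>r > 0\<close> by (auto simp: abs_mult intro!: mult_right_mono)
    qed auto
    then have "\<bar>A r\<bar> / r \<le> a * integral {0..t} (\<lambda>s. \<bar>w s r\<bar>)"
      using that by (simp add: field_simps)
    also have "\<dots> \<le> t / 2 * \<phi> r"
      unfolding a_def \<phi>_def using t that by (intro integral_product_le cr) auto
    finally show ?thesis .
  qed
  have A_bd: "integral {\<alpha>..\<beta>} (\<lambda>r. \<bar>A r\<bar> / r) \<le> t / 2 * (t * K)" if "0 < \<alpha>" "\<alpha> < \<beta>" for \<alpha> \<beta>
  proof -
    have cont: "continuous_on (cbox (\<alpha>, 0) (\<beta>, t)) (\<lambda>(r, s). r * (wr s r)\<^sup>2 + (w s r)\<^sup>2 / r)"
      unfolding split_def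
      by (intro continuous_intros continuous_on_compose2[OF cwr, where f="\<lambda>z. (snd z, fst z)", simplified]
          continuous_on_compose2[OF cw, where f="\<lambda>z. (snd z, fst z)", simplified]) (use that in auto)
    have c\<phi>: "continuous_on {\<alpha>..\<beta>} \<phi>"
      using integral_continuous_on_param[of "{\<alpha>..\<beta>}" 0 t] cont
      by (simp add: \<phi>_def[abs_def] cbox_Pair_eq)
    have "integral {\<alpha>..\<beta>} (\<lambda>r. \<bar>A r\<bar> / r) \<le> integral {\<alpha>..\<beta>} (\<lambda>r. t / 2 * \<phi> r)"
    proof (intro integral_le integrable_continuous_interval continuous_intros c\<phi> continuous_on_subset[OF cA])
      show "\<bar>A r\<bar> / r \<le> t / 2 * \<phi> r" if "r \<in> {\<alpha>..\<beta>}" for r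
        using A_le[of r] that \<open>0 < \<alpha>\<close> by auto
    qed (use that in auto)
    also have "integral {\<alpha>..\<beta>} (\<lambda>r. t / 2 * \<phi> r) = t / 2 * integral {\<alpha>..\<beta>} \<phi>"
      by simp
    also have "integral {\<alpha>..\<beta>} \<phi> =
        integral {0..t} (\<lambda>s. integral {\<alpha>..\<beta>} (\<lambda>r. r * (wr s r)\<^sup>2 + (w s r)\<^sup>2 / r))"
      using integral_swap_continuous[OF cont] by (simp add: \<phi>_def[abs_def])
    also have "\<dots> \<le> integral {0..t} (\<lambda>s. K)"
    proof (rule integral_le)
      have "continuous_on ({0..t} \<times> cbox \<alpha> \<beta>) (\<lambda>(s, r). r * (wr s r)\<^sup>2 + (w s r)\<^sup>2 / r)"
        unfolding split_def
        by (intro continuous_intros continuous_on_subset[OF cw] continuous_on_subset[OF cwr]) (use that in auto)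
      from integral_continuous_on_param[OF this]
      show "(\<lambda>s. integral {\<alpha>..\<beta>} (\<lambda>r. r * (wr s r)\<^sup>2 + (w s r)\<^sup>2 / r)) integrable_on {0..t}"
        by (simp add: integrable_continuous_interval)
    qed (use bd that in auto)
    also have "\<dots> = t * K"
      using t by simp
    finally show ?thesis
      using t by (simp add: mult_left_mono)
  qed
  have A0: "A x = 0" if "x > 0" for x
    using nondecreasing_log_integrable_eq_0[OF A_mono cA A_bd that] .
  \<comment> \<open>The flux vanishes at both ends of the annulus, hence so does the energy between
    them; as \<open>e\<close> is continuous and nonnegative, its summand w^2 vanishes at r.\<close>
  have "integral {r..r+1} (e t) = 0"
    using A_diff[of r "r + 1"] A0[of r] A0[of "r + 1"] \<open>0 < r\<close> by simp
  moreover have "continuous_on {r..r+1} (e t)"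
    using \<open>0 < r\<close> t by (intro c2[OF ce]) auto
  ultimately have "e t r = 0"
    using integral_eq_0_iff[of r "r + 1" "e t"] e0 \<open>0 < r\<close> by auto
  then show ?thesis
    using \<open>0 < r\<close> by (simp add: e_def add_nonneg_eq_0_iff)
qed

section \<open>Weber's exponential integrals\<close>

definition bessel2_coeff :: "nat \<Rightarrow> real" where
  "bessel2_coeff m = (-1) ^ m / (fact m * fact (m + 2))"

text \<open>1 / (m! (m + 2)!) is a binomial coefficient divided by (2 m + 2)!, and a binomial
  coefficient is at most its row sum 2^(2 m + 2), which cancels the powers of x / 2. The series of
  J_2 is thus dominated by even terms of the exponential series.\<close>

lemma bessel2_term_bound:
  assumes "0 \<le> x"
  shows "\<bar>bessel2_coeff m * (x / 2) ^ (2 * m + 2)\<bar> \<le> x ^ (2 * m + 2) / fact (2 * m + 2)"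
proof -
  have "(2 * m + 2 choose m) \<le> (\<Sum>k\<le>2 * m + 2. 2 * m + 2 choose k)"
    by (rule member_le_sum) auto
  also have "\<dots> = 2 ^ (2 * m + 2)"
    by (rule choose_row_sum)
  finally have "real (2 * m + 2 choose m) \<le> 2 ^ (2 * m + 2)"
    by (metis of_nat_le_iff of_nat_numeral of_nat_power)
  then have "fact (2 * m + 2) / (fact m * fact (m + 2)) \<le> (2 :: real) ^ (2 * m + 2)"
    by (subst (asm) binomial_fact) auto
  then have "1 / (fact m * fact (m + 2)) / (2 :: real) ^ (2 * m + 2) \<le> 1 / fact (2 * m + 2)"
    by (simp add: field_simps del: power_Suc fact_Suc)
  then have "x ^ (2 * m + 2) * (1 / (fact m * fact (m + 2)) / (2 :: real) ^ (2 * m + 2)) \<le>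
      x ^ (2 * m + 2) * (1 / fact (2 * m + 2))"
    using assms by (intro mult_left_mono) auto
  moreover have "\<bar>bessel2_coeff m * (x / 2) ^ (2 * m + 2)\<bar> =
      x ^ (2 * m + 2) * (1 / (fact m * fact (m + 2)) / (2 :: real) ^ (2 * m + 2))"
    using assms by (simp add: bessel2_coeff_def abs_mult power_abs power_divide abs_divide del: power_Suc fact_Suc)
  ultimately show ?thesis
    by (simp only: times_divide_eq_right mult_1_right)
qed

lemma even_exp_partial_sum_le:
  assumes "0 \<le> (x :: real)"
  shows "(\<Sum>m<N. x ^ (2 * m + 2) / fact (2 * m + 2)) \<le> exp x"
proof -
  have "(\<Sum>m<N. x ^ (2 * m + 2) / fact (2 * m + 2)) = (\<Sum>n\<in>(\<lambda>m. 2 * m + 2) ` {..<N}. x ^ n / fact n)"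
    by (subst sum.reindex) (auto intro: inj_onI)
  also have "\<dots> \<le> (\<Sum>n. x ^ n / fact n)"
    using assms summable_exp_generic[of x]
    by (intro sum_le_suminf) (auto simp: divide_inverse mult.commute)
  also have "\<dots> = exp x"
    by (simp add: exp_def divide_inverse mult.commute)
  finally show ?thesis .
qed

lemma bessel2_partial_sum_bound:
  assumes "0 \<le> x"
  shows "(\<Sum>m<N. \<bar>bessel2_coeff m * (x / 2) ^ (2 * m + 2)\<bar>) \<le> exp x"
  by (rule order_trans[OF sum_mono[OF bessel2_term_bound] even_exp_partial_sum_le]) (rule assms)+

lemma bessel2_sums:
  assumes "0 \<le> x"
  shows "(\<lambda>m. bessel2_coeff m * (x / 2) ^ (2 * m + 2)) sums bessel_J 2 x"
proof -
  have "summable (\<lambda>m. \<bar>bessel2_coeff m * (x / 2) ^ (2 * m + 2)\<bar>)"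
    by (rule bounded_imp_summable[where B="exp x"])
      (simp_all only: lessThan_Suc_atMost[symmetric] abs_ge_zero bessel2_partial_sum_bound[OF assms])
  then have "summable (\<lambda>m. bessel2_coeff m * (x / 2) ^ (2 * m + 2))"
    by (rule summable_rabs_cancel)
  then show ?thesis
    unfolding bessel_J_def bessel2_coeff_def by (rule summable_sums)
qed

lemma bessel2_bound:
  assumes "0 \<le> x"
  shows "\<bar>bessel_J 2 x\<bar> \<le> exp x"
proof (rule LIMSEQ_le_const2)
  show "(\<lambda>N. \<bar>\<Sum>m<N. bessel2_coeff m * (x / 2) ^ (2 * m + 2)\<bar>) \<longlonglongrightarrow> \<bar>bessel_J 2 x\<bar>"
    using bessel2_sums[OF assms] by (intro tendsto_rabs) (simp add: sums_def)
  show "\<exists>N. \<forall>n\<ge>N. \<bar>\<Sum>m<n. bessel2_coeff m * (x / 2) ^ (2 * m + 2)\<bar> \<le> exp x"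
    by (intro exI allI impI order_trans[OF sum_abs bessel2_partial_sum_bound[OF assms]])
qed

lemma borel_measurable_bessel_J [measurable]: "bessel_J n \<in> borel_measurable borel"
  unfolding bessel_J_def by measurable

text \<open>Odd powers have elementary Gaussian moments on the half-line, and multiplication by the
  even powers in the series of J_2 stays within the family.\<close>

definition gauss_weight :: "real \<Rightarrow> nat \<Rightarrow> real \<Rightarrow> real" where
  "gauss_weight q k x = indicator {0<..} x * (x ^ (2 * k + 1) * exp (- q * x\<^sup>2))"

lemma borel_measurable_gauss_weight [measurable]: "gauss_weight q k \<in> borel_measurable borel"
  unfolding gauss_weight_def by measurable

lemma gauss_weight_nonneg: "0 \<le> gauss_weight q k x"
  by (auto simp: gauss_weight_def indicator_def)

lemma gauss_weight_shift: "x ^ (2 * m) * gauss_weight q k x = gauss_weight q (k + m) x"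
  by (simp add: gauss_weight_def power_add[symmetric] algebra_simps)

lemma has_bochner_integral_gauss_weight:
  assumes "0 < q"
  shows "has_bochner_integral lborel (gauss_weight q k) (fact k / (2 * q ^ (k + 1)))"
proof -
  have "has_bochner_integral lborel
      (\<lambda>x. indicator {0..} (0 + sqrt q * x) *\<^sub>R (exp (- (0 + sqrt q * x)\<^sup>2) * (0 + sqrt q * x) ^ (2 * k + 1)))
      ((fact k / 2) /\<^sub>R \<bar>sqrt q\<bar>)"
    using assms gaussian_moment_odd_pos[of k]
    by (subst lborel_has_bochner_integral_real_affine_iff[symmetric]) auto
  then have "has_bochner_integral lborel (\<lambda>x. inverse (sqrt q ^ (2 * k + 1)) *
      (indicator {0..} (0 + sqrt q * x) *\<^sub>R (exp (- (0 + sqrt q * x)\<^sup>2) * (0 + sqrt q * x) ^ (2 * k + 1))))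
      (inverse (sqrt q ^ (2 * k + 1)) * ((fact k / 2) /\<^sub>R \<bar>sqrt q\<bar>))"
    by (rule has_bochner_integral_mult_right)
  also have "(\<lambda>x. inverse (sqrt q ^ (2 * k + 1)) *
      (indicator {0..} (0 + sqrt q * x) *\<^sub>R (exp (- (0 + sqrt q * x)\<^sup>2) * (0 + sqrt q * x) ^ (2 * k + 1)))) =
      gauss_weight q k"
  proof
    fix x
    have "indicator {0..} (sqrt q * x) * x ^ (2 * k + 1) = (indicator {0<..} x * x ^ (2 * k + 1) :: real)"
      using assms by (auto simp: indicator_def zero_le_mult_iff)
    moreover have "sqrt q ^ (2 * k + 1) \<noteq> 0"
      using assms by simp
    ultimately show "inverse (sqrt q ^ (2 * k + 1)) *
      (indicator {0..} (0 + sqrt q * x) *\<^sub>R (exp (- (0 + sqrt q * x)\<^sup>2) * (0 + sqrt q * x) ^ (2 * k + 1))) =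
      gauss_weight q k x"
      using assms unfolding gauss_weight_def power_mult_distrib add_0
      by (simp add: field_simps del: power_Suc)
  qed
  also have "inverse (sqrt q ^ (2 * k + 1)) * ((fact k / 2) /\<^sub>R \<bar>sqrt q\<bar>) = fact k / (2 * q ^ (k + 1))"
  proof -
    have "sqrt q ^ (2 * k + 1) * sqrt q = (sqrt q ^ 2) ^ (k + 1)"
      by (simp only: power_mult[symmetric] power_Suc2[symmetric]) simp
    then have "sqrt q ^ (2 * k + 1) * sqrt q = q ^ (k + 1)"
      using assms by simp
    then have "inverse (sqrt q ^ (2 * k + 1)) * inverse (sqrt q) = inverse (q ^ (k + 1))"
      by (metis inverse_mult_distrib)
    moreover have "inverse (sqrt q ^ (2 * k + 1)) * ((fact k / 2) /\<^sub>R \<bar>sqrt q\<bar>) =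
        fact k / 2 * (inverse (sqrt q ^ (2 * k + 1)) * inverse (sqrt q))"
      using assms by (simp only: real_scaleR_def abs_of_pos real_sqrt_gt_zero mult_ac)
    ultimately show ?thesis
      by (simp only: divide_inverse inverse_mult_distrib mult_ac)
  qed
  finally show ?thesis .
qed

lemma integral_gauss_weight:
  "0 < q \<Longrightarrow> (LINT x|lborel. gauss_weight q k x) = fact k / (2 * q ^ (k + 1))"
  using has_bochner_integral_gauss_weight by (rule has_bochner_integral_integral_eq)

lemma integrable_gauss_weight: "0 < q \<Longrightarrow> integrable lborel (gauss_weight q k)"
  using has_bochner_integral_gauss_weight by (rule integrable.intros)

text \<open>Completing the square, a x \<le> a^2 / (2 q) + q x^2 / 2: half of the Gaussian absorbs
  the exponential.\<close>

lemma integrable_exp_gauss_weight: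
  assumes "0 < q"
  shows "integrable lborel (\<lambda>x. exp (a * x) * gauss_weight q k x)"
proof (rule Bochner_Integration.integrable_bound)
  show "integrable lborel (\<lambda>x. exp (a\<^sup>2 / (2 * q)) * gauss_weight (q / 2) k x)"
    using assms by (intro integrable_mult_right integrable_gauss_weight) auto
  show "AE x in lborel. norm (exp (a * x) * gauss_weight q k x) \<le>
      norm (exp (a\<^sup>2 / (2 * q)) * gauss_weight (q / 2) k x)"
  proof (rule AE_I2)
    fix x :: real
    have "0 \<le> (a - q * x)\<^sup>2 / (2 * q)"
      using assms by simp
    also have "\<dots> = a\<^sup>2 / (2 * q) + q / 2 * x\<^sup>2 - a * x"
      using assms by (simp add: power2_eq_square field_simps)
    finally have "exp (a * x) * exp (- q * x\<^sup>2) \<le> exp (a\<^sup>2 / (2 * q)) * exp (- (q / 2) * x\<^sup>2)"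
      by (simp add: exp_add[symmetric])
    then have "x ^ (2 * k + 1) * (exp (a * x) * exp (- q * x\<^sup>2)) \<le>
        x ^ (2 * k + 1) * (exp (a\<^sup>2 / (2 * q)) * exp (- (q / 2) * x\<^sup>2))" if "x > 0"
      using that by (intro mult_left_mono) auto
    then show "norm (exp (a * x) * gauss_weight q k x) \<le>
        norm (exp (a\<^sup>2 / (2 * q)) * gauss_weight (q / 2) k x)"
      using gauss_weight_nonneg[of q k x] gauss_weight_nonneg[of "q / 2" k x]
      by (auto simp: gauss_weight_def indicator_def abs_mult mult_ac simp del: power_Suc)
  qed
qed auto

text \<open>Term-by-term integration by dominated convergence; all partial sums of the Bessel series
  are at most exp(a x). It is stated for a general weight since in Weber's second integral the
  weight contains another Bessel function.\<close>

lemma bessel2_integral_sums: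
  assumes "0 \<le> a" and [measurable]: "\<omega> \<in> borel_measurable borel"
    and supp: "\<And>x. x \<le> 0 \<Longrightarrow> \<omega> x = 0" and int: "integrable lborel (\<lambda>x. exp (a * x) * \<bar>\<omega> x\<bar>)"
  shows "(\<lambda>m. bessel2_coeff m * (a / 2) ^ (2 * m + 2) * (LINT x|lborel. x ^ (2 * m + 2) * \<omega> x)) sums
    (LINT x|lborel. bessel_J 2 (a * x) * \<omega> x)"
proof -
  let ?t = "\<lambda>m x. bessel2_coeff m * (a * x / 2) ^ (2 * m + 2)"
  have bd: "norm ((\<Sum>m<N. ?t m x) * \<omega> x) \<le> exp (a * x) * \<bar>\<omega> x\<bar>"
    "norm (?t m x * \<omega> x) \<le> exp (a * x) * \<bar>\<omega> x\<bar>" for N m x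
  proof -
    have "norm ((\<Sum>m\<in>M. ?t m x) * \<omega> x) \<le> exp (a * x) * \<bar>\<omega> x\<bar>" if fin: "finite M" for M
    proof (cases "x \<le> 0")
      case False
      then have ax: "0 \<le> a * x" using assms by simp
      obtain N where N: "M \<subseteq> {..<N}"
        using fin finite_nat_iff_bounded[of M] by blast
      have "\<bar>\<Sum>m\<in>M. ?t m x\<bar> \<le> (\<Sum>m\<in>M. \<bar>?t m x\<bar>)"
        by (rule sum_abs)
      also have "\<dots> \<le> (\<Sum>m<N. \<bar>?t m x\<bar>)"
        using N by (intro sum_mono2) auto
      also have "\<dots> \<le> exp (a * x)"
        by (rule bessel2_partial_sum_bound[OF ax])
      finally show ?thesis
        by (simp add: abs_mult mult_right_mono)
    qed (simp add: supp)
    from this[of "{..<N}"] this[of "{m}"]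
    show "norm ((\<Sum>m<N. ?t m x) * \<omega> x) \<le> exp (a * x) * \<bar>\<omega> x\<bar>"
      "norm (?t m x * \<omega> x) \<le> exp (a * x) * \<bar>\<omega> x\<bar>"
      by auto
  qed
  have int_t: "integrable lborel (\<lambda>x. ?t m x * \<omega> x)" for m
    by (rule Bochner_Integration.integrable_bound[OF int]) (use bd(2) in \<open>auto simp: abs_mult\<close>)
  have "(\<lambda>N. LINT x|lborel. (\<Sum>m<N. ?t m x) * \<omega> x) \<longlonglongrightarrow> (LINT x|lborel. bessel_J 2 (a * x) * \<omega> x)"
  proof (rule integral_dominated_convergence[OF _ _ int])
    show "AE x in lborel. (\<lambda>N. (\<Sum>m<N. ?t m x) * \<omega> x) \<longlonglongrightarrow> bessel_J 2 (a * x) * \<omega> x"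
    proof (rule AE_I2)
      fix x :: real
      show "(\<lambda>N. (\<Sum>m<N. ?t m x) * \<omega> x) \<longlonglongrightarrow> bessel_J 2 (a * x) * \<omega> x"
      proof (cases "x \<le> 0")
        case False
        then show ?thesis
          using bessel2_sums[of "a * x"] assms(1) by (intro tendsto_mult_right) (auto simp: sums_def)
      qed (simp add: supp)
    qed
  qed (use bd(1) in auto)
  moreover have "(LINT x|lborel. (\<Sum>m<N. ?t m x) * \<omega> x) =
      (\<Sum>m<N. bessel2_coeff m * (a / 2) ^ (2 * m + 2) * (LINT x|lborel. x ^ (2 * m + 2) * \<omega> x))" for N
  proof -
    have "(LINT x|lborel. (\<Sum>m<N. ?t m x) * \<omega> x) = (\<Sum>m<N. LINT x|lborel. ?t m x * \<omega> x)"
      unfolding sum_distrib_right by (rule Bochner_Integration.integral_sum) (rule int_t)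
    also have "\<dots> = (\<Sum>m<N. LINT x|lborel. bessel2_coeff m * (a / 2) ^ (2 * m + 2) * (x ^ (2 * m + 2) * \<omega> x))"
      by (intro sum.cong refl Bochner_Integration.integral_cong)
        (simp add: power_mult_distrib power_divide del: power_Suc)
    finally show ?thesis
      by simp
  qed
  ultimately show ?thesis
    by (simp add: sums_def)
qed

lemma sums_cong_unique:
  fixes a b :: real
  assumes "f sums a" "\<And>n. f n = g n" "g sums b"
  shows "a = b"
proof -
  have "f = g"
    using assms(2) by (rule ext)
  then show ?thesis
    using sums_unique2[of g a b] assms(1,3) by blast
qed

text \<open>The Gaussian moment contributes (m + 2)!, which cancels the same factorial in the
  coefficient of J_2, and an exponential series remains.\<close>

lemma weber_first_integral:
  assumes "0 < s" "0 \<le> a"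
  shows "(LINT x|lborel. bessel_J 2 (a * x) * gauss_weight s 1 x) =
    (a / 2)\<^sup>2 / (2 * s ^ 3) * exp (- (a\<^sup>2 / (4 * s)))"
proof -
  have "(\<lambda>m. bessel2_coeff m * (a / 2) ^ (2 * m + 2) *
      (LINT x|lborel. x ^ (2 * m + 2) * gauss_weight s 1 x)) sums
      (LINT x|lborel. bessel_J 2 (a * x) * gauss_weight s 1 x)"
  proof (rule bessel2_integral_sums)
    show "integrable lborel (\<lambda>x. exp (a * x) * \<bar>gauss_weight s 1 x\<bar>)"
      using integrable_exp_gauss_weight[OF assms(1), of a 1] by (simp add: gauss_weight_nonneg)
  qed (use assms in \<open>auto simp: gauss_weight_def\<close>)
  moreover have "bessel2_coeff m * (a / 2) ^ (2 * m + 2) *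
      (LINT x|lborel. x ^ (2 * m + 2) * gauss_weight s 1 x) =
      (a / 2)\<^sup>2 / (2 * s ^ 3) * ((- (a\<^sup>2 / (4 * s))) ^ m /\<^sub>R fact m)" for m
  proof -
    have "x ^ (2 * m + 2) * gauss_weight s 1 x = gauss_weight s (m + 2) x" for x
      using gauss_weight_shift[of x "m + 1" s 1] by simp
    then have "(LINT x|lborel. x ^ (2 * m + 2) * gauss_weight s 1 x) = fact (m + 2) / (2 * s ^ (m + 3))"
      using integral_gauss_weight[OF assms(1), of "m + 2"] by (simp add: numeral_3_eq_3)
    moreover define A where "A = (a / 2)\<^sup>2"
    moreover have "(a / 2) ^ (2 * m + 2) = A * A ^ m"
      by (simp only: A_def power_mult[symmetric] power_add[symmetric]) (simp add: algebra_simps)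
    moreover have "(- (a\<^sup>2 / (4 * s))) ^ m = (-1) ^ m * A ^ m / s ^ m"
      by (simp add: A_def power_minus[of "_ / _"] power_divide power_mult_distrib power_mult[symmetric])
    ultimately show ?thesis
      using assms by (simp only: bessel2_coeff_def power_add A_def[symmetric]) (simp add: divide_simps del: fact_Suc power_Suc)
  qed
  moreover have "(\<lambda>m. (a / 2)\<^sup>2 / (2 * s ^ 3) * ((- (a\<^sup>2 / (4 * s))) ^ m /\<^sub>R fact m)) sums
      ((a / 2)\<^sup>2 / (2 * s ^ 3) * exp (- (a\<^sup>2 / (4 * s))))"
    by (intro sums_mult exp_converges)
  ultimately show ?thesis
    by (rule sums_cong_unique)
qed

section \<open>Weber's second integral by way of Laguerre polynomials\<close>

lemma shifted_exp_sums:
  fixes y :: real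
  shows "(\<lambda>n. if k \<le> n then (- y) ^ n / fact (n - k) else 0) sums ((- y) ^ k * exp (- y))"
proof -
  have "(\<lambda>n. (- y) ^ k * ((- y) ^ n /\<^sub>R fact n)) sums ((- y) ^ k * exp (- y))"
    by (intro sums_mult exp_converges)
  then have "(\<lambda>n. if k \<le> n + k then (- y) ^ (n + k) / fact (n + k - k) else 0) sums ((- y) ^ k * exp (- y))"
    by (simp add: power_add divide_inverse mult_ac)
  then show ?thesis
    by (subst (asm) sums_iff_shift) simp
qed

text \<open>Vandermonde's convolution for the coefficient of m + n + 2 over n. Splitting the mixed
  factorial (m + n + 2)! into a sum over k leaves n only in 1 / (n - k)!, so that the later sum over
  n is a shifted exponential series.\<close>

lemma vandermonde_fact:
  "(\<Sum>k\<le>m. if k \<le> n then 1 / (fact (m - k) * fact (n - k) * fact k * fact (k + 2)) else (0 :: real)) =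
    fact (m + n + 2) / (fact m * fact (m + 2) * fact n * fact (n + 2))"
proof -
  have t: "(if k \<le> n then 1 / (fact (m - k) * fact (n - k) * fact k * fact (k + 2)) else (0 :: real)) =
      (if k \<le> n then real (m choose k) * real (n + 2 choose (n - k)) / (fact m * fact (n + 2)) else 0)"
    if "k \<le> m" for k
  proof (cases "k \<le> n")
    case True
    have "real (m choose k) = fact m / (fact k * fact (m - k))"
      by (rule binomial_fact[OF that])
    moreover have "real (n + 2 choose (n - k)) = fact (n + 2) / (fact (n - k) * fact (k + 2))"
      using True by (subst binomial_fact) auto
    ultimately show ?thesis
      using True by (simp add: field_simps del: fact_Suc)
  qed auto
  have "(\<Sum>k\<le>m. if k \<le> n then 1 / (fact (m - k) * fact (n - k) * fact k * fact (k + 2)) else (0 :: real)) =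
      (\<Sum>k\<le>m. if k \<le> n then real (m choose k) * real (n + 2 choose (n - k)) / (fact m * fact (n + 2)) else 0)"
    using t by (intro sum.cong) auto
  also have "\<dots> = (\<Sum>k\<in>{..m} \<inter> {..n}. real (m choose k) * real (n + 2 choose (n - k)) / (fact m * fact (n + 2)))"
    by (subst sum.inter_restrict) (auto intro: sum.cong)
  also have "\<dots> = (\<Sum>k\<le>n. real (m choose k) * real (n + 2 choose (n - k)) / (fact m * fact (n + 2)))"
    by (rule sum.mono_neutral_left) (auto simp: binomial_eq_0)
  also have "\<dots> = real (\<Sum>k\<le>n. (m choose k) * (n + 2 choose (n - k))) / (fact m * fact (n + 2))"
    by (simp add: sum_divide_distrib)
  also have "(\<Sum>k\<le>n. (m choose k) * (n + 2 choose (n - k))) = (m + (n + 2)) choose n"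
    by (rule vandermonde)
  also have "real ((m + (n + 2)) choose n) = fact (m + n + 2) / (fact n * fact (m + 2))"
    by (subst binomial_fact) (auto simp: add_ac)
  finally show ?thesis
    by (simp add: mult_ac del: fact_Suc)
qed

text \<open>An instance of Kummer's transformation: the finite sum is the Laguerre polynomial
  L_m^(2)(y) divided by (m + 2)!.\<close>

lemma laguerre_sums:
  fixes y :: real
  shows "(\<lambda>n. (- y) ^ n * (fact (m + n + 2) / (fact m * fact (m + 2) * fact n * fact (n + 2)))) sums
    (exp (- y) * (\<Sum>k\<le>m. (- y) ^ k / (fact (m - k) * fact k * fact (k + 2))))"
proof -
  have "(\<lambda>n. \<Sum>k\<le>m. (if k \<le> n then (- y) ^ n / fact (n - k) else 0) * (1 / (fact (m - k) * fact k * fact (k + 2))))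
      sums (\<Sum>k\<le>m. (- y) ^ k * exp (- y) * (1 / (fact (m - k) * fact k * fact (k + 2))))"
    by (intro sums_sum sums_mult2 shifted_exp_sums)
  moreover have "(\<Sum>k\<le>m. (if k \<le> n then (- y) ^ n / fact (n - k) else 0) * (1 / (fact (m - k) * fact k * fact (k + 2)))) =
      (- y) ^ n * (fact (m + n + 2) / (fact m * fact (m + 2) * fact n * fact (n + 2)))" for n
    unfolding vandermonde_fact[symmetric] sum_distrib_left by (intro sum.cong refl) (auto simp: mult_ac)
  moreover have "(\<Sum>k\<le>m. (- y) ^ k * exp (- y) * (1 / (fact (m - k) * fact k * fact (k + 2)))) =
      exp (- y) * (\<Sum>k\<le>m. (- y) ^ k / (fact (m - k) * fact k * fact (k + 2)))"
    unfolding sum_distrib_left by (intro sum.cong refl) (auto simp: mult_ac)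
  ultimately show ?thesis
    by simp
qed

text \<open>The series is the modified Bessel function I_2(a b / (2 q)). As a function of the time q
  this is the heat kernel, with respect to r dr, of the operator g'' + g' / r - 4 g / r^2.\<close>

definition weber_kernel :: "real \<Rightarrow> real \<Rightarrow> real \<Rightarrow> real" where
  "weber_kernel q a b = exp (- ((a\<^sup>2 + b\<^sup>2) / (4 * q))) / (2 * q) *
     (\<Sum>k. (a\<^sup>2 / (4 * q) * (b\<^sup>2 / (4 * q))) ^ (k + 1) / (fact k * fact (k + 2)))"

lemma summable_weber_series: "summable (\<lambda>k. \<bar>z ^ k / (fact k * fact (k + 2))\<bar> :: real)"
proof (rule summable_comparison_test')
  show "summable (\<lambda>k. \<bar>z\<bar> ^ k / fact k)"
    using summable_exp_generic[of "\<bar>z\<bar>"] by (simp add: divide_inverse mult.commute)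
  show "norm \<bar>z ^ k / (fact k * fact (k + 2))\<bar> \<le> \<bar>z\<bar> ^ k / fact k" for k
  proof -
    have "\<bar>z\<bar> ^ k / (fact k * fact (k + 2)) \<le> \<bar>z\<bar> ^ k / (fact k * 1)"
      by (intro divide_left_mono mult_left_mono fact_ge_1) auto
    then show ?thesis
      by (simp add: power_abs abs_mult)
  qed
qed

lemma weber_series_sums:
  "(\<lambda>k. z ^ (k + 1) / (fact k * fact (k + 2))) sums (z * (\<Sum>k. z ^ k / (fact k * fact (k + 2)) :: real))"
proof -
  have "(\<lambda>k. z * (z ^ k / (fact k * fact (k + 2)))) sums (z * (\<Sum>k. z ^ k / (fact k * fact (k + 2))))"
    by (rule sums_mult[OF summable_sums[OF summable_rabs_cancel[OF summable_weber_series]]])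
  then show ?thesis
    by simp
qed

lemma weber_kernel_nonneg: "0 < q \<Longrightarrow> 0 \<le> weber_kernel q a b"
  unfolding weber_kernel_def
  using sums_summable[OF weber_series_sums[of "a\<^sup>2 / (4 * q) * (b\<^sup>2 / (4 * q))"]]
  by (intro mult_nonneg_nonneg suminf_nonneg) auto

lemma weber_kernel_commute: "weber_kernel q a b = weber_kernel q b a"
  by (simp add: weber_kernel_def add.commute mult.commute)

lemma borel_measurable_weber_kernel [measurable (raw)]:
  assumes [measurable]: "f \<in> borel_measurable M" "g \<in> borel_measurable M"
  shows "(\<lambda>x. weber_kernel q (f x) (g x)) \<in> borel_measurable M"
  unfolding weber_kernel_def by measurable

text \<open>Only the Bessel function of \<open>a\<close> is expanded at the outset. Its m-th term is
  then an integral against J_2(b x), which is a Laguerre polynomial times exp(-b^2 / (4 q)), and the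
  sum over m is recognized as a product of two series.\<close>

lemma weber_second_integral:
  assumes "0 < q" "0 \<le> a" "0 \<le> b"
  shows "(LINT x|lborel. bessel_J 2 (a * x) * (bessel_J 2 (b * x) * gauss_weight q 0 x)) = weber_kernel q a b"
proof -
  define x where "x = a\<^sup>2 / (4 * q)"
  define y where "y = b\<^sup>2 / (4 * q)"
  have pw: "(c / 2) ^ (2 * m + 2) = (c\<^sup>2 / (4 * q)) ^ (m + 1) * q ^ (m + 1)" for c :: real and m
  proof -
    have "(c / 2) ^ (2 * m + 2) = ((c / 2)\<^sup>2) ^ (m + 1)"
      by (simp only: power_mult[symmetric]) (simp add: algebra_simps)
    also have "(c / 2)\<^sup>2 = c\<^sup>2 / (4 * q) * q"
      using assms by (simp add: power_divide)
    finally show ?thesis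
      by (simp only: power_mult_distrib)
  qed
  have inner: "bessel2_coeff m * (a / 2) ^ (2 * m + 2) *
      (LINT t|lborel. t ^ (2 * m + 2) * (bessel_J 2 (b * t) * gauss_weight q 0 t)) =
      x * y * exp (- y) / (2 * q) * (\<Sum>k\<le>m. ((x * y) ^ k / (fact k * fact (k + 2))) * ((- x) ^ (m - k) / fact (m - k)))"
    for m
  proof -
    have "t ^ (2 * m + 2) * (bessel_J 2 (b * t) * gauss_weight q 0 t) =
        bessel_J 2 (b * t) * gauss_weight q (m + 1) t" for t
      using gauss_weight_shift[of t "m + 1" q 0] by (simp add: mult_ac)
    then have eq: "(LINT t|lborel. t ^ (2 * m + 2) * (bessel_J 2 (b * t) * gauss_weight q 0 t)) =
        (LINT t|lborel. bessel_J 2 (b * t) * gauss_weight q (m + 1) t)"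
      by presburger
    have "(\<lambda>n. bessel2_coeff n * (b / 2) ^ (2 * n + 2) *
        (LINT t|lborel. t ^ (2 * n + 2) * gauss_weight q (m + 1) t)) sums
        (LINT t|lborel. bessel_J 2 (b * t) * gauss_weight q (m + 1) t)"
    proof (rule bessel2_integral_sums)
      show "integrable lborel (\<lambda>x. exp (b * x) * \<bar>gauss_weight q (m + 1) x\<bar>)"
        using integrable_exp_gauss_weight[OF assms(1), of b "m + 1"] by (simp add: gauss_weight_nonneg)
    qed (use assms in \<open>auto simp: gauss_weight_def\<close>)
    moreover have "bessel2_coeff n * (b / 2) ^ (2 * n + 2) *
        (LINT t|lborel. t ^ (2 * n + 2) * gauss_weight q (m + 1) t) =
        fact m * fact (m + 2) * y / (2 * q ^ (m + 2)) *
        ((- y) ^ n * (fact (m + n + 2) / (fact m * fact (m + 2) * fact n * fact (n + 2))))" for n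
    proof -
      have "t ^ (2 * n + 2) * gauss_weight q (m + 1) t = gauss_weight q (m + n + 2) t" for t
        using gauss_weight_shift[of t "n + 1" q "m + 1"] by (simp add: add_ac)
      then have 1: "(LINT t|lborel. t ^ (2 * n + 2) * gauss_weight q (m + 1) t) =
          fact (m + n + 2) / (2 * q ^ (m + n + 2 + 1))"
        using integral_gauss_weight[OF assms(1), of "m + n + 2"] by presburger
      have 2: "(b / 2) ^ (2 * n + 2) = y ^ n * y * q ^ (n + 1)"
        unfolding pw y_def by simp
      have 3: "q ^ (m + n + 2 + 1) = q ^ (n + 1) * q ^ (m + 2)"
        by (simp add: power_add mult_ac)
      have 4: "(- y) ^ n = (-1) ^ n * y ^ n"
        by (rule power_minus)
      show ?thesis
        unfolding 1 2 3 4 bessel2_coeff_def using assms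
        by (simp add: divide_simps del: fact_Suc power_Suc power_add add_2_eq_Suc add_2_eq_Suc')
    qed
    moreover have "(\<lambda>n. fact m * fact (m + 2) * y / (2 * q ^ (m + 2)) *
        ((- y) ^ n * (fact (m + n + 2) / (fact m * fact (m + 2) * fact n * fact (n + 2))))) sums
        (fact m * fact (m + 2) * y / (2 * q ^ (m + 2)) *
        (exp (- y) * (\<Sum>k\<le>m. (- y) ^ k / (fact (m - k) * fact k * fact (k + 2)))))"
      by (intro sums_mult laguerre_sums)
    ultimately have int: "(LINT t|lborel. bessel_J 2 (b * t) * gauss_weight q (m + 1) t) =
        fact m * fact (m + 2) * y / (2 * q ^ (m + 2)) *
        (exp (- y) * (\<Sum>k\<le>m. (- y) ^ k / (fact (m - k) * fact k * fact (k + 2))))"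
      by (rule sums_cong_unique)
    have "(a / 2) ^ (2 * m + 2) = x ^ m * x * q ^ (m + 1)" "q ^ (m + 2) = q ^ (m + 1) * q"
      "(- x) ^ m = (-1) ^ m * x ^ m"
      unfolding pw x_def by (simp, simp, rule power_minus)
    then have "bessel2_coeff m * (a / 2) ^ (2 * m + 2) *
        (LINT t|lborel. t ^ (2 * m + 2) * (bessel_J 2 (b * t) * gauss_weight q 0 t)) =
        x * y * exp (- y) / (2 * q) *
          ((- x) ^ m * (\<Sum>k\<le>m. (- y) ^ k / (fact (m - k) * fact k * fact (k + 2))))"
      unfolding eq int bessel2_coeff_def using assms
      by (simp add: divide_simps del: fact_Suc power_Suc power_add add_2_eq_Suc add_2_eq_Suc')
    also have "(- x) ^ m * (\<Sum>k\<le>m. (- y) ^ k / (fact (m - k) * fact k * fact (k + 2))) =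
        (\<Sum>k\<le>m. ((x * y) ^ k / (fact k * fact (k + 2))) * ((- x) ^ (m - k) / fact (m - k)))"
      unfolding sum_distrib_left
    proof (intro sum.cong refl)
      fix k assume "k \<in> {..m}"
      then have "(- x) ^ m = (- x) ^ k * (- x) ^ (m - k)"
        by (simp flip: power_add)
      moreover have "(- x) ^ k * (- y) ^ k = (x * y) ^ k"
        by (simp flip: power_mult_distrib)
      ultimately show "(- x) ^ m * ((- y) ^ k / (fact (m - k) * fact k * fact (k + 2))) =
          ((x * y) ^ k / (fact k * fact (k + 2))) * ((- x) ^ (m - k) / fact (m - k))"
        by (simp add: mult_ac del: fact_Suc)
    qed
    finally show ?thesis .
  qed
  \<comment> \<open>The Laguerre coefficients 1 / ((m - k)! k! (k + 2)!) make the sum over m a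
    Cauchy product: the I_2 series in x y times the series of exp(-x).\<close>
  have "(\<lambda>m. \<Sum>k\<le>m. ((x * y) ^ k / (fact k * fact (k + 2))) * ((- x) ^ (m - k) / fact (m - k))) sums
      ((\<Sum>k. (x * y) ^ k / (fact k * fact (k + 2))) * (\<Sum>k. (- x) ^ k / fact k))"
  proof (rule Cauchy_product_sums)
    show "summable (\<lambda>k. norm ((x * y) ^ k / (fact k * fact (k + 2))))"
      using summable_weber_series[of "x * y"] by simp
    show "summable (\<lambda>k. norm ((- x) ^ k / fact k))"
      using summable_norm_exp[of "- x"] by (simp add: divide_inverse mult.commute)
  qed
  then have outer: "(\<lambda>m. x * y * exp (- y) / (2 * q) *
        (\<Sum>k\<le>m. ((x * y) ^ k / (fact k * fact (k + 2))) * ((- x) ^ (m - k) / fact (m - k)))) sums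
      (x * y * exp (- y) / (2 * q) * ((\<Sum>k. (x * y) ^ k / (fact k * fact (k + 2))) * (\<Sum>k. (- x) ^ k / fact k)))"
    by (rule sums_mult)
  have "(\<lambda>m. bessel2_coeff m * (a / 2) ^ (2 * m + 2) *
      (LINT t|lborel. t ^ (2 * m + 2) * (bessel_J 2 (b * t) * gauss_weight q 0 t))) sums
      (LINT t|lborel. bessel_J 2 (a * t) * (bessel_J 2 (b * t) * gauss_weight q 0 t))"
  proof (rule bessel2_integral_sums)
    show "integrable lborel (\<lambda>t. exp (a * t) * \<bar>bessel_J 2 (b * t) * gauss_weight q 0 t\<bar>)"
    proof (rule Bochner_Integration.integrable_bound[OF integrable_exp_gauss_weight[OF assms(1), of "a + b" 0]])
      show "AE t in lborel. norm (exp (a * t) * \<bar>bessel_J 2 (b * t) * gauss_weight q 0 t\<bar>) \<le>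
          norm (exp ((a + b) * t) * gauss_weight q 0 t)"
      proof (rule AE_I2)
        fix t :: real
        have "\<bar>bessel_J 2 (b * t)\<bar> * gauss_weight q 0 t \<le> exp (b * t) * gauss_weight q 0 t"
          using bessel2_bound[of "b * t"] assms(3)
          by (cases "t > 0") (auto simp: gauss_weight_def)
        then have "exp (a * t) * (\<bar>bessel_J 2 (b * t)\<bar> * gauss_weight q 0 t) \<le>
            exp (a * t) * (exp (b * t) * gauss_weight q 0 t)"
          by (intro mult_left_mono) auto
        then show "norm (exp (a * t) * \<bar>bessel_J 2 (b * t) * gauss_weight q 0 t\<bar>) \<le>
          norm (exp ((a + b) * t) * gauss_weight q 0 t)"
          by (simp only: abs_mult abs_exp_cancel real_norm_def abs_abs abs_of_nonneg[OF gauss_weight_nonneg]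
              distrib_right exp_add mult.assoc)
      qed
    qed auto
  qed (use assms in \<open>auto simp: gauss_weight_def\<close>)
  then have "(LINT t|lborel. bessel_J 2 (a * t) * (bessel_J 2 (b * t) * gauss_weight q 0 t)) =
      x * y * exp (- y) / (2 * q) * ((\<Sum>k. (x * y) ^ k / (fact k * fact (k + 2))) * (\<Sum>k. (- x) ^ k / fact k))"
    by (rule sums_cong_unique[OF _ inner outer])
  also have "(\<Sum>k. (- x) ^ k / fact k) = exp (- x)"
    by (simp add: exp_def divide_inverse mult.commute)
  also have "x * y * exp (- y) / (2 * q) * ((\<Sum>k. (x * y) ^ k / (fact k * fact (k + 2))) * exp (- x)) =
      exp (- (x + y)) / (2 * q) * (x * y * (\<Sum>k. (x * y) ^ k / (fact k * fact (k + 2))))"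
  proof -
    have "exp (- (x + y)) = exp (- x) * exp (- y)"
      by (simp add: exp_add[symmetric])
    then show ?thesis
      by (simp only: divide_inverse mult_ac)
  qed
  also have "x * y * (\<Sum>k. (x * y) ^ k / (fact k * fact (k + 2))) =
      (\<Sum>k. (x * y) ^ (k + 1) / (fact k * fact (k + 2)))"
    by (rule sums_unique[OF weber_series_sums])
  finally show ?thesis
    unfolding weber_kernel_def x_def y_def add_divide_distrib .
qed

section \<open>Injectivity of the Hankel transform\<close>

text \<open>The function r^2 solves g'' + g' / r - 4 g / r^2 = 0, so the heat kernel leaves it
  unchanged. The proof expands the kernel into nonnegative Gaussian weights in b, integrates
  termwise and meets the series of exp X.\<close>

lemma nn_integral_weber_kernel:
  assumes "0 < q"
  shows "(\<integral>\<^sup>+b. ennreal (indicator {0<..} b * (b ^ 3 * weber_kernel q a b)) \<partial>lborel) = ennreal (a\<^sup>2)"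
proof -
  define X where "X = a\<^sup>2 / (4 * q)"
  define c where "c k = exp (- X) / (2 * q) * (X ^ (k + 1) / (4 * q) ^ (k + 1) / (fact k * fact (k + 2)))" for k
  have X: "0 \<le> X" using assms by (simp add: X_def)
  have c: "0 \<le> c k" for k
    using assms X by (simp add: c_def)
  have series: "(\<lambda>k. c k * gauss_weight (1 / (4 * q)) (k + 2) b) sums
      (indicator {0<..} b * (b ^ 3 * weber_kernel q a b))" for b
  proof -
    define z where "z = X * (b\<^sup>2 / (4 * q))"
    have "(\<lambda>k. indicator {0<..} b * (b ^ 3 * (exp (- ((a\<^sup>2 + b\<^sup>2) / (4 * q))) / (2 * q) *
        (z ^ (k + 1) / (fact k * fact (k + 2)))))) sums
        (indicator {0<..} b * (b ^ 3 * weber_kernel q a b))"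
      unfolding weber_kernel_def z_def X_def
      by (intro sums_mult summable_sums) (rule sums_summable[OF weber_series_sums])
    moreover have "indicator {0<..} b * (b ^ 3 * (exp (- ((a\<^sup>2 + b\<^sup>2) / (4 * q))) / (2 * q) *
        (z ^ (k + 1) / (fact k * fact (k + 2))))) = c k * gauss_weight (1 / (4 * q)) (k + 2) b" for k
    proof -
      have 1: "exp (- ((a\<^sup>2 + b\<^sup>2) / (4 * q))) = exp (- X) * exp (- (1 / (4 * q)) * b\<^sup>2)"
        by (simp add: X_def exp_add[symmetric] add_divide_distrib)
      have 2: "z ^ (k + 1) = X ^ (k + 1) / (4 * q) ^ (k + 1) * (b\<^sup>2) ^ (k + 1)"
        by (simp only: z_def power_mult_distrib power_divide times_divide_eq_right times_divide_eq_left)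
      have 3: "b ^ (2 * (k + 2) + 1) = b ^ 3 * (b\<^sup>2) ^ (k + 1)"
        by (simp only: power_mult[symmetric] power_add[symmetric]) (rule arg_cong[where f="(^) b"], simp)
      show ?thesis
        unfolding 1 2 3 gauss_weight_def c_def by (simp only: divide_inverse mult_ac)
    qed
    ultimately show ?thesis
      by simp
  qed
  have "(\<integral>\<^sup>+b. ennreal (indicator {0<..} b * (b ^ 3 * weber_kernel q a b)) \<partial>lborel) =
      (\<integral>\<^sup>+b. (\<Sum>k. ennreal (c k * gauss_weight (1 / (4 * q)) (k + 2) b)) \<partial>lborel)"
    using c gauss_weight_nonneg sums_summable[OF series] sums_unique[OF series]
    by (intro nn_integral_cong) (simp add: suminf_ennreal2)
  also have "\<dots> = (\<Sum>k. \<integral>\<^sup>+b. ennreal (c k * gauss_weight (1 / (4 * q)) (k + 2) b) \<partial>lborel)"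
    by (rule nn_integral_suminf) measurable
  also have "\<dots> = (\<Sum>k. ennreal (a\<^sup>2 * exp (- X) * (X ^ k / fact k)))"
  proof (rule suminf_cong)
    fix k
    have "(\<integral>\<^sup>+b. ennreal (c k * gauss_weight (1 / (4 * q)) (k + 2) b) \<partial>lborel) =
        ennreal (LINT b|lborel. c k * gauss_weight (1 / (4 * q)) (k + 2) b)"
      using assms c gauss_weight_nonneg
      by (intro nn_integral_eq_integral integrable_mult_right integrable_gauss_weight) auto
    also have "(LINT b|lborel. c k * gauss_weight (1 / (4 * q)) (k + 2) b) =
        c k * (fact (k + 2) / (2 * (1 / (4 * q)) ^ (k + 2 + 1)))"
      using integral_gauss_weight[of "1 / (4 * q)" "k + 2"] assms by simp
    also have "\<dots> = a\<^sup>2 * exp (- X) * (X ^ k / fact k)"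
    proof -
      define Q where "Q = 4 * q"
      have Q: "Q > 0" "q = Q / 4" "a\<^sup>2 = X * Q" using assms by (auto simp: Q_def X_def)
      have "(1 / Q) ^ (k + 2 + 1) = 1 / (Q ^ (k + 1) * Q * Q)"
        by (simp add: power_divide)
      moreover have "X ^ (k + 1) = X ^ k * X"
        by simp
      ultimately show ?thesis
        unfolding c_def Q_def[symmetric] unfolding Q(3) unfolding Q(2) using Q(1)
        by (simp add: field_simps del: fact_Suc power_Suc power_add add_2_eq_Suc add_2_eq_Suc')
    qed
    finally show "(\<integral>\<^sup>+b. ennreal (c k * gauss_weight (1 / (4 * q)) (k + 2) b) \<partial>lborel) =
        ennreal (a\<^sup>2 * exp (- X) * (X ^ k / fact k))" .
  qed
  also have "\<dots> = ennreal (\<Sum>k. a\<^sup>2 * exp (- X) * (X ^ k / fact k))"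
  proof (rule suminf_ennreal2)
    have "summable (\<lambda>k. X ^ k / fact k)"
      using summable_exp_generic[of X] by (simp add: divide_inverse mult.commute)
    then show "summable (\<lambda>k. a\<^sup>2 * exp (- X) * (X ^ k / fact k))"
      by (rule summable_mult)
  qed (use X in auto)
  also have "(\<Sum>k. a\<^sup>2 * exp (- X) * (X ^ k / fact k)) = a\<^sup>2"
  proof -
    have "(\<lambda>k. X ^ k / fact k) sums exp X"
      using exp_converges[of X] by (simp add: divide_inverse mult.commute)
    then have "(\<lambda>k. a\<^sup>2 * exp (- X) * (X ^ k / fact k)) sums (a\<^sup>2 * exp (- X) * exp X)"
      by (rule sums_mult)
    then show ?thesis
      by (simp add: sums_iff exp_minus)
  qed
  finally show ?thesis .
qed

text \<open>Moves the transform from \<open>G\<close> onto the weight. The support of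
  \<open>G\<close> in (0, R] makes exp(R x) a majorant of J_2(r x) that is uniform in r, and the
  weight has to beat it.\<close>

lemma hankel_fubini:
  fixes G \<omega> :: "real \<Rightarrow> real"
  assumes G: "integrable lborel G" "\<And>r. G r \<noteq> 0 \<Longrightarrow> 0 < r \<and> r \<le> R"
    and [measurable]: "\<omega> \<in> borel_measurable borel" and supp: "\<And>x. x \<le> 0 \<Longrightarrow> \<omega> x = 0"
    and int: "integrable lborel (\<lambda>x. exp (R * x) * \<bar>\<omega> x\<bar>)"
  shows "integrable lborel (\<lambda>x. (LINT r|lborel. G r * bessel_J 2 (r * x)) * \<omega> x)" (is ?int)
    and "(LINT x|lborel. (LINT r|lborel. G r * bessel_J 2 (r * x)) * \<omega> x) =
      (LINT r|lborel. G r * (LINT x|lborel. bessel_J 2 (r * x) * \<omega> x))" (is ?eq)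
proof -
  have [measurable]: "G \<in> borel_measurable borel"
    using G(1) by (simp add: borel_measurable_integrable)
  define f where "f r x = G r * (bessel_J 2 (r * x) * \<omega> x)" for r x
  define M where "M x = exp (R * x) * \<bar>\<omega> x\<bar>" for x
  have intM: "integrable lborel M"
    using int by (simp add: M_def[abs_def])
  have [measurable]: "M \<in> borel_measurable borel"
    unfolding M_def by measurable
  have bd: "norm (f r x) \<le> \<bar>G r\<bar> * M x" for r x
  proof (cases "G r = 0 \<or> x \<le> 0")
    case False
    then have r: "0 < r" "r \<le> R" and x: "x > 0" using G(2)[of r] by auto
    have "\<bar>bessel_J 2 (r * x)\<bar> \<le> exp (r * x)"
      using r x by (intro bessel2_bound) auto
    also have "\<dots> \<le> exp (R * x)"
      using r x by simp
    finally show ?thesis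
      by (simp add: f_def M_def abs_mult mult_left_mono mult_right_mono)
  qed (auto simp: f_def M_def supp)
  have int_f: "integrable (lborel \<Otimes>\<^sub>M lborel) (case_prod f)"
  proof (rule lborel_pair.Fubini_integrable)
    show "case_prod f \<in> borel_measurable (lborel \<Otimes>\<^sub>M lborel)"
      unfolding f_def by measurable
    have [measurable]: "f r \<in> borel_measurable borel" for r
      unfolding f_def by measurable
    have 1: "integrable lborel (f r)" for r
      by (rule Bochner_Integration.integrable_bound[where f="\<lambda>x. \<bar>G r\<bar> * M x"])
        (use bd intM in \<open>auto intro: order_trans[OF _ abs_ge_self]\<close>)
    then show "AE x in lborel. integrable lborel (\<lambda>y. case (x, y) of (x, y) \<Rightarrow> f x y)"
      by auto
    show "integrable lborel (\<lambda>x. LBINT y. norm (case (x, y) of (x, y) \<Rightarrow> f x y))"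
    proof (rule Bochner_Integration.integrable_bound[where f="\<lambda>r. \<bar>G r\<bar> * (LINT x|lborel. M x)"])
      show "integrable lborel (\<lambda>r. \<bar>G r\<bar> * (LINT x|lborel. M x))"
        using G(1) by auto
      show "(\<lambda>x. LBINT y. norm (case (x, y) of (x, y) \<Rightarrow> f x y)) \<in> borel_measurable lborel"
        unfolding f_def by measurable
      have "(LBINT y. norm (f x y)) \<le> (LBINT y. \<bar>G x\<bar> * M y)" for x
        using 1 intM bd by (intro integral_mono) auto
      then show "AE x in lborel. norm (LBINT y. norm (case (x, y) of (x, y) \<Rightarrow> f x y))
          \<le> norm (\<bar>G x\<bar> * (LINT x|lborel. M x))"
        by (intro AE_I2) (auto intro: order_trans[OF _ abs_ge_self])
    qed
  qed
  have eq: "(LINT r|lborel. f r x) = (LINT r|lborel. G r * bessel_J 2 (r * x)) * \<omega> x" for x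
    by (simp add: f_def mult.assoc[symmetric])
  show ?int
    using lborel_pair.integrable_snd[OF int_f] by (simp add: eq)
  show ?eq
    using lborel_pair.Fubini_integral[OF int_f] unfolding eq by (simp add: f_def)
qed

text \<open>A function that is not integrable has integral 0 by convention, so Schur's test can take
  absolute values before any inner integral is known to exist.\<close>

lemma ennreal_abs_integral_le:
  fixes f :: "'a \<Rightarrow> real"
  shows "ennreal \<bar>integral\<^sup>L M f\<bar> \<le> (\<integral>\<^sup>+x. ennreal \<bar>f x\<bar> \<partial>M)"
proof (cases "integrable M f")
  case True
  from integral_norm_bound_ennreal[OF this] show ?thesis by simp
qed (simp add: not_integrable_integral_eq)

text \<open>Schur's test with the weight \<open>r\<^sup>2\<close>, which \<open>weber_kernel q\<close> preserves with respect to
  \<open>r dr\<close>; here \<open>G r = g r * r\<close>.\<close>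

lemma weber_kernel_schur_bound:
  fixes G :: "real \<Rightarrow> real"
  assumes [measurable]: "G \<in> borel_measurable borel" and supp: "\<And>r. G r \<noteq> 0 \<Longrightarrow> 0 < r"
    and "0 < q" and C: "(\<integral>\<^sup>+r. ennreal ((G r)\<^sup>2 / r) \<partial>lborel) \<le> ennreal C" "0 \<le> C"
  shows "(LINT r|lborel. G r * (LINT s|lborel. G s * weber_kernel q s r)) \<le> C"
proof -
  \<comment> \<open>\<open>w\<close> is the weight s^2 together with the measure s ds, and
    \<open>p\<close> is G^2 / w on the support. The kernel turns \<open>w\<close> into r^2, and p r
    * r^2 = (G r)^2 / r is the density of the L^2 norm.\<close>
  define w where "w s = indicator {0<..} s * s ^ 3" for s :: real
  define p where "p r = (G r)\<^sup>2 / r ^ 3" for r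
  have [measurable]: "w \<in> borel_measurable borel" "p \<in> borel_measurable borel"
    unfolding w_def p_def by measurable
  have w0: "0 \<le> w s" for s by (auto simp: w_def indicator_def)
  have p0: "0 \<le> p r" for r using supp[of r] by (cases "G r = 0") (auto simp: p_def)
  let ?K = "weber_kernel q"
  have K0: "0 \<le> ?K r s" for r s using weber_kernel_nonneg[OF \<open>0 < q\<close>] .
  have am: "\<bar>G r\<bar> * \<bar>G s\<bar> \<le> 1/2 * (p r * w s + p s * w r)" for r s
  proof (cases "G r = 0 \<or> G s = 0")
    case False
    then have rs: "0 < r" "0 < s" using supp by auto
    then have r3: "0 < r ^ 3" "0 < s ^ 3" by auto
    have "0 \<le> (\<bar>G r\<bar> * s ^ 3 - \<bar>G s\<bar> * r ^ 3)\<^sup>2 / (r ^ 3 * s ^ 3)"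
      using r3 by simp
    also have "\<dots> = (G r)\<^sup>2 / r ^ 3 * s ^ 3 + (G s)\<^sup>2 / s ^ 3 * r ^ 3 - 2 * (\<bar>G r\<bar> * \<bar>G s\<bar>)"
    proof -
      obtain A B where AB: "A = r ^ 3" "B = s ^ 3" "0 < A" "0 < B" using r3 by blast
      have "(x * B - y * A)\<^sup>2 / (A * B) = x\<^sup>2 / A * B + y\<^sup>2 / B * A - 2 * (x * y)" for x y :: real
        using AB(3,4) by (simp add: power2_eq_square field_simps)
      from this[of "\<bar>G r\<bar>" "\<bar>G s\<bar>"] show ?thesis
        by (simp add: AB(1,2))
    qed
    finally show ?thesis
      using rs by (simp add: p_def w_def)
  qed (use p0 w0 in auto)
  have "ennreal (LINT r|lborel. G r * (LINT s|lborel. G s * ?K s r)) \<le>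
      (\<integral>\<^sup>+r. ennreal \<bar>G r * (LINT s|lborel. G s * ?K s r)\<bar> \<partial>lborel)"
    by (rule order_trans[OF _ ennreal_abs_integral_le]) (simp add: ennreal_leI)
  also have "\<dots> \<le> (\<integral>\<^sup>+r. (\<integral>\<^sup>+s. ennreal (1/2 * (p r * (w s * ?K r s) + p s * (w r * ?K s r))) \<partial>lborel) \<partial>lborel)"
  proof (rule nn_integral_mono)
    fix r
    have "ennreal \<bar>G r * (LINT s|lborel. G s * ?K s r)\<bar> =
        ennreal \<bar>LINT s|lborel. G r * (G s * ?K s r)\<bar>"
      by simp
    also have "\<dots> \<le> (\<integral>\<^sup>+s. ennreal \<bar>G r * (G s * ?K s r)\<bar> \<partial>lborel)"
      by (rule ennreal_abs_integral_le)
    also have "\<dots> \<le> (\<integral>\<^sup>+s. ennreal (1/2 * (p r * (w s * ?K r s) + p s * (w r * ?K s r))) \<partial>lborel)"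
    proof (intro nn_integral_mono ennreal_leI)
      fix s
      have "\<bar>G r * (G s * ?K s r)\<bar> = \<bar>G r\<bar> * \<bar>G s\<bar> * ?K s r"
        using K0 by (simp add: abs_mult)
      also have "\<dots> \<le> 1/2 * (p r * w s + p s * w r) * ?K s r"
        by (intro mult_right_mono am K0)
      also have "\<dots> = 1/2 * (p r * (w s * ?K r s) + p s * (w r * ?K s r))"
        by (simp add: algebra_simps weber_kernel_commute[of q r s])
      finally show "\<bar>G r * (G s * ?K s r)\<bar> \<le> 1/2 * (p r * (w s * ?K r s) + p s * (w r * ?K s r))" .
    qed
    finally show "ennreal \<bar>G r * (LINT s|lborel. G s * ?K s r)\<bar> \<le>
        (\<integral>\<^sup>+s. ennreal (1/2 * (p r * (w s * ?K r s) + p s * (w r * ?K s r))) \<partial>lborel)" .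
  qed
  also have "\<dots> = (\<integral>\<^sup>+r. (\<integral>\<^sup>+s. ennreal (1/2 * p r) * ennreal (w s * ?K r s) +
      ennreal (1/2 * p s) * ennreal (w r * ?K s r) \<partial>lborel) \<partial>lborel)"
    using p0 w0 K0 by (intro nn_integral_cong) (simp add: ennreal_plus[symmetric] ennreal_mult[symmetric] distrib_left mult.assoc del: ennreal_plus)
  also have "\<dots> = (\<integral>\<^sup>+r. (\<integral>\<^sup>+s. ennreal (1/2 * p r) * ennreal (w s * ?K r s) \<partial>lborel) \<partial>lborel) +
      (\<integral>\<^sup>+r. (\<integral>\<^sup>+s. ennreal (1/2 * p s) * ennreal (w r * ?K s r) \<partial>lborel) \<partial>lborel)"
    by (subst nn_integral_add[symmetric], measurable) (simp add: nn_integral_add)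
  \<comment> \<open>With the order exchanged, the second summand is the first with r and s renamed,
    so the next equation rewrites both.\<close>
  also have "(\<integral>\<^sup>+r. (\<integral>\<^sup>+s. ennreal (1/2 * p s) * ennreal (w r * ?K s r) \<partial>lborel) \<partial>lborel) =
      (\<integral>\<^sup>+s. (\<integral>\<^sup>+r. ennreal (1/2 * p s) * ennreal (w r * ?K s r) \<partial>lborel) \<partial>lborel)"
    by (rule lborel_pair.Fubini') measurable
  also have "(\<integral>\<^sup>+r. (\<integral>\<^sup>+s. ennreal (1/2 * p r) * ennreal (w s * ?K r s) \<partial>lborel) \<partial>lborel) =
      (\<integral>\<^sup>+r. ennreal (1/2 * ((G r)\<^sup>2 / r)) \<partial>lborel)"
  proof (rule nn_integral_cong)
    fix r
    have "(\<integral>\<^sup>+s. ennreal (1/2 * p r) * ennreal (w s * ?K r s) \<partial>lborel) =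
        ennreal (1/2 * p r) * (\<integral>\<^sup>+s. ennreal (w s * ?K r s) \<partial>lborel)"
      by (rule nn_integral_cmult) measurable
    also have "(\<integral>\<^sup>+s. ennreal (w s * ?K r s) \<partial>lborel) = ennreal (r\<^sup>2)"
      using nn_integral_weber_kernel[OF \<open>0 < q\<close>, of r] by (simp add: w_def mult.assoc)
    also have "ennreal (1/2 * p r) * ennreal (r\<^sup>2) = ennreal (1/2 * p r * r\<^sup>2)"
      by (rule ennreal_mult[symmetric]) (use p0 in auto)
    also have "1/2 * p r * r\<^sup>2 = 1/2 * ((G r)\<^sup>2 / r)"
      by (simp add: p_def power3_eq_cube power2_eq_square)
    finally show "(\<integral>\<^sup>+s. ennreal (1/2 * p r) * ennreal (w s * ?K r s) \<partial>lborel) =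
        ennreal (1/2 * ((G r)\<^sup>2 / r))" .
  qed
  also have "\<dots> = ennreal (1/2) * (\<integral>\<^sup>+r. ennreal ((G r)\<^sup>2 / r) \<partial>lborel)"
  proof -
    have "0 \<le> (G r)\<^sup>2 / r" for r
      using supp[of r] by (cases "G r = 0") auto
    then have "ennreal (1/2 * ((G r)\<^sup>2 / r)) = ennreal (1/2) * ennreal ((G r)\<^sup>2 / r)" for r
      by (intro ennreal_mult) auto
    then have "(\<integral>\<^sup>+r. ennreal (1/2 * ((G r)\<^sup>2 / r)) \<partial>lborel) =
        (\<integral>\<^sup>+r. ennreal (1/2) * ennreal ((G r)\<^sup>2 / r) \<partial>lborel)"
      by presburger
    also have "\<dots> = ennreal (1/2) * (\<integral>\<^sup>+r. ennreal ((G r)\<^sup>2 / r) \<partial>lborel)"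
      by (rule nn_integral_cmult) measurable
    finally show ?thesis .
  qed
  also have "\<dots> + \<dots> \<le> ennreal (1/2) * ennreal C + ennreal (1/2) * ennreal C"
    using C by (intro add_mono mult_left_mono) auto
  also have "\<dots> = ennreal C"
  proof -
    have "ennreal (1/2) * ennreal C = ennreal (1/2 * C)"
      by (rule ennreal_mult[symmetric]) (use C(2) in auto)
    then show ?thesis
      using C(2) by (simp add: ennreal_plus[symmetric] del: ennreal_plus)
  qed
  finally show ?thesis
    using C(2) by (auto simp: ennreal_le_iff2)
qed

text \<open>One half of Parseval, with a damping: the square of the transform integrated against xi
  exp(-q xi^2) is the quadratic form of the Weber kernel. The constant \<open>C\<close> depends
  neither on \<open>q\<close> nor on the support bound \<open>R\<close>, so it will serve all
  truncations at once.\<close>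

lemma hankel_L2_bound:
  fixes G :: "real \<Rightarrow> real"
  assumes G: "integrable lborel G" "\<And>r. G r \<noteq> 0 \<Longrightarrow> 0 < r \<and> r \<le> R"
    and "0 < q" and C: "(\<integral>\<^sup>+r. ennreal ((G r)\<^sup>2 / r) \<partial>lborel) \<le> ennreal C" "0 \<le> C"
  defines "H \<equiv> \<lambda>x. LINT r|lborel. G r * bessel_J 2 (r * x)"
  shows "integrable lborel (\<lambda>x. (H x)\<^sup>2 * gauss_weight q 0 x)"
    and "(LINT x|lborel. (H x)\<^sup>2 * gauss_weight q 0 x) \<le> C"
proof -
  have [measurable]: "G \<in> borel_measurable borel"
    using G(1) by (simp add: borel_measurable_integrable)
  have [measurable]: "H \<in> borel_measurable borel"
    unfolding H_def by measurable
  let ?w = "gauss_weight q 0"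
  have w0: "?w x = 0" if "x \<le> 0" for x
    using that by (simp add: gauss_weight_def)
  define B where "B = (LINT r|lborel. \<bar>G r\<bar>)"
  have B0: "0 \<le> B"
    unfolding B_def by simp
  have HB: "\<bar>H x\<bar> \<le> B * exp (R * x)" if "x > 0" for x
  proof -
    have "\<bar>G r * bessel_J 2 (r * x)\<bar> \<le> \<bar>G r\<bar> * exp (R * x)" for r
    proof (cases "G r = 0")
      case False
      then have r: "0 < r" "r \<le> R" using G(2)[of r] by auto
      have "\<bar>bessel_J 2 (r * x)\<bar> \<le> exp (r * x)"
        using r that by (intro bessel2_bound) auto
      also have "\<dots> \<le> exp (R * x)"
        using r that by simp
      finally show ?thesis
        by (simp add: abs_mult mult_left_mono)
    qed auto
    note bd = this
    have iG: "integrable lborel (\<lambda>r. \<bar>G r\<bar> * exp (R * x))"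
      using G(1) by auto
    have "integrable lborel (\<lambda>r. G r * bessel_J 2 (r * x))"
      by (rule Bochner_Integration.integrable_bound[OF iG]) (use bd in auto)
    then have "norm (H x) \<le> (LINT r|lborel. \<bar>G r\<bar> * exp (R * x))"
      unfolding H_def using iG bd by (intro Bochner_Integration.integral_norm_bound_integral) auto
    then show ?thesis
      by (simp add: B_def)
  qed
  have i1: "integrable lborel (\<lambda>x. exp (R * x) * \<bar>H x * ?w x\<bar>)"
  proof (rule Bochner_Integration.integrable_bound)
    show "integrable lborel (\<lambda>x. B * (exp (2 * R * x) * ?w x))"
      by (intro integrable_mult_right integrable_exp_gauss_weight assms)
    show "AE x in lborel. norm (exp (R * x) * \<bar>H x * ?w x\<bar>) \<le> norm (B * (exp (2 * R * x) * ?w x))"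
    proof (rule AE_I2)
      fix x :: real
      show "norm (exp (R * x) * \<bar>H x * ?w x\<bar>) \<le> norm (B * (exp (2 * R * x) * ?w x))"
      proof (cases "x > 0")
        case True
        have "exp (R * x) * (\<bar>H x\<bar> * ?w x) \<le> exp (R * x) * (B * exp (R * x) * ?w x)"
          by (intro mult_left_mono mult_right_mono HB True gauss_weight_nonneg) auto
        also have "\<dots> = B * (exp (2 * R * x) * ?w x)"
        proof -
          have "exp (2 * R * x) = exp (R * x) * exp (R * x)"
            by (simp add: exp_add[symmetric])
          then show ?thesis
            by (simp only: mult_ac)
        qed
        finally show ?thesis
          using gauss_weight_nonneg[of q 0 x] B0 by (simp add: abs_mult)
      qed (simp add: w0)
    qed
  qed auto
  have i2: "integrable lborel (\<lambda>x. exp (R * x) * \<bar>bessel_J 2 (s * x) * ?w x\<bar>)" if "0 < s" for s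
  proof (rule Bochner_Integration.integrable_bound[OF integrable_exp_gauss_weight[OF \<open>0 < q\<close>, of "R + s" 0]])
    show "AE x in lborel. norm (exp (R * x) * \<bar>bessel_J 2 (s * x) * ?w x\<bar>) \<le> norm (exp ((R + s) * x) * ?w x)"
    proof (rule AE_I2)
      fix x :: real
      show "norm (exp (R * x) * \<bar>bessel_J 2 (s * x) * ?w x\<bar>) \<le> norm (exp ((R + s) * x) * ?w x)"
      proof (cases "x > 0")
        case True
        have "exp (R * x) * (\<bar>bessel_J 2 (s * x)\<bar> * ?w x) \<le> exp (R * x) * (exp (s * x) * ?w x)"
          using True that by (intro mult_left_mono mult_right_mono bessel2_bound gauss_weight_nonneg) auto
        then show ?thesis
          using gauss_weight_nonneg[of q 0 x] by (simp add: abs_mult distrib_right exp_add mult.assoc)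
      qed (simp add: w0)
    qed
  qed auto
  \<comment> \<open>One copy of the transform is moved onto the weight that contains the other copy;
    the inner integral then undergoes the same exchange, and Weber's second integral appears. The
    growth bound \<open>HB\<close> only justifies these exchanges.\<close>
  have F1: "integrable lborel (\<lambda>x. (LINT r|lborel. G r * bessel_J 2 (r * x)) * (H x * ?w x))"
    "(LINT x|lborel. (LINT r|lborel. G r * bessel_J 2 (r * x)) * (H x * ?w x)) =
      (LINT r|lborel. G r * (LINT x|lborel. bessel_J 2 (r * x) * (H x * ?w x)))"
    by (rule hankel_fubini[OF G]; use i1 w0 in simp)+
  have "(LINT r|lborel. G r * bessel_J 2 (r * x)) * (H x * ?w x) = (H x)\<^sup>2 * ?w x" for x
    by (simp add: H_def power2_eq_square mult.assoc)
  with F1(1) show "integrable lborel (\<lambda>x. (H x)\<^sup>2 * ?w x)"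
    by simp
  have "(LINT x|lborel. (H x)\<^sup>2 * ?w x) =
      (LINT x|lborel. (LINT r|lborel. G r * bessel_J 2 (r * x)) * (H x * ?w x))"
    by (simp add: H_def power2_eq_square mult.assoc)
  also have "\<dots> = (LINT r|lborel. G r * (LINT x|lborel. bessel_J 2 (r * x) * (H x * ?w x)))"
    by (rule F1(2))
  also have "\<dots> = (LINT r|lborel. G r * (LINT s|lborel. G s * weber_kernel q s r))"
  proof (intro Bochner_Integration.integral_cong refl)
    fix r
    show "G r * (LINT x|lborel. bessel_J 2 (r * x) * (H x * ?w x)) =
        G r * (LINT s|lborel. G s * weber_kernel q s r)"
    proof (cases "G r = 0")
      case False
      then have r: "0 < r" using G(2) by blast
      have "(LINT x|lborel. bessel_J 2 (r * x) * (H x * ?w x)) =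
          (LINT x|lborel. H x * (bessel_J 2 (r * x) * ?w x))"
        by (simp add: mult_ac)
      also have "\<dots> = (LINT s|lborel. G s * (LINT x|lborel. bessel_J 2 (s * x) * (bessel_J 2 (r * x) * ?w x)))"
        unfolding H_def by (rule hankel_fubini(2)[OF G]; use i2[OF r] w0 in simp)
      also have "\<dots> = (LINT s|lborel. G s * weber_kernel q s r)"
      proof (intro Bochner_Integration.integral_cong refl)
        fix s
        show "G s * (LINT x|lborel. bessel_J 2 (s * x) * (bessel_J 2 (r * x) * ?w x)) =
            G s * weber_kernel q s r"
          using weber_second_integral[OF \<open>0 < q\<close>, of s r] G(2)[of s] r by (cases "G s = 0") auto
      qed
      finally show ?thesis by simp
    qed simp
  qed
  also have "\<dots> \<le> C"
    by (rule weber_kernel_schur_bound) (use assms G(2) in auto)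
  finally show "(LINT x|lborel. (H x)\<^sup>2 * ?w x) \<le> C" .
qed

text \<open>Cutting |H| at height N: the bounded part tends to 0 by dominated convergence, and the
  excess is at most H^2 / N, whose integral is at most C / N for all n.\<close>

lemma L2_bounded_null_integral:
  fixes H :: "nat \<Rightarrow> real \<Rightarrow> real" and v :: "real \<Rightarrow> real"
  assumes [measurable]: "\<And>n. H n \<in> borel_measurable borel" and v: "integrable lborel v" "\<And>x. 0 \<le> v x"
    and lim: "\<And>x. v x \<noteq> 0 \<Longrightarrow> (\<lambda>n. H n x) \<longlonglongrightarrow> 0"
    and int: "\<And>n. integrable lborel (\<lambda>x. (H n x)\<^sup>2 * v x)"
    and bd: "\<And>n. (LINT x|lborel. (H n x)\<^sup>2 * v x) \<le> C"
  shows "(\<lambda>n. LINT x|lborel. H n x * v x) \<longlonglongrightarrow> 0"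
proof (rule LIMSEQ_I)
  fix \<epsilon> :: real assume \<epsilon>: "0 < \<epsilon>"
  have [measurable]: "v \<in> borel_measurable borel"
    using v(1) by (simp add: borel_measurable_integrable)
  have "0 \<le> (LINT x|lborel. (H 0 x)\<^sup>2 * v x)"
    using v(2) by (intro Bochner_Integration.integral_nonneg) auto
  then have C0: "0 \<le> C" using bd[of 0] by simp
  \<comment> \<open>The first summand brings C / N down to \<epsilon> / 2; the 1 makes this strict
    and keeps N positive when C = 0.\<close>
  define N where "N = 2 * C / \<epsilon> + 1"
  have N: "0 < N" "C / N < \<epsilon> / 2"
    using \<epsilon> C0 by (auto simp: N_def field_simps add_pos_nonneg add_nonneg_pos)
  let ?m = "\<lambda>n x. min \<bar>H n x\<bar> N * v x"
  have "(\<lambda>n. LINT x|lborel. ?m n x) \<longlonglongrightarrow> (LINT x|(lborel :: real measure). 0)"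
  proof (rule integral_dominated_convergence[where f="\<lambda>x. 0" and w="\<lambda>x. N * v x"])
    show "integrable lborel (\<lambda>x. N * v x)"
      using v by auto
    show "AE x in lborel. (\<lambda>n. ?m n x) \<longlonglongrightarrow> 0"
    proof (rule AE_I2)
      fix x
      show "(\<lambda>n. ?m n x) \<longlonglongrightarrow> 0"
      proof (cases "v x = 0")
        case False
        have "(\<lambda>n. min \<bar>H n x\<bar> N * v x) \<longlonglongrightarrow> min \<bar>0\<bar> N * v x"
          by (intro tendsto_intros lim False)
        then show ?thesis using N by simp
      qed simp
    qed
    show "AE x in lborel. norm (?m n x) \<le> N * v x" for n
      using v(2) N by (intro AE_I2) (auto simp: abs_mult intro!: mult_right_mono)
  qed auto
  then have "eventually (\<lambda>n. (LINT x|lborel. ?m n x) < \<epsilon> / 2) sequentially"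
    using \<epsilon> by (intro order_tendstoD(2)) auto
  then obtain n0 where n0: "\<And>n. n \<ge> n0 \<Longrightarrow> (LINT x|lborel. ?m n x) < \<epsilon> / 2"
    by (auto simp: eventually_sequentially)
  have "norm ((LINT x|lborel. H n x * v x) - 0) < \<epsilon>" if "n \<ge> n0" for n
  proof -
    have im: "integrable lborel (?m n)"
      by (rule Bochner_Integration.integrable_bound[where f="\<lambda>x. N * v x"])
        (use v N in \<open>auto simp: abs_mult intro!: mult_right_mono\<close>)
    have pt: "\<bar>H n x * v x\<bar> \<le> ?m n x + (H n x)\<^sup>2 * v x / N" for x
    proof -
      have "\<bar>h\<bar> \<le> min \<bar>h\<bar> N + h\<^sup>2 / N" for h :: real
      proof (cases "\<bar>h\<bar> \<le> N")
        case False
        then have "\<bar>h\<bar> * N \<le> h\<^sup>2"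
          using mult_left_mono[of N "\<bar>h\<bar>" "\<bar>h\<bar>"] by (simp add: power2_eq_square)
        then have "\<bar>h\<bar> \<le> h\<^sup>2 / N"
          using N by (simp add: field_simps)
        then show ?thesis using N False by simp
      qed (use N in simp)
      from mult_right_mono[OF this[of "H n x"] v(2)[of x]] show ?thesis
        using v(2)[of x] by (simp add: abs_mult distrib_right)
    qed
    have "\<bar>LINT x|lborel. H n x * v x\<bar> \<le> (LINT x|lborel. ?m n x + (H n x)\<^sup>2 * v x / N)"
    proof (cases "integrable lborel (\<lambda>x. H n x * v x)")
      case True
      have "\<bar>LINT x|lborel. H n x * v x\<bar> \<le> (LINT x|lborel. \<bar>H n x * v x\<bar>)"
        by (rule integral_abs_bound)
      also have "\<dots> \<le> (LINT x|lborel. ?m n x + (H n x)\<^sup>2 * v x / N)"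
        using True im int[of n] pt by (intro integral_mono) auto
      finally show ?thesis .
    next
      case False
      then show ?thesis
        using pt by (subst not_integrable_integral_eq) (auto intro!: Bochner_Integration.integral_nonneg intro: order_trans[OF abs_ge_zero])
    qed
    also have "\<dots> = (LINT x|lborel. ?m n x) + (LINT x|lborel. (H n x)\<^sup>2 * v x) / N"
      using im int[of n] by simp
    also have "\<dots> < \<epsilon> / 2 + \<epsilon> / 2"
    proof (rule add_strict_mono[OF n0[OF that]])
      have "(LINT x|lborel. (H n x)\<^sup>2 * v x) / N \<le> C / N"
        using N bd by (intro divide_right_mono) auto
      then show "(LINT x|lborel. (H n x)\<^sup>2 * v x) / N < \<epsilon> / 2"
        using N(2) by linarith
    qed
    finally show ?thesis by simp
  qed
  then show "\<exists>no. \<forall>n\<ge>no. norm ((LINT x|lborel. H n x * v x) - 0) < \<epsilon>"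
    by blast
qed

text \<open>The zero transform gives only pointwise convergence of the truncated transforms, without
  a rate or a pointwise majorant in xi. The uniform L^2 bound takes the place of the majorant when
  they are integrated against the test weight.\<close>

lemma hankel_zero_imp_gauss_zero:
  fixes g :: "real \<Rightarrow> real"
  assumes cont: "continuous_on {0<..} g"
    and L2: "integrable lborel (\<lambda>r. indicator {0<..} r * ((g r)\<^sup>2 * r))"
    and hankel: "\<And>\<xi>. 0 < \<xi> \<Longrightarrow> ((\<lambda>r. g r * bessel_J 2 (r * \<xi>) * r) has_integral 0) {0<..}"
    and s: "0 < s"
  shows "integrable lborel (\<lambda>r. indicator {0<..} r * (g r * r ^ 3 * exp (- (r\<^sup>2 / (4 * s)))))" (is ?int)
    and "(LINT r|lborel. indicator {0<..} r * (g r * r ^ 3 * exp (- (r\<^sup>2 / (4 * s))))) = 0" (is ?zero)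
proof -
  define P where "P r = indicator {0<..} r * ((g r)\<^sup>2 * r)" for r
  define g0 where "g0 r = indicator {0<..} r * g r" for r
  have [measurable]: "g0 \<in> borel_measurable borel"
    unfolding g0_def using borel_measurable_continuous_on_indicator[OF _ cont] by simp
  have intP: "integrable lborel P"
    using L2 by (simp add: P_def[abs_def])
  have P0: "0 \<le> P r" for r by (auto simp: P_def indicator_def)
  define G where "G n r = indicator {0<..real n} r * (g0 r * r)" for n r
  have [measurable]: "G n \<in> borel_measurable borel" for n
    unfolding G_def by measurable
  have supp: "0 < r \<and> r \<le> real n" if "G n r \<noteq> 0" for n r
    using that by (auto simp: G_def indicator_def split: if_splits)
  have intG: "integrable lborel (G n)" for n
  proof (rule Bochner_Integration.integrable_bound)
    show "integrable lborel (\<lambda>r. 1/2 * (P r + indicator {0..real n} r * real n))"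
      using intP by auto
    show "AE r in lborel. norm (G n r) \<le> norm (1/2 * (P r + indicator {0..real n} r * real n))"
    proof (rule AE_I2)
      fix r :: real
      show "norm (G n r) \<le> norm (1/2 * (P r + indicator {0..real n} r * real n))"
      proof (cases "0 < r \<and> r \<le> real n")
        case True
        have "0 \<le> (\<bar>g r\<bar> - 1)\<^sup>2 * r"
          using True by simp
        then have "2 * (\<bar>g r\<bar> * r) \<le> (g r)\<^sup>2 * r + r"
          by (simp add: power2_eq_square algebra_simps)
        then show ?thesis
          using True by (simp add: G_def g0_def P_def abs_mult)
      qed (auto simp: G_def)
    qed
  qed auto
  define C where "C = (LINT r|lborel. P r)"
  have C0: "0 \<le> C"
    unfolding C_def using P0 by simp
  have GC: "(\<integral>\<^sup>+r. ennreal ((G n r)\<^sup>2 / r) \<partial>lborel) \<le> ennreal C" for n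
  proof -
    have "(G n r)\<^sup>2 / r \<le> P r" for r
      by (auto simp: G_def g0_def P_def indicator_def power2_eq_square)
    then have "(\<integral>\<^sup>+r. ennreal ((G n r)\<^sup>2 / r) \<partial>lborel) \<le> (\<integral>\<^sup>+r. ennreal (P r) \<partial>lborel)"
      by (intro nn_integral_mono ennreal_leI)
    also have "\<dots> = ennreal C"
      unfolding C_def using intP P0 by (intro nn_integral_eq_integral) auto
    finally show ?thesis .
  qed
  define H where "H n x = (LINT r|lborel. G n r * bessel_J 2 (r * x))" for n x
  have [measurable]: "H n \<in> borel_measurable borel" for n
    unfolding H_def by measurable
  have H_lim: "(\<lambda>n. H n x) \<longlonglongrightarrow> 0" if x: "0 < x" for x
  proof (rule LIMSEQ_I)
    let ?f = "\<lambda>r. g r * bessel_J 2 (r * x) * r"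
    have intGJ: "integrable lborel (\<lambda>r. G n r * bessel_J 2 (r * x))" for n
    proof (rule Bochner_Integration.integrable_bound)
      show "integrable lborel (\<lambda>r. G n r * exp (real n * x))"
        using intG by auto
      show "AE r in lborel. norm (G n r * bessel_J 2 (r * x)) \<le> norm (G n r * exp (real n * x))"
      proof (rule AE_I2)
        fix r
        show "norm (G n r * bessel_J 2 (r * x)) \<le> norm (G n r * exp (real n * x))"
        proof (cases "G n r = 0")
          case False
          then have r: "0 < r" "r \<le> real n" using supp by auto
          have "\<bar>bessel_J 2 (r * x)\<bar> \<le> exp (r * x)"
            using r x by (intro bessel2_bound) auto
          also have "\<dots> \<le> exp (real n * x)"
            using r x by simp
          finally show ?thesis
            by (simp add: abs_mult mult_left_mono)
        qed auto
      qed
    qed auto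
    \<comment> \<open>The improper integral is a limit over growing boxes. On [-n, n] it is the
      Lebesgue integral \<open>H n x\<close>, so a zero transform means that these tend to
      0.\<close>
    have Hn: "((\<lambda>r. if r \<in> {0<..} then ?f r else 0) has_integral H n x) (cbox (- real n) (real n))" for n
    proof -
      have "((\<lambda>r. G n r * bessel_J 2 (r * x)) has_integral H n x) UNIV"
        unfolding H_def by (rule has_integral_integral_lborel[OF intGJ])
      moreover have "(\<lambda>r. G n r * bessel_J 2 (r * x)) =
          (\<lambda>r. if r \<in> cbox (- real n) (real n) then (if r \<in> {0<..} then ?f r else 0) else 0)"
        by (auto simp: G_def g0_def indicator_def)
      ultimately show ?thesis
        by (simp only: has_integral_restrict_UNIV)
    qed
    fix \<epsilon> :: real assume "0 < \<epsilon>"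
    then obtain B where B: "\<And>a b. ball 0 B \<subseteq> cbox a b \<Longrightarrow>
        norm (integral (cbox a b) (\<lambda>r. if r \<in> {0<..} then ?f r else 0) - 0) < \<epsilon>"
      using hankel[OF x] unfolding has_integral_alt'[of ?f] by blast
    have "norm (H n x - 0) < \<epsilon>" if "n \<ge> nat \<lceil>B\<rceil>" for n
    proof -
      have "ball 0 B \<subseteq> cbox (- real n) (real n)"
        using that by (auto simp: dist_real_def)
      from B[OF this] show ?thesis
        using integral_unique[OF Hn[of n]] by simp
    qed
    then show "\<exists>no. \<forall>n\<ge>no. norm (H n x - 0) < \<epsilon>"
      by blast
  qed
  \<comment> \<open>Weber's first integral needs the power xi^3, whereas the L^2 bound is for xi.
    Half of the Gaussian pays for the factor xi^2, by z \<le> exp z with z = s xi^2 / 2.\<close>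
  let ?v = "gauss_weight s 1"
  let ?w = "gauss_weight (s / 2) 0"
  have vw: "?v x \<le> 2 / s * ?w x" for x
  proof (cases "x > 0")
    case True
    define z where "z = s / 2 * x\<^sup>2"
    have "z \<le> exp z"
      using exp_ge_add_one_self[of z] by linarith
    then have "2 / s * x * exp (- (2 * z)) * z \<le> 2 / s * x * exp (- (2 * z)) * exp z"
      using s True by (intro mult_left_mono) auto
    also have "\<dots> = 2 / s * x * exp (- z)"
      by (simp add: mult.assoc exp_add[symmetric])
    also have "2 / s * x * exp (- (2 * z)) * z = x ^ 3 * exp (- s * x\<^sup>2)"
      using s by (simp add: z_def power3_eq_cube power2_eq_square)
    finally show ?thesis
      using True by (simp add: gauss_weight_def z_def power3_eq_cube numeral_3_eq_3)
  qed (simp add: gauss_weight_def)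
  have iHw: "integrable lborel (\<lambda>x. (H n x)\<^sup>2 * ?w x)" and bHw: "(LINT x|lborel. (H n x)\<^sup>2 * ?w x) \<le> C" for n
    using hankel_L2_bound[OF intG[of n] supp[of n] _ GC[of n] C0, of "s / 2"] s
    by (simp_all add: H_def)
  have Hv_le: "(H n x)\<^sup>2 * ?v x \<le> 2 / s * ((H n x)\<^sup>2 * ?w x)" for n x
    using mult_left_mono[OF vw[of x], of "(H n x)\<^sup>2"] by (simp add: mult_ac)
  have iHv: "integrable lborel (\<lambda>x. (H n x)\<^sup>2 * ?v x)" for n
  proof (rule Bochner_Integration.integrable_bound)
    show "integrable lborel (\<lambda>x. 2 / s * ((H n x)\<^sup>2 * ?w x))"
      using iHw by auto
    show "AE x in lborel. norm ((H n x)\<^sup>2 * ?v x) \<le> norm (2 / s * ((H n x)\<^sup>2 * ?w x))"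
    proof (rule AE_I2)
      fix x
      have "0 \<le> (H n x)\<^sup>2 * ?v x"
        by (simp add: gauss_weight_nonneg)
      then show "norm ((H n x)\<^sup>2 * ?v x) \<le> norm (2 / s * ((H n x)\<^sup>2 * ?w x))"
        unfolding real_norm_def using Hv_le[of n x] by arith
    qed
  qed auto
  have "(LINT x|lborel. (H n x)\<^sup>2 * ?v x) \<le> 2 / s * C" for n
  proof -
    have "(LINT x|lborel. (H n x)\<^sup>2 * ?v x) \<le> (LINT x|lborel. 2 / s * ((H n x)\<^sup>2 * ?w x))"
      using iHv iHw Hv_le by (intro integral_mono) auto
    also have "\<dots> \<le> 2 / s * C"
      using bHw[of n] s by (simp add: divide_right_mono)
    finally show ?thesis .
  qed
  note bHv = this
  have lim0: "(\<lambda>n. LINT x|lborel. H n x * ?v x) \<longlonglongrightarrow> 0"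
  proof (rule L2_bounded_null_integral[OF _ integrable_gauss_weight[OF s] gauss_weight_nonneg _ iHv bHv])
    show "(\<lambda>n. H n x) \<longlonglongrightarrow> 0" if "?v x \<noteq> 0" for x
      using that by (intro H_lim) (auto simp: gauss_weight_def indicator_def split: if_splits)
  qed simp
  \<comment> \<open>The constant in Weber's first integral: (r / 2)^2 / (2 s^3) = r^2 / (8
    s^3).\<close>
  define \<kappa> where "\<kappa> = 1 / (8 * s ^ 3)"
  define E where "E r = exp (- (r\<^sup>2 / (4 * s)))" for r
  have [measurable]: "E \<in> borel_measurable borel"
    unfolding E_def by measurable
  have Hv: "(LINT x|lborel. H n x * ?v x) = (LINT r|lborel. \<kappa> * (G n r * (r\<^sup>2 * E r)))" for n
  proof -
    have "(LINT x|lborel. H n x * ?v x) = (LINT r|lborel. G n r * (LINT x|lborel. bessel_J 2 (r * x) * ?v x))"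
      unfolding H_def
    proof (rule hankel_fubini(2)[OF intG supp])
      show "integrable lborel (\<lambda>x. exp (real n * x) * \<bar>?v x\<bar>)"
        using integrable_exp_gauss_weight[OF s, of "real n" 1] by (simp add: gauss_weight_nonneg)
    qed (simp_all add: gauss_weight_def)
    also have "\<dots> = (LINT r|lborel. \<kappa> * (G n r * (r\<^sup>2 * E r)))"
    proof (intro Bochner_Integration.integral_cong refl)
      fix r
      show "G n r * (LINT x|lborel. bessel_J 2 (r * x) * ?v x) = \<kappa> * (G n r * (r\<^sup>2 * E r))"
      proof (cases "G n r = 0")
        case False
        then have "0 \<le> r" using supp by force
        from weber_first_integral[OF s this] show ?thesis
          by (simp add: \<kappa>_def E_def power_divide)
      qed simp
    qed
    finally show ?thesis .
  qed
  have bound: "integrable lborel (\<lambda>r. P r + gauss_weight (1 / (2 * s)) 2 r)"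
    using intP s by (intro Bochner_Integration.integrable_add integrable_gauss_weight) auto
  \<comment> \<open>With h = r^2 \<open>E r\<close>, the product |g| h r is at most g^2 r + h^2 r;
    the first term is integrable by assumption, and the second is a Gaussian weight.\<close>
  have dom: "\<bar>indicator {0<..} r * (g r * r ^ 3 * E r)\<bar> \<le> P r + gauss_weight (1 / (2 * s)) 2 r" for r
  proof (cases "r > 0")
    case True
    define h where "h = r\<^sup>2 * E r"
    have h: "0 \<le> h" by (simp add: h_def E_def)
    have EE: "E r * E r = exp (- (1 / (2 * s)) * r\<^sup>2)"
      using s by (simp add: E_def exp_add[symmetric])
    have "0 \<le> (\<bar>g r\<bar> - h)\<^sup>2 * r"
      using True by simp
    then have "2 * (\<bar>g r\<bar> * h * r) \<le> (g r)\<^sup>2 * r + h\<^sup>2 * r"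
      by (simp add: power2_eq_square algebra_simps)
    moreover have "0 \<le> \<bar>g r\<bar> * h * r"
      using h True by simp
    ultimately have "\<bar>g r\<bar> * h * r \<le> (g r)\<^sup>2 * r + h\<^sup>2 * r"
      by linarith
    moreover have "h\<^sup>2 * r = r ^ 5 * exp (- (1 / (2 * s)) * r\<^sup>2)"
      unfolding EE[symmetric] by (simp add: h_def power2_eq_square eval_nat_numeral)
    moreover have "\<bar>g r * r ^ 3 * E r\<bar> = \<bar>g r\<bar> * h * r"
      using True by (simp add: h_def abs_mult E_def power3_eq_cube power2_eq_square)
    ultimately show ?thesis
      using True by (simp add: P_def gauss_weight_def)
  qed (use P0 gauss_weight_nonneg in auto)
  have Gr: "G n r * (r\<^sup>2 * E r) = indicator {0<..real n} r * (indicator {0<..} r * (g r * r ^ 3 * E r))" for n r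
    by (simp add: G_def g0_def power3_eq_cube power2_eq_square)
  have F_eq: "indicator {0<..} r * (g r * r ^ 3 * E r) = g0 r * r ^ 3 * E r" for r
    by (simp add: g0_def)
  have F_meas [measurable]: "(\<lambda>r. indicator {0<..} r * (g r * r ^ 3 * E r)) \<in> borel_measurable borel"
    unfolding F_eq by measurable
  have int: "integrable lborel (\<lambda>r. indicator {0<..} r * (g r * r ^ 3 * E r))"
    by (rule Bochner_Integration.integrable_bound[OF bound]) (use dom in \<open>auto intro: order_trans[OF _ abs_ge_self]\<close>)
  then show ?int
    by (simp add: E_def)
  have "(\<lambda>n. LINT r|lborel. G n r * (r\<^sup>2 * E r)) \<longlonglongrightarrow>
      (LINT r|lborel. indicator {0<..} r * (g r * r ^ 3 * E r))"
    unfolding Gr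
  proof (rule integral_dominated_convergence[OF _ _ bound])
    show "AE r in lborel. (\<lambda>n. indicator {0<..real n} r * (indicator {0<..} r * (g r * r ^ 3 * E r))) \<longlonglongrightarrow>
        indicator {0<..} r * (g r * r ^ 3 * E r)"
    proof (rule AE_I2)
      fix r :: real
      show "(\<lambda>n. indicator {0<..real n} r * (indicator {0<..} r * (g r * r ^ 3 * E r))) \<longlonglongrightarrow>
          indicator {0<..} r * (g r * r ^ 3 * E r)"
      proof (rule tendsto_eventually, rule eventually_sequentiallyI)
        fix n assume "nat \<lceil>r\<rceil> \<le> n"
        then have "r \<le> real n" by linarith
        then show "indicator {0<..real n} r * (indicator {0<..} r * (g r * r ^ 3 * E r)) =
            indicator {0<..} r * (g r * r ^ 3 * E r)"
          by (simp add: indicator_def)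
      qed
    qed
    show "AE r in lborel. norm (indicator {0<..real n} r * (indicator {0<..} r * (g r * r ^ 3 * E r))) \<le>
        P r + gauss_weight (1 / (2 * s)) 2 r" for n
    proof (rule AE_I2)
      fix r :: real
      show "norm (indicator {0<..real n} r * (indicator {0<..} r * (g r * r ^ 3 * E r))) \<le>
        P r + gauss_weight (1 / (2 * s)) 2 r"
        using dom[of r] by (auto simp: indicator_def split: if_splits)
    qed
  qed measurable
  then have "(\<lambda>n. LINT x|lborel. H n x * ?v x) \<longlonglongrightarrow>
      \<kappa> * (LINT r|lborel. indicator {0<..} r * (g r * r ^ 3 * E r))"
    unfolding Hv integral_mult_right_zero by (rule tendsto_mult_left)
  then have "\<kappa> * (LINT r|lborel. indicator {0<..} r * (g r * r ^ 3 * E r)) = 0"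
    using lim0 LIMSEQ_unique by blast
  then show ?zero
    using s by (simp add: \<kappa>_def E_def)
qed

section \<open>From vanishing Gaussian moments to a vanishing function\<close>

lemma AE_lborel_eq_0_continuous:
  fixes f :: "real \<Rightarrow> real"
  assumes "AE x in lborel. f x = 0" "open S" "continuous_on S f" "x0 \<in> S"
  shows "f x0 = 0"
proof (rule ccontr)
  assume nz: "f x0 \<noteq> 0"
  have "isCont f x0"
    using assms(2-4) by (simp add: continuous_on_eq_continuous_at)
  then obtain d where d: "d > 0" "\<And>x. \<bar>x - x0\<bar> < d \<Longrightarrow> f x \<noteq> 0"
    using nz continuous_at_avoid[of x0 f 0] by (auto simp: dist_real_def abs_minus_commute)
  obtain N where N: "{x \<in> space lborel. f x \<noteq> 0} \<subseteq> N" "emeasure lborel N = 0" "N \<in> sets lborel"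
    using assms(1) by (auto elim: AE_E)
  have "{x0 - d<..<x0 + d} \<subseteq> N"
    using N(1) d(2) by (force simp: abs_less_iff)
  then have "emeasure lborel {x0 - d<..<x0 + d} \<le> emeasure lborel N"
    using N(3) by (rule emeasure_mono)
  then show False
    using N(2) d(1) by simp
qed

text \<open>For s = 1 / (4 (n + 1)) the Gaussian is a power of y = exp(-r^2). The density
  \<open>k\<close> therefore annihilates all polynomials in y and, by Weierstrass on [0, 1], all
  continuous functions of y. As y is strictly decreasing in r, a tent in y localizes near r0, where
  g keeps its sign.\<close>

lemma gauss_transform_injective:
  fixes g :: "real \<Rightarrow> real"
  assumes cont: "continuous_on {0<..} g"
    and int: "\<And>s. 0 < s \<Longrightarrow>
      integrable lborel (\<lambda>r. indicator {0<..} r * (g r * r ^ 3 * exp (- (r\<^sup>2 / (4 * s)))))"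
    and zero: "\<And>s. 0 < s \<Longrightarrow>
      (LINT r|lborel. indicator {0<..} r * (g r * r ^ 3 * exp (- (r\<^sup>2 / (4 * s))))) = 0"
    and "0 < r0"
  shows "g r0 = 0"
proof (rule ccontr)
  assume nz: "g r0 \<noteq> 0"
  define y where "y r = exp (- r\<^sup>2)" for r :: real
  define k where "k r = indicator {0<..} r * (g r * r ^ 3 * y r)" for r
  have [measurable]: "y \<in> borel_measurable borel"
    unfolding y_def by measurable
  have y01: "y r \<in> {0..1}" for r by (simp add: y_def)
  \<comment> \<open>One factor y is kept inside \<open>k\<close>; this makes \<open>k\<close>
    integrable and turns the powers n + 1 \<ge> 1 of y into all powers n \<ge> 0.\<close>
  have ky: "k r * y r ^ n = indicator {0<..} r * (g r * r ^ 3 * exp (- (r\<^sup>2 / (4 * (1 / (4 * (real n + 1)))))))"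
    for n r
  proof -
    have "y r * y r ^ n = exp (- (r\<^sup>2 / (4 * (1 / (4 * (real n + 1))))))"
      unfolding y_def by (simp add: exp_of_nat_mult[symmetric] exp_add[symmetric] algebra_simps)
    then show ?thesis
      by (simp add: k_def mult.assoc)
  qed
  have intky: "integrable lborel (\<lambda>r. k r * y r ^ n)" and zeroky: "(LINT r|lborel. k r * y r ^ n) = 0" for n
    using int[of "1 / (4 * (real n + 1))"] zero[of "1 / (4 * (real n + 1))"]
    by (simp_all only: ky zero_less_divide_iff) (simp_all add: add_nonneg_pos)
  have intk: "integrable lborel k"
    using intky[of 0] by simp
  have [measurable]: "k \<in> borel_measurable borel"
    using intk by (simp add: borel_measurable_integrable)
  have cont_zero: "integrable lborel (\<lambda>r. k r * \<Psi> (y r)) \<and> (LINT r|lborel. k r * \<Psi> (y r)) = 0"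
    if \<Psi>: "continuous_on {0..1} \<Psi>" and [measurable]: "\<Psi> \<in> borel_measurable borel" for \<Psi> :: "real \<Rightarrow> real"
  proof -
    obtain B where B: "\<And>x. x \<in> {0..1} \<Longrightarrow> \<bar>\<Psi> x\<bar> \<le> B"
      using compact_continuous_image[OF \<Psi>] by (force dest: compact_imp_bounded simp: bounded_iff)
    have int\<Psi>: "integrable lborel (\<lambda>r. k r * \<Psi> (y r))"
    proof (rule Bochner_Integration.integrable_bound)
      show "integrable lborel (\<lambda>r. k r * B)"
        using intk by auto
      show "AE r in lborel. norm (k r * \<Psi> (y r)) \<le> norm (k r * B)"
        using B[OF y01] by (intro AE_I2) (auto simp: abs_mult intro!: mult_left_mono intro: order_trans[OF _ abs_ge_self])
    qed measurable
    have "\<bar>LINT r|lborel. k r * \<Psi> (y r)\<bar> \<le> e * (LINT r|lborel. \<bar>k r\<bar>)" if "e > 0" for e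
    proof -
      obtain p where p: "real_polynomial_function p" "\<And>x. x \<in> {0..1} \<Longrightarrow> \<bar>\<Psi> x - p x\<bar> < e"
        using Stone_Weierstrass_real_polynomial_function[OF compact_Icc \<Psi> \<open>e > 0\<close>] by blast
      obtain a n where p_eq: "p = (\<lambda>x. \<Sum>i\<le>n. a i * x ^ i)"
        using p(1) by (auto simp: real_polynomial_function_iff_sum)
      have kp: "k r * p (y r) = (\<Sum>i\<le>n. a i * (k r * y r ^ i))" for r
        by (simp add: p_eq sum_distrib_left mult_ac)
      have intp: "integrable lborel (\<lambda>r. k r * p (y r))"
        unfolding kp using intky by auto
      have "(LINT r|lborel. k r * p (y r)) = 0"
        unfolding kp using intky zeroky by (subst Bochner_Integration.integral_sum) auto
      then have "(LINT r|lborel. k r * \<Psi> (y r)) = (LINT r|lborel. k r * \<Psi> (y r) - k r * p (y r))"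
        using int\<Psi> intp by simp
      also have "\<bar>\<dots>\<bar> \<le> (LINT r|lborel. e * \<bar>k r\<bar>)"
      proof (rule integral_abs_bound_integral)
        show "\<bar>k r * \<Psi> (y r) - k r * p (y r)\<bar> \<le> e * \<bar>k r\<bar>" for r
        proof -
          have "\<bar>k r * \<Psi> (y r) - k r * p (y r)\<bar> = \<bar>k r\<bar> * \<bar>\<Psi> (y r) - p (y r)\<bar>"
            by (simp add: abs_mult[symmetric] right_diff_distrib)
          also have "\<dots> \<le> \<bar>k r\<bar> * e"
            using p(2)[OF y01[of r]] by (intro mult_left_mono) auto
          finally show ?thesis
            by (simp add: mult.commute)
        qed
      qed (use int\<Psi> intp intk in auto)
      finally show ?thesis
        by simp
    qed
    note small = this
    define K where "K = (LINT r|lborel. \<bar>k r\<bar>)"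
    have K0: "0 \<le> K" by (simp add: K_def)
    have "(LINT r|lborel. k r * \<Psi> (y r)) = 0"
    proof (rule ccontr)
      assume "(LINT r|lborel. k r * \<Psi> (y r)) \<noteq> 0"
      then have pos: "0 < \<bar>LINT r|lborel. k r * \<Psi> (y r)\<bar>" (is "0 < ?L") by simp
      \<comment> \<open>The approximation error is chosen relative to the integral itself; the
        summand 1 covers K = 0.\<close>
      have "?L \<le> ?L / (2 * (K + 1)) * K"
      proof -
        have "0 < ?L / (2 * (K + 1))"
          using pos K0 by (intro divide_pos_pos) auto
        from small[OF this] show ?thesis
          by (simp only: K_def)
      qed
      also have "\<dots> = ?L * (K / (2 * (K + 1)))"
        by simp
      also have "\<dots> < ?L * 1"
        using pos K0 by (intro mult_strict_left_mono) auto
      finally show False by simp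
    qed
    then show ?thesis
      using int\<Psi> by simp
  qed
  define \<sigma> where "\<sigma> = sgn (g r0)"
  have \<sigma>: "\<sigma> * g r0 > 0"
    using nz by (simp add: \<sigma>_def sgn_if)
  have "isCont (\<lambda>r. \<sigma> * g r) r0"
    using cont \<open>0 < r0\<close> by (intro continuous_intros) (auto simp: continuous_on_eq_continuous_at)
  then have "((\<lambda>r. \<sigma> * g r) \<longlongrightarrow> \<sigma> * g r0) (nhds r0)"
    unfolding isCont_def by (subst tendsto_at_iff_tendsto_nhds[symmetric])
  then have "eventually (\<lambda>r. 0 < \<sigma> * g r) (nhds r0)"
    using \<sigma> by (rule order_tendstoD(1))
  then obtain d0 where d0: "d0 > 0" "\<And>r. dist r r0 < d0 \<Longrightarrow> 0 < \<sigma> * g r"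
    unfolding eventually_nhds_metric by blast
  define d where "d = min d0 (r0 / 2)"
  have d: "0 < d" "d < r0" "\<And>r. \<bar>r - r0\<bar> < d \<Longrightarrow> 0 < \<sigma> * g r"
    using d0 \<open>0 < r0\<close> by (auto simp: d_def dist_real_def)
  have y_anti: "y b \<le> y a" if "0 \<le> a" "a \<le> b" for a b
    using power_mono[OF that(2,1), of 2] by (simp add: y_def)
  have y_less: "y b < y a" if "0 \<le> a" "a < b" for a b
    using power_strict_mono[OF that(2,1), of 2] by (simp add: y_def)
  \<comment> \<open>Outside (r0 - d, r0 + d) the values of y differ from y r0 by at least
    \<open>\<eta>\<close>. A tent of this half-width therefore vanishes wherever the sign of g is
    unknown.\<close>
  define \<eta> where "\<eta> = min (y (r0 - d) - y r0) (y r0 - y (r0 + d))"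
  have \<eta>: "0 < \<eta>"
    using y_less[of "r0 - d" r0] y_less[of r0 "r0 + d"] d(1,2) by (simp add: \<eta>_def)
  define \<Psi> where "\<Psi> z = max 0 (\<eta> - \<bar>z - y r0\<bar>)" for z
  have \<Psi>_cont: "continuous_on A \<Psi>" for A
    unfolding \<Psi>_def by (intro continuous_intros)
  have [measurable]: "\<Psi> \<in> borel_measurable borel"
    using \<Psi>_cont by (rule borel_measurable_continuous_onI)
  define F where "F r = \<sigma> * (k r * \<Psi> (y r))" for r
  have F0: "0 \<le> F r" for r
  proof (cases "r > 0")
    case True
    show ?thesis
    proof (cases "\<bar>r - r0\<bar> < d")
      case near: True
      have "F r = \<sigma> * g r * (r ^ 3 * y r * \<Psi> (y r))"
        using True by (simp add: F_def k_def mult_ac)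
      moreover have "0 \<le> \<sigma> * g r * (r ^ 3 * y r * \<Psi> (y r))"
        by (rule mult_nonneg_nonneg[OF less_imp_le[OF d(3)[OF near]]])
          (use True y01[of r] in \<open>simp add: \<Psi>_def\<close>)
      ultimately show ?thesis by simp
    next
      case False
      then have "r \<le> r0 - d \<or> r0 + d \<le> r" by linarith
      then have "\<eta> \<le> \<bar>y r - y r0\<bar>"
        using y_anti[of r "r0 - d"] y_anti[of "r0 + d" r] True d(1) \<open>0 < r0\<close> by (auto simp: \<eta>_def)
      then show ?thesis
        by (simp add: F_def \<Psi>_def)
    qed
  qed (simp add: F_def k_def)
  have "integrable lborel F" "(LINT r|lborel. F r) = 0"
    using cont_zero[OF \<Psi>_cont] unfolding F_def by simp_all
  then have AE0: "AE r in lborel. F r = 0"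
    using integral_nonneg_eq_0_iff_AE[of lborel F] F0 by simp
  have "F r0 = 0"
  proof (rule AE_lborel_eq_0_continuous[OF AE0])
    have "continuous_on {0<..} (\<lambda>r. \<sigma> * (g r * r ^ 3 * y r * \<Psi> (y r)))"
      unfolding y_def by (intro continuous_intros cont continuous_on_compose2[OF \<Psi>_cont[of UNIV]]) auto
    then show "continuous_on {0<..} F"
      by (rule continuous_on_eq) (simp add: F_def k_def)
  qed (use \<open>0 < r0\<close> in auto)
  moreover have "F r0 = \<sigma> * g r0 * (r0 ^ 3 * y r0 * \<eta>)"
    using \<open>0 < r0\<close> \<eta> by (simp add: F_def k_def \<Psi>_def)
  moreover have "0 < \<sigma> * g r0 * (r0 ^ 3 * y r0 * \<eta>)"
    by (rule mult_pos_pos[OF \<sigma>]) (use \<open>0 < r0\<close> \<eta> in \<open>simp add: y_def\<close>)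
  ultimately show False
    by linarith
qed

section \<open>The one-parameter family\<close>

lemma has_partials_on_diff:
  assumes "has_partials_on D v vt vr" "has_partials_on D w wt wr"
  shows "has_partials_on D (\<lambda>t r. v t r - w t r) (\<lambda>t r. vt t r - wt t r) (\<lambda>t r. vr t r - wr t r)"
  unfolding has_partials_on_def
proof (intro conjI)
  show "\<forall>(t, r)\<in>D. ((\<lambda>z. v (fst z) (snd z) - w (fst z) (snd z)) has_derivative
      (\<lambda>h. (vt t r - wt t r) * fst h + (vr t r - wr t r) * snd h)) (at (t, r) within D)"
  proof safe
    fix t r assume "(t, r) \<in> D"
    then have "((\<lambda>z. v (fst z) (snd z)) has_derivative (\<lambda>h. vt t r * fst h + vr t r * snd h)) (at (t, r) within D)"
      "((\<lambda>z. w (fst z) (snd z)) has_derivative (\<lambda>h. wt t r * fst h + wr t r * snd h)) (at (t, r) within D)"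
      using assms by (auto simp: has_partials_on_def)
    from has_derivative_diff[OF this]
    show "((\<lambda>z. v (fst z) (snd z) - w (fst z) (snd z)) has_derivative
      (\<lambda>h. (vt t r - wt t r) * fst h + (vr t r - wr t r) * snd h)) (at (t, r) within D)"
      by (simp add: algebra_simps)
  qed
qed (use assms in \<open>auto simp: has_partials_on_def intro: continuous_on_diff\<close>)

lemma continuous_on_has_partials_slice:
  fixes g :: "real \<Rightarrow> real \<Rightarrow> real"
  assumes "continuous_on ({0..} \<times> {0<..}) (\<lambda>z. g (fst z) (snd z))" "0 \<le> t"
  shows "continuous_on {0<..} (g t)"
  by (rule continuous_on_compose2[OF assms(1), where f="\<lambda>r. (t, r)", simplified])
    (use assms in \<open>auto intro!: continuous_intros\<close>)

text \<open>The energy density is pointwise at least half of the integrand, whence the factor 2; the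
  velocity term is discarded. What remains is the quantity in the uniqueness theorem for the wave
  equation.\<close>

lemma E_lin_local_bound:
  assumes "continuous_on {0<..} a" "continuous_on {0<..} c" "E_lin a b c \<le> ennreal K" "0 \<le> K" "0 < \<alpha>"
  shows "integral {\<alpha>..\<beta>} (\<lambda>r. r * (c r)\<^sup>2 + (a r)\<^sup>2 / r) \<le> 2 * K"
proof -
  define q where "q r = 1/2 * (r * (c r)\<^sup>2 + (a r)\<^sup>2 / r)" for r
  have "continuous_on {\<alpha>..\<beta>} q"
    unfolding q_def using assms
    by (intro continuous_intros continuous_on_subset[OF assms(1)] continuous_on_subset[OF assms(2)]) auto
  then have int: "set_integrable lborel {\<alpha>..\<beta>} q"
    by (rule borel_integrable_atLeastAtMost')
  have q0: "0 \<le> q r" if "r \<in> {\<alpha>..\<beta>}" for r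
    using that assms(5) by (simp add: q_def)
  have "ennreal (integral {\<alpha>..\<beta>} q) = ennreal (LINT r:{\<alpha>..\<beta>}|lborel. q r)"
    using set_borel_integral_eq_integral(2)[OF int] by simp
  also have "\<dots> = (\<integral>\<^sup>+r. ennreal (indicator {\<alpha>..\<beta>} r *\<^sub>R q r) \<partial>lborel)"
    unfolding set_lebesgue_integral_def
  proof (rule nn_integral_eq_integral[symmetric])
    show "integrable lborel (\<lambda>x. indicator {\<alpha>..\<beta>} x *\<^sub>R q x)"
      using int by (simp add: set_integrable_def)
    show "AE x in lborel. 0 \<le> indicator {\<alpha>..\<beta>} x *\<^sub>R q x"
      using q0 by (intro AE_I2) (auto simp: indicator_def)
  qed
  also have "\<dots> \<le> E_lin a b c"
    unfolding E_lin_def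
  proof (rule nn_integral_mono)
    fix r
    show "ennreal (indicator {\<alpha>..\<beta>} r *\<^sub>R q r) \<le>
        ennreal (1/2 * ((b r)\<^sup>2 + (c r)\<^sup>2 + 4 * (a r)\<^sup>2 / r\<^sup>2) * r) * indicator {0<..} r"
    proof (cases "r \<in> {\<alpha>..\<beta>}")
      case True
      then have r: "0 < r" using assms(5) by simp
      have "(1/2 * ((b r)\<^sup>2 + (c r)\<^sup>2 + 4 * (a r)\<^sup>2 / r\<^sup>2) * r) =
          1/2 * (r * (b r)\<^sup>2) + 1/2 * (r * (c r)\<^sup>2) + 2 * ((a r)\<^sup>2 / r)"
        using r by (simp add: field_simps power2_eq_square)
      moreover have "0 \<le> r * (b r)\<^sup>2" "0 \<le> (a r)\<^sup>2 / r"
        using r by auto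
      moreover have "q r = 1/2 * (r * (c r)\<^sup>2) + 1/2 * ((a r)\<^sup>2 / r)"
        by (simp add: q_def distrib_left)
      ultimately have "q r \<le> 1/2 * ((b r)\<^sup>2 + (c r)\<^sup>2 + 4 * (a r)\<^sup>2 / r\<^sup>2) * r"
        by linarith
      then show ?thesis
        using True r by (simp add: ennreal_leI)
    qed simp
  qed
  also have "\<dots> \<le> ennreal K"
    by (rule assms(3))
  finally have "integral {\<alpha>..\<beta>} q \<le> K"
    using assms(4) by (auto simp: ennreal_le_iff2)
  moreover have "integral {\<alpha>..\<beta>} q = 1/2 * integral {\<alpha>..\<beta>} (\<lambda>r. r * (c r)\<^sup>2 + (a r)\<^sup>2 / r)"
    unfolding q_def by simp
  ultimately show ?thesis
    by simp
qed

lemma E_lin_velocity_integrable: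
  assumes "continuous_on {0<..} b" "E_lin a b c < \<infinity>"
  shows "integrable lborel (\<lambda>r. indicator {0<..} r * ((b r)\<^sup>2 * r))"
proof -
  have [measurable]: "(\<lambda>r. indicator {0<..} r * ((b r)\<^sup>2 * r)) \<in> borel_measurable borel"
  proof -
    have "continuous_on {0<..} (\<lambda>r. (b r)\<^sup>2 * r)"
      by (intro continuous_intros assms(1))
    from borel_measurable_continuous_on_indicator[OF _ this] show ?thesis
      by simp
  qed
  have "(\<integral>\<^sup>+r. ennreal (1/2 * (indicator {0<..} r * ((b r)\<^sup>2 * r))) \<partial>lborel) \<le> E_lin a b c"
    unfolding E_lin_def
  proof (rule nn_integral_mono)
    fix r
    show "ennreal (1/2 * (indicator {0<..} r * ((b r)\<^sup>2 * r))) \<le>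
        ennreal (1/2 * ((b r)\<^sup>2 + (c r)\<^sup>2 + 4 * (a r)\<^sup>2 / r\<^sup>2) * r) * indicator {0<..} r"
    proof (cases "r > 0")
      case True
      have "(b r)\<^sup>2 * r \<le> ((b r)\<^sup>2 + (c r)\<^sup>2 + 4 * (a r)\<^sup>2 / r\<^sup>2) * r"
        using True by (intro mult_right_mono) (auto intro: add_nonneg_nonneg)
      then show ?thesis
        using True by (simp add: ennreal_leI)
    qed simp
  qed
  then have "(\<integral>\<^sup>+r. ennreal (1/2 * (indicator {0<..} r * ((b r)\<^sup>2 * r))) \<partial>lborel) < \<infinity>"
    using assms(2) by (rule le_less_trans)
  then have "integrable lborel (\<lambda>r. 1/2 * (indicator {0<..} r * ((b r)\<^sup>2 * r)))"
  proof (intro integrableI_nonneg)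
    show "(\<lambda>r. 1/2 * (indicator {0<..} r * ((b r)\<^sup>2 * r))) \<in> borel_measurable lborel"
      by measurable
  qed (auto simp: indicator_def)
  then have "integrable lborel (\<lambda>r. 2 * (1/2 * (indicator {0<..} r * ((b r)\<^sup>2 * r))))"
    by (rule integrable_mult_right)
  then show ?thesis
    by simp
qed

lemma radiation_profileE:
  assumes "radiation_profile \<psi> f v"
  obtains vt vr vtt vtr vrt vrr K where
    "has_partials_on ({0..} \<times> {0<..}) v vt vr" "has_partials_on ({0..} \<times> {0<..}) vt vtt vtr"
    "has_partials_on ({0..} \<times> {0<..}) vr vrt vrr"
    "\<And>t r. 0 \<le> t \<Longrightarrow> 0 < r \<Longrightarrow> vtt t r = vrr t r + vr t r / r - 4 * v t r / r\<^sup>2"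
    "\<And>r. 0 < r \<Longrightarrow> v 0 r = 0" "has_hankel2 (vt 0) (profile_data_hat \<psi> f)"
    "0 \<le> K" "\<And>t. 0 \<le> t \<Longrightarrow> E_lin (v t) (vt t) (vr t) \<le> ennreal K"
proof -
  obtain vt vr where 1: "linear_wave_solution v vt vr" "\<And>r. 0 < r \<Longrightarrow> v 0 r = 0"
    "has_hankel2 (vt 0) (profile_data_hat \<psi> f)" "(SUP t\<in>{0..}. E_lin (v t) (vt t) (vr t)) < \<infinity>"
    using assms unfolding radiation_profile_def by blast
  obtain vtt vtr vrt vrr where 2: "has_partials_on ({0..} \<times> {0<..}) v vt vr"
    "has_partials_on ({0..} \<times> {0<..}) vt vtt vtr" "has_partials_on ({0..} \<times> {0<..}) vr vrt vrr"
    "\<forall>(t, r)\<in>{0..} \<times> {0<..}. - vtt t r + vrr t r + 1 / r * vr t r - 4 * v t r / r\<^sup>2 = 0"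
    using 1(1) unfolding linear_wave_solution_def Let_def by blast
  have eq: "vtt t r = vrr t r + vr t r / r - 4 * v t r / r\<^sup>2" if "0 \<le> t" "0 < r" for t r
  proof -
    have "- vtt t r + vrr t r + 1 / r * vr t r - 4 * v t r / r\<^sup>2 = 0"
      using 2(4) that by force
    then show ?thesis by simp
  qed
  have "E_lin (v t) (vt t) (vr t) \<le> ennreal (enn2real (SUP t\<in>{0..}. E_lin (v t) (vt t) (vr t)))"
    if "0 \<le> t" for t
    using 1(4) that by (subst ennreal_enn2real) (auto intro: SUP_upper)
  then show ?thesis
    using that[OF 2(1-3) eq 1(2,3) enn2real_nonneg] by blast
qed

text \<open>\<open>radiation_profile\<close> prescribes the initial velocity through its transform
  and replaces a condition at r = 0 by finite energy, so two injectivity statements meet here. The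
  difference of the velocities is continuous, square integrable for r dr and has zero transform,
  hence vanishes; then the evolution is unique.\<close>

lemma radiation_profile_unique:
  assumes "radiation_profile \<psi> f v" "radiation_profile \<psi> f v'" "0 \<le> t" "0 < r"
  shows "v' t r = v t r"
proof -
  obtain vt vr vtt vtr vrt vrr K where v:
    "has_partials_on ({0..} \<times> {0<..}) v vt vr" "has_partials_on ({0..} \<times> {0<..}) vt vtt vtr"
    "has_partials_on ({0..} \<times> {0<..}) vr vrt vrr"
    "\<And>t r. 0 \<le> t \<Longrightarrow> 0 < r \<Longrightarrow> vtt t r = vrr t r + vr t r / r - 4 * v t r / r\<^sup>2"
    "\<And>r. 0 < r \<Longrightarrow> v 0 r = 0" "has_hankel2 (vt 0) (profile_data_hat \<psi> f)"
    "0 \<le> K" "\<And>t. 0 \<le> t \<Longrightarrow> E_lin (v t) (vt t) (vr t) \<le> ennreal K"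
    by (rule radiation_profileE[OF assms(1)]) (rule that)
  obtain vt' vr' vtt' vtr' vrt' vrr' K' where v':
    "has_partials_on ({0..} \<times> {0<..}) v' vt' vr'" "has_partials_on ({0..} \<times> {0<..}) vt' vtt' vtr'"
    "has_partials_on ({0..} \<times> {0<..}) vr' vrt' vrr'"
    "\<And>t r. 0 \<le> t \<Longrightarrow> 0 < r \<Longrightarrow> vtt' t r = vrr' t r + vr' t r / r - 4 * v' t r / r\<^sup>2"
    "\<And>r. 0 < r \<Longrightarrow> v' 0 r = 0" "has_hankel2 (vt' 0) (profile_data_hat \<psi> f)"
    "0 \<le> K'" "\<And>t. 0 \<le> t \<Longrightarrow> E_lin (v' t) (vt' t) (vr' t) \<le> ennreal K'"
    by (rule radiation_profileE[OF assms(2)]) (rule that)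
  note slice = continuous_on_has_partials_slice[OF has_partials_on_continuous]
  define g where "g r = vt 0 r - vt' 0 r" for r
  have cg: "continuous_on {0<..} g"
    unfolding g_def by (intro continuous_on_diff slice[OF v(2)] slice[OF v'(2)]) auto
  have L2: "integrable lborel (\<lambda>r. indicator {0<..} r * ((g r)\<^sup>2 * r))"
  proof (rule Bochner_Integration.integrable_bound)
    show "integrable lborel (\<lambda>r. 2 * (indicator {0<..} r * ((vt 0 r)\<^sup>2 * r)) + 2 * (indicator {0<..} r * ((vt' 0 r)\<^sup>2 * r)))"
      using v(8)[of 0] v'(8)[of 0]
      by (intro Bochner_Integration.integrable_add integrable_mult_right
          E_lin_velocity_integrable slice[OF v(2)] slice[OF v'(2)]) (auto intro: le_less_trans)
    show "(\<lambda>r. indicator {0<..} r * ((g r)\<^sup>2 * r)) \<in> borel_measurable lborel"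
    proof -
      have "continuous_on {0<..} (\<lambda>r. (g r)\<^sup>2 * r)"
        by (intro continuous_intros cg)
      from borel_measurable_continuous_on_indicator[OF _ this] show ?thesis
        by simp
    qed
    show "AE r in lborel. norm (indicator {0<..} r * ((g r)\<^sup>2 * r)) \<le>
        norm (2 * (indicator {0<..} r * ((vt 0 r)\<^sup>2 * r)) + 2 * (indicator {0<..} r * ((vt' 0 r)\<^sup>2 * r)))"
    proof (rule AE_I2)
      fix r :: real
      have "(g r)\<^sup>2 \<le> 2 * (vt 0 r)\<^sup>2 + 2 * (vt' 0 r)\<^sup>2"
        unfolding g_def using sum_squares_bound[of "vt 0 r" "- vt' 0 r"] by (simp add: power2_diff)
      then have "(g r)\<^sup>2 * r \<le> (2 * (vt 0 r)\<^sup>2 + 2 * (vt' 0 r)\<^sup>2) * r" if "r > 0"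
        using that by (intro mult_right_mono) auto
      then show "norm (indicator {0<..} r * ((g r)\<^sup>2 * r)) \<le>
        norm (2 * (indicator {0<..} r * ((vt 0 r)\<^sup>2 * r)) + 2 * (indicator {0<..} r * ((vt' 0 r)\<^sup>2 * r)))"
        by (cases "r > 0") (auto simp: algebra_simps)
    qed
  qed
  have hankel: "((\<lambda>r. g r * bessel_J 2 (r * \<xi>) * r) has_integral 0) {0<..}" if "0 < \<xi>" for \<xi>
  proof -
    have "((\<lambda>r. vt 0 r * bessel_J 2 (r * \<xi>) * r - vt' 0 r * bessel_J 2 (r * \<xi>) * r) has_integral
        (profile_data_hat \<psi> f \<xi> - profile_data_hat \<psi> f \<xi>)) {0<..}"
      using v(6) v'(6) that by (intro has_integral_diff) (auto simp: has_hankel2_def)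
    then show ?thesis
      by (simp add: g_def algebra_simps)
  qed
  have g0: "g r = 0" if "0 < r" for r
    using gauss_transform_injective[OF cg hankel_zero_imp_gauss_zero[OF cg L2 hankel] that] by blast
  have "v t r - v' t r = 0"
  proof (rule wave_energy_uniqueness[OF has_partials_on_diff[OF v(1) v'(1)]
        has_partials_on_diff[OF v(2) v'(2)] has_partials_on_diff[OF v(3) v'(3)]])
    show "vtt t r - vtt' t r = vrr t r - vrr' t r + (vr t r - vr' t r) / r - 4 * (v t r - v' t r) / r\<^sup>2"
      if "0 \<le> t" "0 < r" for t r
      using v(4)[OF that] v'(4)[OF that] by (simp add: diff_divide_distrib algebra_simps)
    show "vt 0 r - vt' 0 r = 0" if "0 < r" for r
      using g0[OF that] by (simp add: g_def)
    \<comment> \<open>The local bounds 2 K and 2 K' are doubled by (x - y)^2 \<le> 2 x^2 + 2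
      y^2.\<close>
    show "integral {\<alpha>..\<beta>} (\<lambda>r. r * (vr t r - vr' t r)\<^sup>2 + (v t r - v' t r)\<^sup>2 / r) \<le> 4 * K + 4 * K'"
      if "0 \<le> t" "0 < \<alpha>" "\<alpha> < \<beta>" for t \<alpha> \<beta>
    proof -
      have c: "continuous_on {\<alpha>..\<beta>} (v t)" "continuous_on {\<alpha>..\<beta>} (vr t)"
        "continuous_on {\<alpha>..\<beta>} (v' t)" "continuous_on {\<alpha>..\<beta>} (vr' t)"
        using slice[OF v(1)] slice[OF v(3)] slice[OF v'(1)] slice[OF v'(3)] that
        by (auto intro: continuous_on_subset[of "{0<..}"])
      let ?e = "\<lambda>v vr r. r * (vr t r)\<^sup>2 + (v t r)\<^sup>2 / r"
      have ie: "(\<lambda>r. ?e v vr r) integrable_on {\<alpha>..\<beta>}" "(\<lambda>r. ?e v' vr' r) integrable_on {\<alpha>..\<beta>}"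
        using that by (auto intro!: integrable_continuous_interval continuous_intros c)
      have sq: "(x - y)\<^sup>2 \<le> 2 * x\<^sup>2 + 2 * y\<^sup>2" for x y :: real
        using sum_squares_bound[of x "- y"] by (simp add: power2_diff)
      have "integral {\<alpha>..\<beta>} (\<lambda>r. r * (vr t r - vr' t r)\<^sup>2 + (v t r - v' t r)\<^sup>2 / r) \<le>
          integral {\<alpha>..\<beta>} (\<lambda>r. 2 * ?e v vr r + 2 * ?e v' vr' r)"
      proof (rule integral_le)
        show "r * (vr t r - vr' t r)\<^sup>2 + (v t r - v' t r)\<^sup>2 / r \<le> 2 * ?e v vr r + 2 * ?e v' vr' r"
          if "r \<in> {\<alpha>..\<beta>}" for r
        proof -
          have r: "0 < r" using that \<open>0 < \<alpha>\<close> by simp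
          have "r * (vr t r - vr' t r)\<^sup>2 \<le> r * (2 * (vr t r)\<^sup>2 + 2 * (vr' t r)\<^sup>2)"
            "(v t r - v' t r)\<^sup>2 / r \<le> (2 * (v t r)\<^sup>2 + 2 * (v' t r)\<^sup>2) / r"
            using r by (intro mult_left_mono divide_right_mono sq; simp)+
          then show ?thesis
            by (simp add: distrib_left add_divide_distrib)
        qed
      qed (use that in \<open>auto intro!: integrable_continuous_interval continuous_intros c\<close>)
      also have "\<dots> = 2 * integral {\<alpha>..\<beta>} (?e v vr) + 2 * integral {\<alpha>..\<beta>} (?e v' vr')"
        unfolding integral_add[OF integrable_on_mult_right[OF ie(1), of 2] integrable_on_mult_right[OF ie(2), of 2]]
          integral_mult_right ..
      also have "integral {\<alpha>..\<beta>} (?e v vr) \<le> 2 * K"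
        by (rule E_lin_local_bound[OF slice[OF v(1)] slice[OF v(3)] v(8) v(7)]) (use that in auto)
      also have "integral {\<alpha>..\<beta>} (?e v' vr') \<le> 2 * K'"
        by (rule E_lin_local_bound[OF slice[OF v'(1)] slice[OF v'(3)] v'(8) v'(7)]) (use that in auto)
      finally show ?thesis by simp
    qed
  qed (use v(5) v'(5) assms(3,4) in auto)
  then show ?thesis by simp
qed

section \<open>Limits as time tends to infinity, and the family\<close>

lemma energy_path_vanishes:
  assumes "energy_path T v vt vr" "\<And>t. t \<ge> T \<Longrightarrow> E_lin (v t) (vt t) (vr t) < ennreal (C / ln t powr a)" "0 < a"
  shows "energy_vanishes T v"
proof -
  have "((\<lambda>t. C / ln t powr a) \<longlongrightarrow> 0) at_top"
    using assms(3) by real_asymp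
  then have "((\<lambda>t. ennreal (C / ln t powr a)) \<longlongrightarrow> ennreal 0) at_top"
    by (rule tendsto_ennrealI)
  then have lim: "((\<lambda>t. ennreal (C / ln t powr a)) \<longlongrightarrow> 0) at_top"
    by simp
  have "((\<lambda>t. E_lin (v t) (vt t) (vr t)) \<longlongrightarrow> 0) at_top"
  proof (rule tendsto_sandwich[OF _ _ tendsto_const lim])
    show "eventually (\<lambda>t. E_lin (v t) (vt t) (vr t) \<le> ennreal (C / ln t powr a)) at_top"
      using assms(2) by (intro eventually_at_top_linorderI[of T]) (rule less_imp_le)
  qed simp_all
  then show ?thesis
    using assms(1) by (auto simp: energy_vanishes_def)
qed

lemma family_solution_limit:
  assumes "family_solution b f \<psi> T lam0 T0 u lam v1 ve" "(lam0 \<longlongrightarrow> c) at_top"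
  shows "(lam \<longlongrightarrow> c) at_top"
proof -
  obtain e \<epsilon>0 C where e: "\<And>t. t \<ge> T0 \<Longrightarrow> lam t = lam0 t * (1 + e t)" "\<epsilon>0 > 0"
    "\<And>k t. k \<le> 4 \<Longrightarrow> t \<ge> T0 \<Longrightarrow> \<bar>(deriv_on {T0..} ^^ k) e t\<bar> \<le> C / (t ^ k * ln t powr \<epsilon>0)"
    using assms(1) unfolding family_solution_def by blast
  have "\<bar>e t\<bar> \<le> C / ln t powr \<epsilon>0" if "t \<ge> T0" for t
    using e(3)[of 0 t] that by simp
  then have "eventually (\<lambda>t. norm (e t) \<le> C / ln t powr \<epsilon>0) at_top"
    by (auto intro: eventually_at_top_linorderI[of T0])
  moreover have "((\<lambda>t. C / ln t powr \<epsilon>0) \<longlongrightarrow> 0) at_top"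
    using e(2) by real_asymp
  ultimately have "(e \<longlongrightarrow> 0) at_top"
    by (rule Lim_null_comparison)
  then have "((\<lambda>t. lam0 t * (1 + e t)) \<longlongrightarrow> c * (1 + 0)) at_top"
    by (intro tendsto_intros assms(2))
  then have "((\<lambda>t. lam0 t * (1 + e t)) \<longlongrightarrow> c) at_top"
    by simp
  moreover have "eventually (\<lambda>t. lam0 t * (1 + e t) = lam t) at_top"
    using e(1) by (auto intro: eventually_at_top_linorderI[of T0])
  ultimately show ?thesis
    by (rule Lim_transform_eventually)
qed

theorem mainTheorem3:
  fixes b :: real and f :: "real \<Rightarrow> real" and \<Psi> :: "real \<Rightarrow> real \<Rightarrow> real"
  assumes "b > 2/3"
    and "f \<in> F_class b"
    and cutoff: "\<And>T. T > 50 \<Longrightarrow> is_cutoff T (\<Psi> T)"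
    and family: "\<And>M T lam0. symbol_from b M f \<Longrightarrow> M < T \<Longrightarrow> lam0 \<in> Lambda_from b T \<Longrightarrow>
        corresponds T f lam0 \<Longrightarrow>
        \<exists>T0 u lam v1 ve. family_solution b f (\<Psi> T) T lam0 T0 u lam v1 ve"
  shows "\<exists>M T (lam0 :: real \<Rightarrow> real \<Rightarrow> real) v1.
     symbol_from b M f \<and> M < T \<and>
     (\<forall>c>0. lam0 c \<in> Lambda_from b T \<and> corresponds T f (lam0 c) \<and> (lam0 c \<longlongrightarrow> c) at_top) \<and>
     (\<forall>T' lam'. lam' \<in> Lambda_from b T' \<and> corresponds T' f lam' \<longrightarrow>
        (\<exists>!c. c > 0 \<and> (\<forall>t\<ge>max T T'. lam' t = lam0 c t))) \<and>
     radiation_profile (\<Psi> T) f v1 \<and>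
     (\<forall>v1'. radiation_profile (\<Psi> T) f v1' \<longrightarrow> (\<forall>t\<ge>0. \<forall>r>0. v1' t r = v1 t r)) \<and>
     (\<forall>c>0. \<exists>T0 u lam ve. family_solution b f (\<Psi> T) T (lam0 c) T0 u lam v1 ve \<and>
        (lam \<longlongrightarrow> c) at_top \<and> energy_vanishes T0 ve)"
proof -
  obtain M where f: "symbol_from b M f"
    using assms(2) by (auto simp: F_class_def)
  \<comment> \<open>The exponent 4 b - 2 in the decay of the remainder is positive under the same
    condition b > 1/2 that makes the quadratic Riccati term integrable.\<close>
  have b: "1/2 < b" "0 < b" "0 < 4 * b - 2"
    using assms(1) by auto
  obtain T y z C where T: "M < T"
    and y: "\<And>t. t \<ge> T \<Longrightarrow> (y has_real_derivative z t) (at t within {T..})"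
    and z: "\<And>t. t \<ge> T \<Longrightarrow> (z has_real_derivative deriv_on {T..} f t / t * y t) (at t within {T..})"
    and pos: "\<And>t. t \<ge> T \<Longrightarrow> y t > 0" and bd: "\<And>t. t \<ge> T \<Longrightarrow> \<bar>z t\<bar> / y t \<le> C / (t * ln t powr b)"
    and lim: "(y \<longlongrightarrow> 1) at_top"
    by (rule asymptotically_constant_solution[OF b(1) f]) (rule that)
  have T50: "50 < T"
    using f T by (simp add: symbol_from_def)
  \<comment> \<open>The equation is linear and the bound concerns the logarithmic derivative, so all
    multiples share the same \<open>T\<close> and \<open>C\<close>. A common \<open>T\<close> means
    a common cutoff, hence a single profile for the whole family.\<close>
  define lam0 where "lam0 c t = c * y t" for c t
  have lam0: "lam0 c \<in> Lambda_from b T" "corresponds T f (lam0 c)" "(lam0 c \<longlongrightarrow> c) at_top"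
    if "0 < c" for c
  proof -
    have 1: "(lam0 c has_real_derivative c * z t) (at t within {T..})" if "t \<ge> T" for t
      unfolding lam0_def by (rule DERIV_cmult[OF y[OF that]])
    have 2: "((\<lambda>t. c * z t) has_real_derivative deriv_on {T..} f t / t * lam0 c t) (at t within {T..})"
      if "t \<ge> T" for t
      by (rule DERIV_cong[OF DERIV_cmult[OF z[OF that]]]) (simp add: lam0_def)
    have 3: "0 < lam0 c t" "\<bar>c * z t\<bar> / lam0 c t \<le> C / (t * ln t powr b)" if "t \<ge> T" for t
      using pos[OF that] bd[OF that] \<open>0 < c\<close> by (simp_all add: lam0_def abs_mult)
    show "lam0 c \<in> Lambda_from b T" "corresponds T f (lam0 c)"
      by (rule Lambda_fromI[OF f T 1 2 3]; assumption)+
    show "(lam0 c \<longlongrightarrow> c) at_top"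
      unfolding lam0_def using tendsto_mult[OF tendsto_const lim, of c] by simp
  qed
  have lam0_1: "lam0 1 = y"
    by (simp add: lam0_def fun_eq_iff)
  \<comment> \<open>Existence of a profile is taken from the member with parameter 1; the profiles
    of the other members are matched to it by uniqueness.\<close>
  obtain v1 where v1: "radiation_profile (\<Psi> T) f v1"
    using family[OF f T lam0(1,2)[of 1]] unfolding family_solution_def by auto
  have unique: "v1' t r = v1 t r" if "radiation_profile (\<Psi> T) f v1'" "0 \<le> t" "0 < r" for v1' t r
    using radiation_profile_unique[OF v1] that by blast
  have sol: "\<exists>T0 u lam ve. family_solution b f (\<Psi> T) T (lam0 c) T0 u lam v1 ve \<and>
      (lam \<longlongrightarrow> c) at_top \<and> energy_vanishes T0 ve" if c: "0 < c" for c
  proof -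
    obtain T0 u lam v1' ve where fam: "family_solution b f (\<Psi> T) T (lam0 c) T0 u lam v1' ve"
      using family[OF f T lam0(1,2)[OF c]] by blast
    have "T \<le> T0" "radiation_profile (\<Psi> T) f v1'"
      using fam by (auto simp: family_solution_def)
    \<comment> \<open>The decomposition of u refers to the profile only for t \<ge> T0 and r > 0,
      and T0 \<ge> T > 50 lies within the range t \<ge> 0 of uniqueness. So \<open>v1'\<close> can
      be replaced by \<open>v1\<close> with u and the remainder unchanged.\<close>
    then have "v1' t r = v1 t r" if "T0 \<le> t" "0 < r" for t r
      using that T50 by (intro unique) auto
    then have fam1: "family_solution b f (\<Psi> T) T (lam0 c) T0 u lam v1 ve"
      using fam v1 unfolding family_solution_def by simp
    moreover have "(lam \<longlongrightarrow> c) at_top"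
      using family_solution_limit[OF fam lam0(3)[OF c]] .
    moreover obtain vet ver C' where "energy_path T0 ve vet ver"
      "\<forall>t\<ge>T0. E_lin (ve t) (vet t) (ver t) < ennreal (C' / ln t powr (4 * b - 2))"
      using fam unfolding family_solution_def by blast
    then have "energy_vanishes T0 ve"
      using b(3) by (intro energy_path_vanishes) auto
    ultimately show ?thesis
      by blast
  qed
  show ?thesis
  proof (rule exI[of _ M], rule exI[of _ T], rule exI[of _ lam0], rule exI[of _ v1], intro conjI allI impI)
    show "symbol_from b M f" by (rule f)
    show "M < T" by (rule T)
    show "lam0 c \<in> Lambda_from b T" "corresponds T f (lam0 c)" "(lam0 c \<longlongrightarrow> c) at_top"
      if "0 < c" for c
      using lam0[OF that] by auto
    show "\<exists>!c. 0 < c \<and> (\<forall>t\<ge>max T T'. lam' t = lam0 c t)"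
      if "lam' \<in> Lambda_from b T' \<and> corresponds T' f lam'" for T' lam'
      unfolding lam0_def
      using Lambda_from_proportional[OF b(2) lam0(1,2)[of 1, unfolded lam0_1] lim] that by auto
    show "radiation_profile (\<Psi> T) f v1" by (rule v1)
    show "v1' t r = v1 t r" if "radiation_profile (\<Psi> T) f v1'" "0 \<le> t" "0 < r" for v1' t r
      by (rule unique[OF that])
    show "\<exists>T0 u lam ve. family_solution b f (\<Psi> T) T (lam0 c) T0 u lam v1 ve \<and>
      (lam \<longlongrightarrow> c) at_top \<and> energy_vanishes T0 ve" if "0 < c" for c
      by (rule sol[OF that])
  qed
qed

end
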